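(* Let $V$ be a NonNil finite-dimensional irreducible $\mathcal A_q$-module of type $(1,1)$. Then there exists a unique $U_q(\widehat{\mathfrak{sl}}_2)$-module structure on $V$ such that the standard generators $x$ and $y$ of $\mathcal A_q$ act on $V$ as $e_0^+ + K_0$ and $e_1^+ + K_1$ respectively. This $U_q(\widehat{\mathfrak{sl}}_2)$-module is irreducible of type $(1,1)$, and $P_V\big(q^{-1}(q-q^{-1})^{-2}\big)\neq 0$.
   Context: $\mathbb K$ is an algebraically closed field of characteristic $0$, and $q\in\mathbb K$ is nonzero and not a root of unity. For integers $n\ge 0$, $[n]_q=\frac{q^n-q^{-n}}{q-q^{-1}}$, and $[n]_q^!=[n]_q[n-1]_q\cdots[1]_q$ with $[0]_q^!=1$. $\mathcal A_q$ is the unital associative $\mathbb K$-algebra with generators $x,y$ (the standard generators) and relations $x^3y-[3]_qx^2yx+[3]_qxyx^2-yx^3=0$ and $y^3x-[3]_qy^2xy+[3]_qyxy^2-xy^3=0$. A finite-dimensional $\mathcal A_q$-module is NonNil if neither $x$ nor $y$ acts nilpotently on it. For a NonNil finite-dimensional irreducible $\mathcal A_q$-module $V$, it is known that $x,y$ are semisimple on $V$ and that there are an integer $d\ge 0$ and nonzero scalars $\alpha,\alpha^*\in\mathbb K$ such that the set of distinct eigenvalues of $x$ (resp. $y$) on $V$ is $\{\alpha q^{d-2i}\mid 0\le i\le d\}$ (resp. $\{\alpha^* q^{d-2i}\mid 0\le i\le d\}$); the type of $V$ is the ordered pair $(\alpha,\alpha^* )$. $U_q(\widehat{\mathfrak{sl}}_2)$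 is the unital associative $\mathbb K$-algebra with generators $e_i^{\pm},K_i^{\pm1}$ ($i\in\{0,1\}$) and relations $K_iK_i^{-1}=K_i^{-1}K_i=1$; $K_0K_1=K_1K_0$; $K_ie_i^{\pm}K_i^{-1}=q^{\pm2}e_i^{\pm}$; $K_ie_j^{\pm}K_i^{-1}=q^{\mp2}e_j^{\pm}$ for $i\ne j$; $[e_i^+,e_i^-]=\frac{K_i-K_i^{-1}}{q-q^{-1}}$; $[e_0^{\pm},e_1^{\mp}]=0$; and $(e_i^{\pm})^3e_j^{\pm}-[3]_q(e_i^{\pm})^2e_j^{\pm}e_i^{\pm}+[3]_qe_i^{\pm}e_j^{\pm}(e_i^{\pm})^2-e_j^{\pm}(e_i^{\pm})^3=0$ for $i\neq j$. For a finite-dimensional irreducible $U_q(\widehat{\mathfrak{sl}}_2)$-module $V$ it is known (Chari–Pressley) that there are unique $\varepsilon_0,\varepsilon_1\in\{1,-1\}$ and a unique sequence $U_0,\dots,U_d$ of nonzero subspaces with $V=\bigoplus_{i=0}^dU_i$ such that $K_0$ acts on $U_i$ as $\varepsilon_0q^{2i-d}$ and $K_1$ acts on $U_i$ as $\varepsilon_1q^{d-2i}$; moreover $e_0^+U_i\subseteq U_{i+1}$ and $e_1^+U_i\subseteq U_{i-1}$, where $U_{-1}=U_{d+1}=0$. The type of $V$ is $(\varepsilon_0,\varepsilon_1)$. If $V$ has type $(1,1)$ then $\dim U_0=1$; let $\sigma_i$ ($i\ge0$) be the eigenvalue of $(e_1^+)^i(e_0^+)^i$ on $U_0$ (so $\sigma_i=0$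 for $i>d$). The Drinfel'd polynomial of $V$ is $P_V(z)=\sum_{i=0}^\infty\frac{(-1)^i\sigma_iq^iz^i}{([i]_q^!)^2}\in\mathbb K[z]$. In the claim, $P_V$ refers to the $U_q(\widehat{\mathfrak{sl}}_2)$-module structure on $V$. *)

theory Defs
  imports Complex_Main "HOL-Computational_Algebra.Polynomial"
begin

text \<open>
  Throughout, the vector space \<open>V\<close> is the whole type \<open>'v\<close>, with scalar multiplication \<open>s\<close> over
  the field \<open>'k\<close>.  A module over an algebra presented by generators and relations is given by
  the operators by which the generators act: linear endomorphisms satisfying the relations.
\<close>

definition root_of_unity :: "'k::field \<Rightarrow> bool" where
  "root_of_unity q \<longleftrightarrow> (\<exists>n>0. q ^ n = 1)"

definition q_int :: "'k::field \<Rightarrow> nat \<Rightarrow> 'k" where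
  "q_int q n = (q ^ n - inverse q ^ n) / (q - inverse q)"

definition q_fact :: "'k::field \<Rightarrow> nat \<Rightarrow> 'k" where
  "q_fact q n = (\<Prod>k=1..n. q_int q k)"

definition eigenvalues :: "('k::field \<Rightarrow> 'v::ab_group_add \<Rightarrow> 'v) \<Rightarrow> ('v \<Rightarrow> 'v) \<Rightarrow> 'k set" where
  "eigenvalues s f = {c. \<exists>v. v \<noteq> 0 \<and> f v = s c v}"

definition nilpotent_op :: "('v::ab_group_add \<Rightarrow> 'v) \<Rightarrow> bool" where
  "nilpotent_op f \<longleftrightarrow> (\<exists>n. \<forall>v. (f ^^ n) v = 0)"

definition irreducible_under ::
    "('k::field \<Rightarrow> 'v::ab_group_add \<Rightarrow> 'v) \<Rightarrow> ('v \<Rightarrow> 'v) set \<Rightarrow> bool" where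
  "irreducible_under s F \<longleftrightarrow>
     (UNIV :: 'v set) \<noteq> {0} \<and>
     (\<forall>W. module.subspace s W \<and> (\<forall>f\<in>F. f ` W \<subseteq> W) \<longrightarrow> W = {0} \<or> W = UNIV)"

definition q_serre ::
    "('k::field \<Rightarrow> 'v::ab_group_add \<Rightarrow> 'v) \<Rightarrow> 'k \<Rightarrow> ('v \<Rightarrow> 'v) \<Rightarrow> ('v \<Rightarrow> 'v) \<Rightarrow> bool" where
  "q_serre s q a b \<longleftrightarrow>
     (\<forall>v. a (a (a (b v))) - s (q_int q 3) (a (a (b (a v))))
          + s (q_int q 3) (a (b (a (a v)))) - b (a (a (a v))) = 0)"

definition Aq_module ::
    "('k::field \<Rightarrow> 'v::ab_group_add \<Rightarrow> 'v) \<Rightarrow> 'k \<Rightarrow> ('v \<Rightarrow> 'v) \<Rightarrow> ('v \<Rightarrow> 'v) \<Rightarrow> bool" where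
  "Aq_module s q x y \<longleftrightarrow>
     Vector_Spaces.linear s s x \<and> Vector_Spaces.linear s s y \<and>
     q_serre s q x y \<and> q_serre s q y x"

definition Aq_irreducible ::
    "('k::field \<Rightarrow> 'v::ab_group_add \<Rightarrow> 'v) \<Rightarrow> ('v \<Rightarrow> 'v) \<Rightarrow> ('v \<Rightarrow> 'v) \<Rightarrow> bool" where
  "Aq_irreducible s x y \<longleftrightarrow> irreducible_under s {x, y}"

definition NonNil :: "('v::ab_group_add \<Rightarrow> 'v) \<Rightarrow> ('v \<Rightarrow> 'v) \<Rightarrow> bool" where
  "NonNil x y \<longleftrightarrow> \<not> nilpotent_op x \<and> \<not> nilpotent_op y"

definition Aq_has_type ::
    "('k::field \<Rightarrow> 'v::ab_group_add \<Rightarrow> 'v) \<Rightarrow> 'k \<Rightarrow> ('v \<Rightarrow> 'v) \<Rightarrow> ('v \<Rightarrow> 'v) \<Rightarrow> 'k \<times> 'k \<Rightarrow> bool" where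
  "Aq_has_type s q x y = (\<lambda>(\<alpha>, \<alpha>').
     \<alpha> \<noteq> 0 \<and> \<alpha>' \<noteq> 0 \<and>
     (\<exists>d::nat. eigenvalues s x = {\<alpha> * q powi (int d - 2 * int i) | i. i \<le> d} \<and>
               eigenvalues s y = {\<alpha>' * q powi (int d - 2 * int i) | i. i \<le> d}))"

datatype node = N0 | N1

datatype Uq_gen = E_plus node | E_minus node | K node | K_inv node

text \<open>A module structure assigns to each generator the operator by which it acts.\<close>

definition Uq_module ::
    "('k::field \<Rightarrow> 'v::ab_group_add \<Rightarrow> 'v) \<Rightarrow> 'k \<Rightarrow> (Uq_gen \<Rightarrow> 'v \<Rightarrow> 'v) \<Rightarrow> bool" where
  "Uq_module s q \<rho> \<longleftrightarrow>
     (\<forall>g. Vector_Spaces.linear s s (\<rho> g)) \<and>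
     (\<forall>i v. \<rho> (K i) (\<rho> (K_inv i) v) = v \<and> \<rho> (K_inv i) (\<rho> (K i) v) = v) \<and>
     (\<forall>v. \<rho> (K N0) (\<rho> (K N1) v) = \<rho> (K N1) (\<rho> (K N0) v)) \<and>
     (\<forall>i v. \<rho> (K i) (\<rho> (E_plus i) (\<rho> (K_inv i) v)) = s (q powi 2) (\<rho> (E_plus i) v) \<and>
            \<rho> (K i) (\<rho> (E_minus i) (\<rho> (K_inv i) v)) = s (q powi (- 2)) (\<rho> (E_minus i) v)) \<and>
     (\<forall>i j v. i \<noteq> j \<longrightarrow>
            \<rho> (K i) (\<rho> (E_plus j) (\<rho> (K_inv i) v)) = s (q powi (- 2)) (\<rho> (E_plus j) v) \<and>
            \<rho> (K i) (\<rho> (E_minus j) (\<rho> (K_inv i) v)) = s (q powi 2) (\<rho> (E_minus j) v)) \<and>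
     (\<forall>i v. \<rho> (E_plus i) (\<rho> (E_minus i) v) - \<rho> (E_minus i) (\<rho> (E_plus i) v)
            = s (inverse (q - inverse q)) (\<rho> (K i) v - \<rho> (K_inv i) v)) \<and>
     (\<forall>i j v. i \<noteq> j \<longrightarrow>
            \<rho> (E_plus i) (\<rho> (E_minus j) v) - \<rho> (E_minus j) (\<rho> (E_plus i) v) = 0) \<and>
     (\<forall>i j. i \<noteq> j \<longrightarrow>
            q_serre s q (\<rho> (E_plus i)) (\<rho> (E_plus j)) \<and>
            q_serre s q (\<rho> (E_minus i)) (\<rho> (E_minus j)))"

definition Uq_irreducible ::
    "('k::field \<Rightarrow> 'v::ab_group_add \<Rightarrow> 'v) \<Rightarrow> (Uq_gen \<Rightarrow> 'v \<Rightarrow> 'v) \<Rightarrow> bool" where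
  "Uq_irreducible s \<rho> \<longleftrightarrow> irreducible_under s (range \<rho>)"

text \<open>\<open>V\<close> is the direct sum of \<open>U 0, \<dots>, U d\<close>; the values of \<open>U\<close> beyond \<open>d\<close> are irrelevant.\<close>

definition is_direct_sum ::
    "('k::field \<Rightarrow> 'v::ab_group_add \<Rightarrow> 'v) \<Rightarrow> nat \<Rightarrow> (nat \<Rightarrow> 'v set) \<Rightarrow> bool" where
  "is_direct_sum s d U \<longleftrightarrow>
     (\<forall>i\<le>d. module.subspace s (U i)) \<and>
     (\<forall>v. \<exists>!u. (\<forall>i\<le>d. u i \<in> U i) \<and> (\<forall>i>d. u i = 0) \<and> v = (\<Sum>i\<le>d. u i))"

definition Uq_decomposition ::
    "('k::field \<Rightarrow> 'v::ab_group_add \<Rightarrow> 'v) \<Rightarrow> 'k \<Rightarrow> (Uq_gen \<Rightarrow> 'v \<Rightarrow> 'v) \<Rightarrow>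
     'k \<times> 'k \<Rightarrow> nat \<Rightarrow> (nat \<Rightarrow> 'v set) \<Rightarrow> bool" where
  "Uq_decomposition s q \<rho> = (\<lambda>(\<epsilon>\<^sub>0, \<epsilon>\<^sub>1) d U.
     \<epsilon>\<^sub>0 \<in> {1, - 1} \<and> \<epsilon>\<^sub>1 \<in> {1, - 1} \<and>
     is_direct_sum s d U \<and> (\<forall>i\<le>d. U i \<noteq> {0}) \<and>
     (\<forall>i\<le>d. \<forall>u\<in>U i.
        \<rho> (K N0) u = s (\<epsilon>\<^sub>0 * q powi (2 * int i - int d)) u \<and>
        \<rho> (K N1) u = s (\<epsilon>\<^sub>1 * q powi (int d - 2 * int i)) u))"

definition Uq_has_type ::
    "('k::field \<Rightarrow> 'v::ab_group_add \<Rightarrow> 'v) \<Rightarrow> 'k \<Rightarrow> (Uq_gen \<Rightarrow> 'v \<Rightarrow> 'v) \<Rightarrow> 'k \<times> 'k \<Rightarrow> bool" where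
  "Uq_has_type s q \<rho> \<epsilon> \<longleftrightarrow> (\<exists>d U. Uq_decomposition s q \<rho> \<epsilon> d U)"

definition Aq_acts_via ::
    "('v::ab_group_add \<Rightarrow> 'v) \<Rightarrow> ('v \<Rightarrow> 'v) \<Rightarrow> (Uq_gen \<Rightarrow> 'v \<Rightarrow> 'v) \<Rightarrow> bool" where
  "Aq_acts_via x y \<rho> \<longleftrightarrow>
     (\<forall>v. x v = \<rho> (E_plus N0) v + \<rho> (K N0) v) \<and>
     (\<forall>v. y v = \<rho> (E_plus N1) v + \<rho> (K N1) v)"

text \<open>
  The descriptions below determine \<open>U\<^sub>0\<close> and \<open>\<sigma>\<^sub>i\<close> for finite-dimensional irreducible modules of
  type \<open>(1, 1)\<close>, the only ones for which the Drinfel'd polynomial is used: there the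
  decomposition is unique and \<open>U\<^sub>0\<close> has dimension one.
\<close>

definition Uq_U0 ::
    "('k::field \<Rightarrow> 'v::ab_group_add \<Rightarrow> 'v) \<Rightarrow> 'k \<Rightarrow> (Uq_gen \<Rightarrow> 'v \<Rightarrow> 'v) \<Rightarrow> 'v set" where
  "Uq_U0 s q \<rho> = (THE W. \<exists>\<epsilon> d U. Uq_decomposition s q \<rho> \<epsilon> d U \<and> W = U 0)"

definition Uq_sigma ::
    "('k::field \<Rightarrow> 'v::ab_group_add \<Rightarrow> 'v) \<Rightarrow> 'k \<Rightarrow> (Uq_gen \<Rightarrow> 'v \<Rightarrow> 'v) \<Rightarrow> nat \<Rightarrow> 'k" where
  "Uq_sigma s q \<rho> i =
     (THE c. \<forall>u\<in>Uq_U0 s q \<rho>. (\<rho> (E_plus N1) ^^ i) ((\<rho> (E_plus N0) ^^ i) u) = s c u)"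

text \<open>Only finitely many \<open>\<sigma>\<^sub>i\<close> are nonzero; the sum over all \<open>i\<close> is taken over those.\<close>

definition drinfeld_poly ::
    "('k::field \<Rightarrow> 'v::ab_group_add \<Rightarrow> 'v) \<Rightarrow> 'k \<Rightarrow> (Uq_gen \<Rightarrow> 'v \<Rightarrow> 'v) \<Rightarrow> 'k poly" where
  "drinfeld_poly s q \<rho> =
     (\<Sum>i | Uq_sigma s q \<rho> i \<noteq> 0.
        monom ((- 1) ^ i * Uq_sigma s q \<rho> i * q ^ i / (q_fact q i)\<^sup>2) i)"

end

theory Submission
  imports Defs
begin

text \<open>
  Since the eigenvalues of \<open>x\<close> and \<open>y\<close> are nonzero, the cubic \<open>q\<close>-Serre relations say that \<open>y\<close>
  acts tridiagonally on the sum of the eigenspaces of \<open>x\<close> and vice versa; by irreducibility \<open>x\<close>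
  and \<open>y\<close> are diagonalizable.  For each choice of standard orderings of the two eigenspace
  decompositions, the intersections of the two induced flags form a decomposition of \<open>V\<close> on which
  \<open>x\<close> and \<open>y\<close> act bidiagonally.  One choice gives the spaces \<open>U\<^sub>i\<close>, hence \<open>K\<^sub>0\<close>, \<open>K\<^sub>1\<close>, \<open>e\<^sub>0\<^sup>+\<close>
  and \<open>e\<^sub>1\<^sup>+\<close>; another one gives an operator \<open>B\<close> that forms \<open>q\<close>-Weyl pairs with \<open>x\<close>, \<open>y\<close> and
  \<open>K\<^sub>1\<close>, and \<open>e\<^sub>0\<^sup>-\<close> is a multiple of \<open>B K\<^sub>1 - 1\<close>.  Exchanging \<open>x\<close> and \<open>y\<close> gives \<open>e\<^sub>1\<^sup>-\<close>.

  Uniqueness: in any such module structure \<open>K\<^sub>0\<close> preserves both flags and has known eigenvalues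
  on the graded pieces, so it is determined on each \<open>U\<^sub>i\<close>; the difference of two candidates for
  \<open>e\<^sub>0\<^sup>-\<close> commutes with \<open>e\<^sub>0\<^sup>+\<close> and \<open>e\<^sub>1\<^sup>+\<close>, lowers the grading, and has an invariant nonzero kernel.

  The operators \<open>\<sigma>\<^sub>n = (e\<^sub>1\<^sup>+)\<^sup>n (e\<^sub>0\<^sup>+)\<^sup>n\<close> are scalar on \<open>U\<^sub>0\<close>: as a function of \<open>a\<close>, the operator
  \<open>e\<^sup>a f\<^sup>m e\<^sup>(\<^sup>N\<^sup>-\<^sup>a\<^sup>)\<close> is a combination of the \<open>2m+1\<close> exponentials \<open>q\<^sup>2\<^sup>k\<^sup>a\<close> with \<open>|k| \<le> m\<close>, and interpolation
  shows that the \<open>\<sigma>\<^sub>n\<close> commute and that they generate the action on \<open>U\<^sub>0\<close> of all words in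
  \<open>e\<^sub>0\<^sup>+\<close> and \<open>e\<^sub>1\<^sup>+\<close>.  Finally the value of the Drinfel'd polynomial is the factor by which a vector of
  \<open>U\<^sub>0\<close> is multiplied when it is projected to the eigenspace of \<open>x\<close> for \<open>q\<^sup>-\<^sup>d\<close> and back; it
  is nonzero because the corresponding flags are opposite.
\<close>

section \<open>Eigenspaces and the cubic \<open>q\<close>-Serre relations\<close>

locale lin_space = vector_space scale
  for scale :: "'a::field \<Rightarrow> 'b::ab_group_add \<Rightarrow> 'b" (infixr \<open>*s\<close> 75)
begin

abbreviation lin :: "('b \<Rightarrow> 'b) \<Rightarrow> bool" where
  "lin A \<equiv> Vector_Spaces.linear scale scale A"

lemma lin_iff: "lin A \<longleftrightarrow> (\<forall>u v. A (u + v) = A u + A v) \<and> (\<forall>c v. A (c *s v) = c *s A v)"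
  by (simp add: Vector_Spaces.linear_iff vector_space_axioms)

lemma lin_add: "lin A \<Longrightarrow> A (u + v) = A u + A v"
  and lin_scale: "lin A \<Longrightarrow> A (c *s v) = c *s A v"
  by (simp_all add: lin_iff)

lemma lin_zero: "lin A \<Longrightarrow> A 0 = 0"
  by (metis lin_scale scale_zero_left)

lemma lin_neg: "lin A \<Longrightarrow> A (- v) = - A v"
  by (metis lin_add lin_zero add_eq_0_iff)

lemma lin_diff: "lin A \<Longrightarrow> A (u - v) = A u - A v"
  by (metis diff_conv_add_uminus lin_add lin_neg)

lemma lin_sum: "lin A \<Longrightarrow> A (\<Sum>i\<in>I. f i) = (\<Sum>i\<in>I. A (f i))"
  by (induction I rule: infinite_finite_induct) (simp_all add: lin_zero lin_add)

lemmas lin_simps = lin_add lin_scale lin_zero lin_neg lin_diff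

lemma lin_id: "lin (\<lambda>v. v)"
  by (simp add: lin_iff)

lemma lin_comp: "lin A \<Longrightarrow> lin C \<Longrightarrow> lin (\<lambda>v. A (C v))"
  by (simp add: lin_iff)

lemma lin_plus: "lin A \<Longrightarrow> lin C \<Longrightarrow> lin (\<lambda>v. A v + C v)"
  by (simp add: lin_iff scale_right_distrib)

lemma lin_minus: "lin A \<Longrightarrow> lin C \<Longrightarrow> lin (\<lambda>v. A v - C v)"
  by (simp add: lin_iff scale_right_diff_distrib)

lemma lin_scaled: "lin A \<Longrightarrow> lin (\<lambda>v. c *s A v)"
  by (simp add: lin_iff scale_right_distrib)

lemma lin_sum_fun: "(\<And>i. i \<in> I \<Longrightarrow> lin (f i)) \<Longrightarrow> lin (\<lambda>v. \<Sum>i\<in>I. f i v)"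
  by (simp add: lin_iff sum.distrib scale_sum_right)

lemma lin_funpow: "lin A \<Longrightarrow> lin (A ^^ n)"
proof (induction n)
  case 0 show ?case by (simp add: lin_iff)
next
  case (Suc n) then show ?case by (simp add: lin_iff)
qed

lemma lin_subspace_vimage: "lin A \<Longrightarrow> subspace T \<Longrightarrow> subspace {v. A v \<in> T}"
  by (simp add: subspace_def lin_simps)

lemma lin_eq_on_span:
  assumes "lin A" "lin C" "v \<in> span G" "\<And>g. g \<in> G \<Longrightarrow> A g = C g"
  shows "A v = C v"
  using assms(3)
proof (induction rule: span_induct)
  case base show ?case using assms(1,2) by (simp add: subspace_def lin_simps)
next
  case (step g) then show ?case by (rule assms(4))
qed

lemma lin_span_subset:
  assumes "lin A" "v \<in> span G" "subspace T" "\<And>g. g \<in> G \<Longrightarrow> A g \<in> T"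
  shows "A v \<in> T"
  using assms(2)
proof (induction rule: span_induct)
  case base show ?case using lin_subspace_vimage[OF assms(1,3)] by simp
next
  case (step g) then show ?case by (rule assms(4))
qed

lemma funpow_mem: "v \<in> T \<Longrightarrow> (\<And>w. w \<in> T \<Longrightarrow> A w \<in> T) \<Longrightarrow> (A ^^ n) v \<in> T"
  by (induction n) auto

definition eigsp :: "('b \<Rightarrow> 'b) \<Rightarrow> 'a \<Rightarrow> 'b set" where
  "eigsp A c = {v. A v = c *s v}"

lemma eigspI: "A v = c *s v \<Longrightarrow> v \<in> eigsp A c"
  and eigspD: "v \<in> eigsp A c \<Longrightarrow> A v = c *s v"
  by (simp_all add: eigsp_def)

lemma subspace_eigsp: "lin A \<Longrightarrow> subspace (eigsp A c)"
  by (simp add: subspace_def eigsp_def lin_simps scale_right_distrib scale_left_commute)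

text \<open>The product of the operators \<open>A - c\<close> over a list of scalars; it stands in
  for a polynomial in \<open>A\<close> with prescribed roots.\<close>

primrec annih :: "('b \<Rightarrow> 'b) \<Rightarrow> 'a list \<Rightarrow> 'b \<Rightarrow> 'b" where
  "annih A [] v = v"
| "annih A (c # cs) v = annih A cs (A v - c *s v)"

lemma lin_annih: "lin A \<Longrightarrow> lin (annih A cs)"
proof (induction cs)
  case Nil then show ?case by (simp add: lin_iff)
next
  case (Cons c cs)
  have "lin (\<lambda>v. annih A cs (A v - c *s v))"
    by (rule lin_comp[OF Cons.IH[OF Cons.prems]])
       (rule lin_minus[OF Cons.prems lin_scaled[OF lin_id]])
  then show ?case by simp
qed

lemma annih_commute: "lin A \<Longrightarrow> annih A cs (A v - c *s v) = A (annih A cs v) - c *s annih A cs v"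
proof (induction cs arbitrary: v)
  case (Cons a cs)
  have "A (A v - c *s v) - a *s (A v - c *s v) = A (A v - a *s v) - c *s (A v - a *s v)"
    using Cons.prems by (simp add: lin_simps scale_right_diff_distrib scale_left_commute)
  then show ?case using Cons by simp
qed simp

lemma annih_append: "annih A (cs @ ds) v = annih A ds (annih A cs v)"
  by (induction cs arbitrary: v) auto

lemma annih_swap: "lin A \<Longrightarrow> annih A cs (annih A ds v) = annih A ds (annih A cs v)"
  by (induction ds arbitrary: v) (simp_all add: annih_commute)

lemma annih_eigsp: "lin A \<Longrightarrow> v \<in> eigsp A c \<Longrightarrow> annih A cs v = (\<Prod>a\<leftarrow>cs. c - a) *s v"
proof (induction cs arbitrary: v)
  case (Cons a cs)
  have *: "A v - a *s v = (c - a) *s v"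
    using Cons.prems by (simp add: eigsp_def scale_left_diff_distrib)
  show ?case using Cons by (simp add: * lin_scale[OF lin_annih] mult.commute)
qed simp

text \<open>Induction on the list: \<open>A v - c *s v\<close> lies in the sum of the remaining
  eigenspaces, and \<open>A - c\<close> maps that sum onto itself because the roots are distinct.
  Subtracting a preimage from \<open>v\<close> leaves a \<open>c\<close>-eigenvector.\<close>

lemma annih_zero_span:
  assumes "lin A" "distinct cs" "annih A cs v = 0"
  shows "v \<in> span (\<Union>c\<in>set cs. eigsp A c)"
  using assms(2,3)
proof (induction cs arbitrary: v)
  case Nil then show ?case by (simp add: span_zero)
next
  case (Cons c cs)
  let ?G = "\<Union>c\<in>set cs. eigsp A c"
  have "A v - c *s v \<in> span ?G" using Cons by simp
  moreover have "\<exists>w\<in>span ?G. A w - c *s w = z" if "z \<in> span ?G" for z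
    using that
  proof (induction z rule: span_induct)
    case base
    show ?case
    proof (rule subspaceI, goal_cases)
      case 1 show ?case by (auto intro!: bexI[of _ 0] span_zero simp: lin_zero[OF assms(1)])
    next
      case (2 a b)
      then obtain u w where "u \<in> span ?G" "w \<in> span ?G" "A u - c *s u = a" "A w - c *s w = b"
        by auto
      then show ?case
        by (auto intro!: bexI[of _ "u + w"] span_add
            simp: lin_add[OF assms(1)] scale_right_distrib algebra_simps)
    next
      case (3 t a)
      then obtain u where "u \<in> span ?G" "A u - c *s u = a" by auto
      then show ?case
        by (auto intro!: bexI[of _ "t *s u"] span_scale
            simp: lin_scale[OF assms(1)] scale_right_diff_distrib scale_left_commute)
    qed
  next
    case (step g)
    then obtain b where b: "b \<in> set cs" "A g = b *s g" by (auto simp: eigsp_def)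
    then have ne: "b - c \<noteq> 0" using Cons.prems by auto
    have "g \<in> span ?G" using step by (rule span_base)
    moreover have "A (inverse (b - c) *s g) - c *s inverse (b - c) *s g = g"
    proof -
      have "A (inverse (b - c) *s g) - c *s inverse (b - c) *s g
        = (inverse (b - c) * (b - c)) *s g"
        by (simp add: lin_scale[OF assms(1)] b algebra_simps scale_left_diff_distrib)
      then show ?thesis using ne by simp
    qed
    ultimately show ?case by (blast intro: span_scale)
  qed
  ultimately obtain w where w: "w \<in> span ?G" "A w - c *s w = A v - c *s v" by blast
  have "v - w \<in> eigsp A c" using w(2)
    by (simp add: eigsp_def lin_diff[OF assms(1)] scale_right_diff_distrib algebra_simps)
  then have "v - w \<in> span (\<Union>c\<in>set (c # cs). eigsp A c)" by (auto intro: span_base)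
  moreover have "w \<in> span (\<Union>c\<in>set (c # cs). eigsp A c)"
    using w(1) span_mono[of ?G "\<Union>c\<in>set (c # cs). eigsp A c"] by auto
  ultimately show ?case using span_add by fastforce
qed

text \<open>Lists for two summands are concatenated; the factors commute by
  \<open>annih_swap\<close>.\<close>

lemma span_annih:
  assumes "lin A" "v \<in> span (\<Union>c\<in>C. eigsp A c)"
  shows "\<exists>cs. set cs \<subseteq> C \<and> annih A cs v = 0"
  using assms(2)
proof (induction rule: span_induct)
  case base
  show ?case
  proof (rule subspaceI, goal_cases)
    case 1 show ?case by (auto intro!: exI[of _ "[]"])
  next
    case (2 a b)
    then obtain cs ds where "set cs \<subseteq> C" "annih A cs a = 0" "set ds \<subseteq> C" "annih A ds b = 0"
      by auto
    then have "set (cs @ ds) \<subseteq> C \<and> annih A (cs @ ds) (a + b) = 0"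
      by (simp add: annih_append lin_simps[OF lin_annih[OF assms(1)]])
         (metis annih_swap[OF assms(1)] lin_zero[OF lin_annih[OF assms(1)]])
    then show ?case by blast
  next
    case (3 t a)
    then show ?case by (auto simp: lin_scale[OF lin_annih[OF assms(1)]])
  qed
next
  case (step g)
  then obtain c where "c \<in> C" "A g = c *s g" by (auto simp: eigsp_def)
  then show ?case by (intro exI[of _ "[c]"]) auto
qed

text \<open>Some product of factors \<open>A - a\<close> with \<open>a\<close> in \<open>C\<close>
  kills \<open>v\<close>, but it multiplies a \<open>c\<close>-eigenvector by the nonzero product of
  the \<open>c - a\<close>.\<close>

lemma eigsp_independent:
  assumes "lin A" "v \<in> eigsp A c" "v \<in> span (\<Union>c\<in>C. eigsp A c)" "c \<notin> C"
  shows "v = 0"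
proof -
  obtain cs where cs: "set cs \<subseteq> C" "annih A cs v = 0" using span_annih[OF assms(1,3)] by blast
  have "(\<Prod>a\<leftarrow>cs. c - a) \<noteq> 0" using cs(1) assms(4) by (induction cs) auto
  then show ?thesis using cs(2) annih_eigsp[OF assms(1,2), of cs] by simp
qed

end

section \<open>Powers of \<open>q\<close> and the factorization of the cubic Serre
  expression\<close>

lemma q_int_3:
  fixes q :: "'k::field"
  assumes "q \<noteq> 0" "q - inverse q \<noteq> 0"
  shows "q_int q 3 = q powi 2 + 1 + q powi (- 2)"
proof -
  have "q ^ 3 - inverse q ^ 3 = (q powi 2 + 1 + q powi (- 2)) * (q - inverse q)"
    using assms(1) by (simp add: power_int_minus field_simps power2_eq_square power3_eq_cube)
  then show ?thesis using assms(2) by (simp add: q_int_def)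
qed

locale q_space = lin_space scale
  for scale :: "'k::field \<Rightarrow> 'v::ab_group_add \<Rightarrow> 'v" (infixr \<open>*s\<close> 75) +
  fixes q :: 'k
  assumes q_nz: "q \<noteq> 0" and q_gen: "\<not> root_of_unity q"
begin

lemma qpow_eq_1_iff: "q powi n = 1 \<longleftrightarrow> n = 0"
proof
  assume *: "q powi n = 1"
  show "n = 0"
  proof (rule ccontr)
    assume "n \<noteq> 0"
    then have "nat \<bar>n\<bar> > 0" by simp
    moreover have "q ^ nat \<bar>n\<bar> = 1"
      using * by (auto simp: power_int_def abs_if power_inverse split: if_splits)
    ultimately show False using q_gen unfolding root_of_unity_def by blast
  qed
qed simp

lemma qpow_nz [simp]: "q powi n \<noteq> 0"
  using q_nz by simp

lemma qpow_add: "q powi (m + n) = q powi m * q powi n"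
  using q_nz by (simp add: power_int_add)

lemma qpow_mult: "q powi m * q powi n = q powi (m + n)"
  by (simp add: qpow_add)

lemma qpow_eq_iff [simp]: "q powi m = q powi n \<longleftrightarrow> m = n"
proof
  assume "q powi m = q powi n"
  then have "q powi (m - n) = 1" using q_nz by (simp add: power_int_diff)
  then show "m = n" by (simp add: qpow_eq_1_iff)
qed simp

lemma q_diff_nz: "q - inverse q \<noteq> 0"
proof
  assume "q - inverse q = 0"
  then have "q powi 1 = q powi (-1)" by (simp add: power_int_minus)
  then show False by (simp only: qpow_eq_iff)
qed

lemma q_int_3_eq: "q_int q 3 = q powi 2 + 1 + q powi (- 2)"
  by (rule q_int_3[OF q_nz q_diff_nz])

lemma annih3:
  assumes "lin A"
  shows "annih A [a, b, c] w
    = A (A (A w)) - (a + b + c) *s A (A w) + (a * b + b * c + a * c) *s A w - (a * b * c) *s w"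
  by (simp add: lin_simps[OF assms] scale_right_diff_distrib scale_left_distrib algebra_simps)

text \<open>The elementary symmetric functions of the three roots are \<open>[3] t\<close>,
  \<open>[3] t^2\<close> and \<open>t^3\<close>, so on a \<open>t\<close>-eigenvector the Serre
  expression factors into linear terms applied to \<open>C v\<close>.\<close>

lemma annih_cubic:
  assumes "lin A" "lin C" "v \<in> eigsp A t"
  shows "annih A [q powi (- 2) * t, t, q powi 2 * t] (C v)
    = A (A (A (C v))) - q_int q 3 *s A (A (C (A v))) + q_int q 3 *s A (C (A (A v))) - C (A (A (A v)))"
proof -
  have v: "A v = t *s v" using assms(3) by (rule eigspD)
  have inv: "q powi 2 * q powi (- 2) = 1" by (simp only: qpow_mult) simp
  have "q powi (- 2) * t + t + q powi 2 * t = q_int q 3 * t"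
    unfolding q_int_3_eq by algebra
  moreover have "q powi (- 2) * t * t + t * (q powi 2 * t) + q powi (- 2) * t * (q powi 2 * t)
      = q_int q 3 * (t * t)"
    unfolding q_int_3_eq using inv by algebra
  moreover have "q powi (- 2) * t * t * (q powi 2 * t) = t * (t * t)"
    using inv by algebra
  ultimately show ?thesis unfolding annih3[OF assms(1)]
    by (simp add: v lin_scale[OF assms(1)] lin_scale[OF assms(2)])
qed

text \<open>The three roots in \<open>annih_cubic\<close> are distinct because \<open>t\<close> is
  nonzero and \<open>q\<close> is not a root of unity, so \<open>annih_zero_span\<close> applies to
  \<open>C v\<close>.\<close>

lemma serre_tridiag:
  assumes "lin A" "lin C" "q_serre (*s) q A C" "v \<in> eigsp A t" "t \<noteq> 0"
  shows "C v \<in> span (eigsp A (q powi (- 2) * t) \<union> eigsp A t \<union> eigsp A (q powi 2 * t))"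
proof -
  have "annih A [q powi (- 2) * t, t, q powi 2 * t] (C v) = 0"
    unfolding annih_cubic[OF assms(1,2,4)] using assms(3) by (simp add: q_serre_def)
  moreover have "distinct [q powi (- 2) * t, t, q powi 2 * t]"
    using assms(5) qpow_eq_iff[of "-2" 0] qpow_eq_iff[of 2 0] qpow_eq_iff[of "-2" 2]
    by (simp del: qpow_eq_iff power_int_minus)
  ultimately show ?thesis using annih_zero_span[OF assms(1)] by (fastforce simp: Un_assoc)
qed

text \<open>Converse to \<open>serre_tridiag\<close>: each of three neighbouring eigenspaces is
  killed by one factor of the cubic. It yields Serre relations for operators that are built from a
  decomposition.\<close>

lemma tridiag_serre:
  assumes "lin A" "lin C" and span: "span (\<Union>i. S i) = UNIV"
    and eig: "\<And>i v. v \<in> S i \<Longrightarrow> A v = (q powi (2 * i + c)) *s v"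
    and tri: "\<And>i v. v \<in> S i \<Longrightarrow> C v \<in> span (S (i - 1) \<union> S i \<union> S (i + 1))"
  shows "q_serre (*s) q A C"
  unfolding q_serre_def
proof
  fix v
  let ?R = "\<lambda>v. A (A (A (C v))) - q_int q 3 *s A (A (C (A v))) + q_int q 3 *s A (C (A (A v)))
    - C (A (A (A v)))"
  have R: "lin ?R"
    by (intro lin_minus lin_plus lin_scaled lin_comp[OF assms(1)] lin_comp[OF assms(2)] assms(1,2))
  have "?R v = (\<lambda>v. 0) v"
  proof (rule lin_eq_on_span[OF R, of "\<lambda>v. 0" v "\<Union>i. S i"])
    show "lin (\<lambda>v. 0)" by (simp add: lin_iff)
    show "v \<in> span (\<Union>i. S i)" by (simp add: span)
    fix v assume "v \<in> (\<Union>i. S i)"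
    then obtain i where i: "v \<in> S i" by auto
    let ?t = "q powi (2 * i + c)"
    let ?p = "annih A [q powi (- 2) * ?t, ?t, q powi 2 * ?t]"
    have z: "?p w = 0" if "w \<in> eigsp A s" "s = q powi (- 2) * ?t \<or> s = ?t \<or> s = q powi 2 * ?t" for w s
      unfolding annih_eigsp[OF assms(1) that(1)] using that(2) by auto
    have "?p w = 0" if "w \<in> S (i - 1) \<union> S i \<union> S (i + 1)" for w
    proof -
      have e: "w \<in> eigsp A (q powi (2 * k + c))" if "w \<in> S k" for k
        using eig[OF that] by (rule eigspI)
      have "2 * (i - 1) + c = -2 + (2 * i + c)" "2 * (i + 1) + c = 2 + (2 * i + c)" by simp_all
      then show ?thesis using that e[of i] e[of "i - 1"] e[of "i + 1"] z
        by (metis UnE qpow_add)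
    qed
    then have *: "?p w \<in> {0}" if "w \<in> S (i - 1) \<union> S i \<union> S (i + 1)" for w
      using that by (simp del: annih.simps)
    have "?p (C v) \<in> {0}"
      using lin_span_subset[OF lin_annih[OF assms(1)] tri[OF i] subspace_single_0 *] .
    then have "?p (C v) = 0" by (simp only: singleton_iff)
    moreover have "v \<in> eigsp A ?t" using eig[OF i] by (rule eigspI)
    ultimately show "?R v = 0" using annih_cubic[OF assms(1,2), of v ?t] by (simp del: annih.simps)
  qed
  then show "?R v = 0" .
qed

end

section \<open>Split decompositions\<close>

text \<open>The indices are integers and the eigenspaces outside \<open>{0..d}\<close> are zero, so
  that the neighbours \<open>i - 1\<close> and \<open>i + 1\<close> need no boundary cases.\<close>

locale split_decomposition = lin_space scale
  for scale :: "'k::field \<Rightarrow> 'v::ab_group_add \<Rightarrow> 'v" (infixr \<open>*s\<close> 75) +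
  fixes A B :: "'v \<Rightarrow> 'v" and \<alpha> \<beta> :: "int \<Rightarrow> 'k" and d :: int
  assumes lin_A: "lin A" and lin_B: "lin B" and d_nonneg: "0 \<le> d"
    and inj_\<alpha>: "inj \<alpha>" and inj_\<beta>: "inj \<beta>"
    and eig_A_out: "\<And>i. i \<notin> {0..d} \<Longrightarrow> eigsp A (\<alpha> i) = {0}"
    and eig_B_out: "\<And>i. i \<notin> {0..d} \<Longrightarrow> eigsp B (\<beta> i) = {0}"
    and eig_A_in: "\<And>i. i \<in> {0..d} \<Longrightarrow> eigsp A (\<alpha> i) \<noteq> {0}"
    and span_B: "span (\<Union>i. eigsp B (\<beta> i)) = UNIV"
    and tri_A: "\<And>i v. v \<in> eigsp A (\<alpha> i) \<Longrightarrow>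
      B v \<in> span (eigsp A (\<alpha> (i - 1)) \<union> eigsp A (\<alpha> i) \<union> eigsp A (\<alpha> (i + 1)))"
    and tri_B: "\<And>i v. v \<in> eigsp B (\<beta> i) \<Longrightarrow>
      A v \<in> span (eigsp B (\<beta> (i - 1)) \<union> eigsp B (\<beta> i) \<union> eigsp B (\<beta> (i + 1)))"
    and irred: "\<And>W. subspace W \<Longrightarrow> A ` W \<subseteq> W \<Longrightarrow> B ` W \<subseteq> W \<Longrightarrow> W = {0} \<or> W = UNIV"
begin

text \<open>\<open>UE\<close> is a descending flag for \<open>A\<close> and \<open>LF\<close> an
  ascending flag for \<open>B\<close>; their intersections \<open>S i\<close> are the split
  decomposition known from tridiagonal pairs.\<close>

definition UE :: "int \<Rightarrow> 'v set" where "UE i = span (\<Union>j\<in>{i..}. eigsp A (\<alpha> j))"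
definition LF :: "int \<Rightarrow> 'v set" where "LF i = span (\<Union>j\<in>{..i}. eigsp B (\<beta> j))"
definition S :: "int \<Rightarrow> 'v set" where "S i = LF i \<inter> UE i"

lemma subspace_UE: "subspace (UE i)" and subspace_LF: "subspace (LF i)"
  by (simp_all add: UE_def LF_def)

lemma subspace_S: "subspace (S i)"
  by (simp add: S_def subspace_UE subspace_LF subspace_inter)

lemma UE_mono: "i \<le> j \<Longrightarrow> UE j \<subseteq> UE i"
  unfolding UE_def by (intro span_mono UN_mono) auto

lemma LF_mono: "i \<le> j \<Longrightarrow> LF i \<subseteq> LF j"
  unfolding LF_def by (intro span_mono UN_mono) auto

lemma eigsp_UE: "i \<le> j \<Longrightarrow> eigsp A (\<alpha> j) \<subseteq> UE i"
  unfolding UE_def by (auto intro: span_base)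

lemma eigsp_LF: "j \<le> i \<Longrightarrow> eigsp B (\<beta> j) \<subseteq> LF i"
  unfolding LF_def by (auto intro: span_base)

lemma LF_ge_d: assumes "d \<le> i" shows "LF i = UNIV"
proof -
  have "eigsp B (\<beta> j) \<subseteq> LF i" for j
  proof (cases "j \<le> i")
    case True then show ?thesis by (rule eigsp_LF)
  next
    case False
    then have "eigsp B (\<beta> j) = {0}" using assms by (intro eig_B_out) auto
    then show ?thesis using subspace_0[OF subspace_LF] by simp
  qed
  then have "(\<Union>j. eigsp B (\<beta> j)) \<subseteq> LF i" by blast
  then show ?thesis using span_minimal[OF _ subspace_LF] span_B by blast
qed

lemma UE_gt_d: assumes "d < i" shows "UE i = {0}"
proof -
  have "UE i \<subseteq> {0}" unfolding UE_def
    by (rule span_minimal) (use assms eig_A_out in auto)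
  then show ?thesis using subspace_0[OF subspace_UE] by blast
qed

lemma LF_lt_0: assumes "i < 0" shows "LF i = {0}"
proof -
  have "LF i \<subseteq> {0}" unfolding LF_def
    by (rule span_minimal) (use assms eig_B_out in auto)
  then show ?thesis using subspace_0[OF subspace_LF] by blast
qed

lemma lin_shift_A: "lin (\<lambda>v. A v - c *s v)" and lin_shift_B: "lin (\<lambda>v. B v - c *s v)"
  using lin_minus[OF lin_A lin_scaled[OF lin_id]] lin_minus[OF lin_B lin_scaled[OF lin_id]] by auto

lemma A_UE: "v \<in> UE i \<Longrightarrow> A v - \<alpha> i *s v \<in> UE (i + 1)"
  unfolding UE_def[of i]
proof (erule lin_span_subset[OF lin_shift_A _ subspace_UE])
  fix v assume "v \<in> (\<Union>j\<in>{i..}. eigsp A (\<alpha> j))"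
  then obtain j where j: "i \<le> j" "v \<in> eigsp A (\<alpha> j)" by auto
  have *: "A v - \<alpha> i *s v = (\<alpha> j - \<alpha> i) *s v" using j by (simp add: eigsp_def scale_left_diff_distrib)
  show "A v - \<alpha> i *s v \<in> UE (i + 1)"
  proof (cases "j = i")
    case True then show ?thesis using * subspace_0[OF subspace_UE] by simp
  next
    case False
    then have "v \<in> UE (i + 1)" using j eigsp_UE[of "i + 1" j] by auto
    then show ?thesis unfolding * by (rule subspace_scale[OF subspace_UE])
  qed
qed

lemma B_LF: "v \<in> LF i \<Longrightarrow> B v - \<beta> i *s v \<in> LF (i - 1)"
  unfolding LF_def[of i]
proof (erule lin_span_subset[OF lin_shift_B _ subspace_LF])
  fix v assume "v \<in> (\<Union>j\<in>{..i}. eigsp B (\<beta> j))"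
  then obtain j where j: "j \<le> i" "v \<in> eigsp B (\<beta> j)" by auto
  have *: "B v - \<beta> i *s v = (\<beta> j - \<beta> i) *s v" using j by (simp add: eigsp_def scale_left_diff_distrib)
  show "B v - \<beta> i *s v \<in> LF (i - 1)"
  proof (cases "j = i")
    case True then show ?thesis using * subspace_0[OF subspace_LF] by simp
  next
    case False
    then have "v \<in> LF (i - 1)" using j eigsp_LF[of j "i - 1"] by auto
    then show ?thesis unfolding * by (rule subspace_scale[OF subspace_LF])
  qed
qed

lemma B_UE: "v \<in> UE i \<Longrightarrow> B v \<in> UE (i - 1)"
  unfolding UE_def[of i]
proof (erule lin_span_subset[OF lin_B _ subspace_UE])
  fix v assume "v \<in> (\<Union>j\<in>{i..}. eigsp A (\<alpha> j))"
  then obtain j where j: "i \<le> j" "v \<in> eigsp A (\<alpha> j)" by auto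
  then have "eigsp A (\<alpha> (j - 1)) \<union> eigsp A (\<alpha> j) \<union> eigsp A (\<alpha> (j + 1)) \<subseteq> UE (i - 1)"
    by (intro Un_least eigsp_UE) auto
  then show "B v \<in> UE (i - 1)" using tri_A[OF j(2)] span_minimal[OF _ subspace_UE] by blast
qed

lemma A_LF: "v \<in> LF i \<Longrightarrow> A v \<in> LF (i + 1)"
  unfolding LF_def[of i]
proof (erule lin_span_subset[OF lin_A _ subspace_LF])
  fix v assume "v \<in> (\<Union>j\<in>{..i}. eigsp B (\<beta> j))"
  then obtain j where j: "j \<le> i" "v \<in> eigsp B (\<beta> j)" by auto
  then have "eigsp B (\<beta> (j - 1)) \<union> eigsp B (\<beta> j) \<union> eigsp B (\<beta> (j + 1)) \<subseteq> LF (i + 1)"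
    by (intro Un_least eigsp_LF) auto
  then show "A v \<in> LF (i + 1)" using tri_B[OF j(2)] span_minimal[OF _ subspace_LF] by blast
qed

text \<open>\<open>A\<close> minus a scalar moves one step up in both indices, and \<open>B\<close>
  minus a scalar one step down in both; the offset between the indices is kept.\<close>

lemma A_LF_UE:
  assumes "v \<in> LF i \<inter> UE j"
  shows "A v - \<alpha> j *s v \<in> LF (i + 1) \<inter> UE (j + 1)"
  using assms A_UE A_LF LF_mono[of i "i + 1"]
  by (auto intro!: subspace_diff subspace_scale subspace_LF)

lemma B_LF_UE:
  assumes "v \<in> LF i \<inter> UE j"
  shows "B v - \<beta> i *s v \<in> LF (i - 1) \<inter> UE (j - 1)"
  using assms B_LF B_UE UE_mono[of "j - 1" j]
  by (auto intro!: subspace_diff subspace_scale subspace_UE)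

lemma A_S: "v \<in> S i \<Longrightarrow> A v - \<alpha> i *s v \<in> S (i + 1)"
  and B_S: "v \<in> S i \<Longrightarrow> B v - \<beta> i *s v \<in> S (i - 1)"
  using A_LF_UE[of v i i] B_LF_UE[of v i i] by (simp_all add: S_def)

lemma eigsp_UE_zero: "v \<in> eigsp A (\<alpha> i) \<Longrightarrow> v \<in> UE (i + 1) \<Longrightarrow> v = 0"
  using eigsp_independent[OF lin_A, of v "\<alpha> i" "\<alpha> ` {i+1..}"] inj_\<alpha>
  by (simp add: UE_def inj_image_mem_iff)

lemma UE_1_proper: "UE 1 \<noteq> UNIV"
proof
  assume *: "UE 1 = UNIV"
  have "eigsp A (\<alpha> 0) \<subseteq> {0}" using eigsp_UE_zero[of _ 0] * by auto
  then show False using eig_A_in[of 0] d_nonneg subspace_0[OF subspace_eigsp[OF lin_A]] by fastforce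
qed

definition diag_span :: "int \<Rightarrow> 'v set" where "diag_span r = span (\<Union>i. LF i \<inter> UE (i + r))"

text \<open>By \<open>A_LF_UE\<close> and \<open>B_LF_UE\<close> both operators keep the offset
  \<open>r\<close>, so irreducibility applies.\<close>

lemma diag_span_invariant: "diag_span r = {0} \<or> diag_span r = UNIV"
proof (rule irred)
  have sub: "LF i \<inter> UE (i + r) \<subseteq> diag_span r" for i
    unfolding diag_span_def by (auto intro: span_base)
  show "subspace (diag_span r)" by (simp add: diag_span_def)
  have "A v \<in> diag_span r" if "v \<in> diag_span r" for v
    using that[unfolded diag_span_def]
  proof (rule lin_span_subset[OF lin_A])
    show "subspace (diag_span r)" by (simp add: diag_span_def)
    fix v assume "v \<in> (\<Union>i. LF i \<inter> UE (i + r))"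
    then obtain i where i: "v \<in> LF i \<inter> UE (i + r)" by blast
    have "A v - \<alpha> (i + r) *s v \<in> diag_span r"
      using A_LF_UE[OF i] sub[of "i + 1"] by (auto simp: algebra_simps)
    moreover have "\<alpha> (i + r) *s v \<in> diag_span r"
      using i sub[of i] unfolding diag_span_def by (auto intro: span_scale)
    ultimately show "A v \<in> diag_span r"
      using span_add unfolding diag_span_def by fastforce
  qed
  then show "A ` diag_span r \<subseteq> diag_span r" by auto
  have "B v \<in> diag_span r" if "v \<in> diag_span r" for v
    using that[unfolded diag_span_def]
  proof (rule lin_span_subset[OF lin_B])
    show "subspace (diag_span r)" by (simp add: diag_span_def)
    fix v assume "v \<in> (\<Union>i. LF i \<inter> UE (i + r))"
    then obtain i where i: "v \<in> LF i \<inter> UE (i + r)" by blast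
    have "B v - \<beta> i *s v \<in> diag_span r"
      using B_LF_UE[OF i] sub[of "i - 1"] by (auto simp: algebra_simps)
    moreover have "\<beta> i *s v \<in> diag_span r"
      using i sub[of i] unfolding diag_span_def by (auto intro: span_scale)
    ultimately show "B v \<in> diag_span r"
      using span_add unfolding diag_span_def by fastforce
  qed
  then show "B ` diag_span r \<subseteq> diag_span r" by auto
qed

text \<open>For a positive offset every intersection lies in the proper subspace
  \<open>UE 1\<close>, so the invariant space \<open>diag_span r\<close> is not everything and must
  be zero. This is the sense in which the two flags are opposite.\<close>

lemma LF_UE_zero:
  assumes "i < j"
  shows "LF i \<inter> UE j = {0}"
proof -
  define r where "r = j - i"
  then have r: "r \<ge> 1" using assms by simp
  have "LF i \<inter> UE (i + r) \<subseteq> UE 1" for i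
  proof (cases "i < 0")
    case True then show ?thesis using LF_lt_0 subspace_0[OF subspace_UE] by auto
  next
    case False then show ?thesis using UE_mono[of 1 "i + r"] r by auto
  qed
  then have "diag_span r \<subseteq> UE 1"
    unfolding diag_span_def by (intro span_minimal subspace_UE) auto
  then have "diag_span r = {0}" using diag_span_invariant UE_1_proper by auto
  moreover have "LF i \<inter> UE j \<subseteq> diag_span r"
    unfolding diag_span_def r_def
    using span_superset[of "\<Union>k. LF k \<inter> UE (k + (j - i))"] by fastforce
  ultimately show ?thesis
    using subspace_0[OF subspace_LF] subspace_0[OF subspace_UE] by auto
qed

text \<open>The invariant space of offset \<open>0\<close> contains the nonzero eigenspace for
  \<open>\<alpha> d\<close>, since \<open>LF d\<close> is everything.\<close>

lemma span_S: "span (\<Union>i. S i) = UNIV"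
proof -
  have eq: "span (\<Union>i. S i) = diag_span 0" by (simp add: diag_span_def S_def)
  have "eigsp A (\<alpha> d) \<subseteq> S d" using eigsp_UE[of d d] LF_ge_d[of d] by (auto simp: S_def)
  also have "\<dots> \<subseteq> diag_span 0" unfolding eq[symmetric] using span_superset by blast
  finally have "diag_span 0 \<noteq> {0}"
    using eig_A_in[of d] d_nonneg subspace_0[OF subspace_eigsp[OF lin_A]]
    by (metis atLeastAtMost_iff insert_absorb insert_not_empty order_refl subset_singletonD)
  then show ?thesis using eq diag_span_invariant by auto
qed

lemma S_subset_LF: "j \<le> i \<Longrightarrow> S j \<subseteq> LF i" and S_subset_UE: "i \<le> j \<Longrightarrow> S j \<subseteq> UE i"
  using LF_mono[of j i] UE_mono[of i j] by (auto simp: S_def)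

lemma S_out: "i \<notin> {0..d} \<Longrightarrow> S i = {0}"
  using LF_lt_0[of i] UE_gt_d[of i] subspace_0[OF subspace_LF, of i] subspace_0[OF subspace_UE, of i]
  by (cases "i < 0") (auto simp: S_def)

text \<open>Split \<open>v\<close> into its components of index at most \<open>i\<close> and the
  rest; the rest lies in both \<open>LF i\<close> and \<open>UE (i + 1)\<close>, hence
  vanishes.\<close>

lemma LF_eq_span: "LF i = span (\<Union>j\<in>{..i}. S j)"
proof
  show "span (\<Union>j\<in>{..i}. S j) \<subseteq> LF i"
    by (rule span_minimal[OF _ subspace_LF]) (use S_subset_LF in blast)
  show "LF i \<subseteq> span (\<Union>j\<in>{..i}. S j)"
  proof
    fix v assume v: "v \<in> LF i"
    have "(\<Union>j. S j) = (\<Union>j\<in>{..i}. S j) \<union> (\<Union>j\<in>{i+1..}. S j)" by force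
    then have "v \<in> span ((\<Union>j\<in>{..i}. S j) \<union> (\<Union>j\<in>{i+1..}. S j))"
      using span_S by simp
    then obtain a b where ab: "v = a + b" "a \<in> span (\<Union>j\<in>{..i}. S j)" "b \<in> span (\<Union>j\<in>{i+1..}. S j)"
      unfolding span_Un by blast
    have "b \<in> UE (i + 1)" using ab(3) span_minimal[OF _ subspace_UE, of "\<Union>j\<in>{i+1..}. S j" "i + 1"]
      S_subset_UE by blast
    moreover have "a \<in> LF i" using ab(2) span_minimal[OF _ subspace_LF, of "\<Union>j\<in>{..i}. S j" i]
      S_subset_LF by blast
    then have "v - a \<in> LF i" using v by (intro subspace_diff subspace_LF)
    then have "b \<in> LF i" using ab(1) by simp
    ultimately have "b = 0" using LF_UE_zero[of i "i + 1"] by auto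
    then show "v \<in> span (\<Union>j\<in>{..i}. S j)" using ab by simp
  qed
qed

text \<open>The components below \<open>l\<close> are cut off as in \<open>LF_eq_span\<close>. This
  bounds how far an operator that shifts both flags can move a vector of \<open>S i\<close>.\<close>

lemma UE_LF_span:
  assumes "v \<in> LF k" "v \<in> UE l"
  shows "v \<in> span (\<Union>j\<in>{l..k}. S j)"
proof -
  have "(\<Union>j\<in>{..k}. S j) \<subseteq> (\<Union>j\<in>{..l-1}. S j) \<union> (\<Union>j\<in>{l..k}. S j)" by force
  then have "v \<in> span ((\<Union>j\<in>{..l-1}. S j) \<union> (\<Union>j\<in>{l..k}. S j))"
    using assms(1) span_mono unfolding LF_eq_span by blast
  then obtain a b where ab: "v = a + b" "a \<in> span (\<Union>j\<in>{..l-1}. S j)" "b \<in> span (\<Union>j\<in>{l..k}. S j)"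
    unfolding span_Un by blast
  have "span (\<Union>j\<in>{l..k}. S j) \<subseteq> UE l"
    by (rule span_minimal[OF _ subspace_UE]) (rule UN_least, rule S_subset_UE, simp)
  then have "b \<in> UE l" using ab(3) by blast
  then have "v - b \<in> UE l" using assms(2) by (intro subspace_diff subspace_UE)
  then have "a = 0" using ab LF_UE_zero[of "l - 1" l] by (auto simp: LF_eq_span[of "l - 1"])
  then show ?thesis using ab by simp
qed

lemma UE_eq_span: "UE i = span (\<Union>j\<in>{i..}. S j)"
proof
  show "span (\<Union>j\<in>{i..}. S j) \<subseteq> UE i"
    by (rule span_minimal[OF _ subspace_UE]) (use S_subset_UE in blast)
  have "span (\<Union>j\<in>{i..d}. S j) \<subseteq> span (\<Union>j\<in>{i..}. S j)"
    by (rule span_mono) auto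
  then show "UE i \<subseteq> span (\<Union>j\<in>{i..}. S j)"
    using UE_LF_span[of _ d i] LF_ge_d[of d] by blast
qed

text \<open>Otherwise \<open>UE i\<close> would lie in \<open>UE (i + 1)\<close>, which contains no
  nonzero eigenvector for \<open>\<alpha> i\<close>.\<close>

lemma S_nonzero:
  assumes "i \<in> {0..d}"
  shows "S i \<noteq> {0}"
proof
  assume *: "S i = {0}"
  have "(\<Union>j\<in>{i..}. S j) \<subseteq> UE (i + 1)"
  proof
    fix v assume "v \<in> (\<Union>j\<in>{i..}. S j)"
    then obtain j where "i \<le> j" "v \<in> S j" by auto
    then show "v \<in> UE (i + 1)"
      using * S_subset_UE[of "i + 1" j] subspace_0[OF subspace_UE] by (cases "j = i") auto
  qed
  then have "UE i \<subseteq> UE (i + 1)" unfolding UE_eq_span[of i] by (rule span_minimal[OF _ subspace_UE])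
  then have "eigsp A (\<alpha> i) \<subseteq> {0}" using eigsp_UE[of i i] eigsp_UE_zero by fastforce
  then show False
    using eig_A_in[OF assms] subspace_0[OF subspace_eigsp[OF lin_A]] by fastforce
qed

text \<open>The nonzero component of least index \<open>m\<close> is minus the sum of the later
  ones, hence in both \<open>LF m\<close> and \<open>UE (m + 1)\<close>.\<close>

lemma S_sum_unique:
  assumes "\<And>i. u i \<in> S i" "(\<Sum>i\<in>{0..d}. u i) = 0"
  shows "u i = 0"
proof (rule ccontr)
  assume "u i \<noteq> 0"
  define I where "I = {i \<in> {0..d}. u i \<noteq> 0}"
  have "i \<in> I" using assms(1)[of i] S_out[of i] \<open>u i \<noteq> 0\<close> by (auto simp: I_def)
  define m where "m = Min I"
  have fin: "finite I" unfolding I_def by (rule finite_subset[of _ "{0..d}"]) auto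
  have m: "m \<in> I" "\<And>j. j \<in> I \<Longrightarrow> m \<le> j"
    unfolding m_def using fin \<open>i \<in> I\<close> by (auto intro: Min_in)
  have "0 = (\<Sum>i\<in>I. u i)"
    unfolding assms(2)[symmetric] by (rule sum.mono_neutral_right) (auto simp: I_def)
  also have "\<dots> = u m + (\<Sum>i\<in>I - {m}. u i)" using fin m(1) by (rule sum.remove)
  finally have "u m = - (\<Sum>i\<in>I - {m}. u i)" by (simp add: eq_neg_iff_add_eq_0)
  also have "\<dots> \<in> UE (m + 1)"
  proof (intro subspace_neg subspace_sum subspace_UE)
    fix j assume "j \<in> I - {m}"
    then have "m + 1 \<le> j" using m(2)[of j] by auto
    then show "u j \<in> UE (m + 1)" using S_subset_UE[of "m + 1" j] assms(1) by blast
  qed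
  finally have "u m \<in> LF m \<inter> UE (m + 1)" using assms(1)[of m] by (auto simp: S_def)
  then show False using LF_UE_zero[of m "m + 1"] m(1) by (auto simp: I_def)
qed

lemma S_sum_exists: "\<exists>u. (\<forall>i. u i \<in> S i) \<and> v = (\<Sum>i\<in>{0..d}. u i)"
proof -
  have "v \<in> span (\<Union>i. S i)" by (simp add: span_S)
  then show ?thesis
  proof (induction rule: span_induct)
    case base
    show ?case
    proof (rule subspaceI, goal_cases)
      case 1 show ?case
        by (auto intro!: exI[of _ "\<lambda>_. 0"] subspace_0 subspace_S)
    next
      case (2 a b)
      then obtain u w where "\<forall>i. u i \<in> S i" "a = (\<Sum>i\<in>{0..d}. u i)" "\<forall>i. w i \<in> S i" "b = (\<Sum>i\<in>{0..d}. w i)"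
        by auto
      then show ?case
        by (auto intro!: exI[of _ "\<lambda>i. u i + w i"] subspace_add subspace_S simp: sum.distrib)
    next
      case (3 c a)
      then obtain u where "\<forall>i. u i \<in> S i" "a = (\<Sum>i\<in>{0..d}. u i)" by auto
      then show ?case
        by (auto intro!: exI[of _ "\<lambda>i. c *s u i"] subspace_scale subspace_S simp: scale_sum_right)
    qed
  next
    case (step v)
    then obtain k where k: "v \<in> S k" by auto
    show ?case
    proof (cases "k \<in> {0..d}")
      case True
      then show ?thesis
        by (intro exI[of _ "\<lambda>i. if i = k then v else 0"]) (auto simp: k subspace_0 subspace_S)
    next
      case False
      then have "v = 0" using k S_out by auto
      then show ?thesis by (auto intro!: exI[of _ "\<lambda>_. 0"] subspace_0 subspace_S)
    qed
  qed
qed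

text \<open>The choice is forced: the components are unique, also outside \<open>{0..d}\<close>,
  where \<open>S i\<close> is zero.\<close>

definition pr :: "int \<Rightarrow> 'v \<Rightarrow> 'v" where
  "pr i v = (SOME u. (\<forall>i. u i \<in> S i) \<and> v = (\<Sum>i\<in>{0..d}. u i)) i"

lemma pr_mem: "pr i v \<in> S i" and sum_pr: "(\<Sum>i\<in>{0..d}. pr i v) = v"
  using someI_ex[OF S_sum_exists, of v] by (auto simp: pr_def)

lemma pr_unique:
  assumes "\<And>i. u i \<in> S i" "v = (\<Sum>i\<in>{0..d}. u i)"
  shows "pr i v = u i"
proof -
  have "pr i v - u i = 0"
    by (rule S_sum_unique[of "\<lambda>i. pr i v - u i"])
       (simp_all add: subspace_diff subspace_S pr_mem assms(1) sum_subtractf sum_pr assms(2)[symmetric])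
  then show ?thesis by simp
qed

lemma lin_pr: "lin (pr i)"
  unfolding lin_iff
proof (intro conjI allI)
  fix u v c
  show "pr i (u + v) = pr i u + pr i v"
    by (rule pr_unique) (simp_all add: subspace_add subspace_S pr_mem sum.distrib sum_pr)
  show "pr i (c *s v) = c *s pr i v"
    by (rule pr_unique) (simp_all add: subspace_scale subspace_S pr_mem scale_sum_right[symmetric] sum_pr)
qed

lemma pr_S: assumes "v \<in> S k" shows "pr i v = (if i = k then v else 0)"
proof (rule pr_unique)
  show "(if i = k then v else 0) \<in> S i" for i using assms subspace_0[OF subspace_S] by simp
  show "v = (\<Sum>i\<in>{0..d}. if i = k then v else 0)"
    using assms S_out[of k] by (cases "k \<in> {0..d}") auto
qed

definition diagop :: "(int \<Rightarrow> 'k) \<Rightarrow> 'v \<Rightarrow> 'v" where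
  "diagop c v = (\<Sum>i\<in>{0..d}. c i *s pr i v)"

lemma lin_diagop: "lin (diagop c)"
  unfolding diagop_def by (intro lin_sum_fun lin_scaled lin_pr)

lemma diagop_S: assumes "v \<in> S k" shows "diagop c v = c k *s v"
proof -
  have "diagop c v = (\<Sum>i\<in>{0..d}. if i = k then c k *s v else 0)"
    unfolding diagop_def by (rule sum.cong) (simp_all add: pr_S[OF assms])
  then show ?thesis using assms S_out[of k] by (cases "k \<in> {0..d}") auto
qed

lemma eq_on_S: "lin f \<Longrightarrow> lin g \<Longrightarrow> (\<And>i v. v \<in> S i \<Longrightarrow> f v = g v) \<Longrightarrow> f v = g v"
  using lin_eq_on_span[of f g v "\<Union>i. S i"] span_S by auto

lemma eigsp_diagop:
  assumes "inj c"
  shows "eigsp (diagop c) (c k) = S k"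
proof
  show "S k \<subseteq> eigsp (diagop c) (c k)" by (auto intro: eigspI diagop_S)
  show "eigsp (diagop c) (c k) \<subseteq> S k"
  proof
    fix v assume "v \<in> eigsp (diagop c) (c k)"
    then have v: "(\<Sum>i\<in>{0..d}. c i *s pr i v) = c k *s v" by (auto simp: eigsp_def diagop_def)
    have z: "(c i - c k) *s pr i v = 0" for i
    proof (rule S_sum_unique)
      show "(c i - c k) *s pr i v \<in> S i" for i by (simp add: subspace_scale subspace_S pr_mem)
      show "(\<Sum>i\<in>{0..d}. (c i - c k) *s pr i v) = 0"
        by (simp add: scale_left_diff_distrib sum_subtractf v scale_sum_right[symmetric] sum_pr)
    qed
    have "pr i v \<in> S k" for i
      using z[of i] assms pr_mem[of k v] subspace_0[OF subspace_S] by (cases "i = k") (auto dest: injD)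
    then have "(\<Sum>i\<in>{0..d}. pr i v) \<in> S k" by (intro subspace_sum subspace_S)
    then show "v \<in> S k" by (simp add: sum_pr)
  qed
qed

end

section \<open>Serre relations under diagonal shifts, and \<open>q\<close>-Weyl pairs\<close>

context q_space begin

text \<open>Moving every \<open>M\<close> to the right gives a normal form in which all terms with
  an \<open>M\<close> cancel. \<open>Z n\<close> abstracts \<open>q powi (2 * n)\<close> and
  \<open>q powi (- 2 * n)\<close>, which serve the raising and the lowering operators.\<close>

lemma serre_shift_left:
  fixes Z :: "int \<Rightarrow> 'k"
  assumes lin: "lin e" "lin f" "lin M"
    and Z: "\<And>m n. Z m * Z n = Z (m + n)" "Z 0 = 1" "q_int q 3 = Z 1 + 1 + Z (- 1)"
    and Me: "\<And>v. M (e v) = Z 1 *s e (M v)" and Mf: "\<And>v. M (f v) = Z (- 1) *s f (M v)"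
    and xe: "\<And>v. x v = e v + M v"
  shows "x (x (x (f v))) - q_int q 3 *s x (x (f (x v))) + q_int q 3 *s x (f (x (x v))) - f (x (x (x v)))
    = e (e (e (f v))) - q_int q 3 *s e (e (f (e v))) + q_int q 3 *s e (f (e (e v))) - f (e (e (e v)))"
  unfolding Z(3)
  apply (simp only: xe lin_simps[OF lin(1)] lin_simps[OF lin(2)] lin_simps[OF lin(3)] Me Mf Z
      scale_scale scale_right_distrib)
  apply (simp only: scale_left_distrib scale_one Z(1,2) scale_right_distrib scale_scale
      distrib_right distrib_left mult_1_left mult_1_right)
  by (simp add: Z(2) add_ac diff_diff_eq diff_diff_eq2 add_diff_eq diff_add_eq diff_eq_eq eq_diff_eq)

lemma serre_shift_inverse:
  fixes Z :: "int \<Rightarrow> 'k"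
  assumes lin: "lin e" "lin M" "lin L"
    and Z: "\<And>m n. Z m * Z n = Z (m + n)" "Z 0 = 1" "q_int q 3 = Z 1 + 1 + Z (- 1)"
    and Me: "\<And>v. M (e v) = Z 1 *s e (M v)" and Le: "\<And>v. L (e v) = Z (- 1) *s e (L v)"
    and inverses: "\<And>v. M (L v) = v" "\<And>v. L (M v) = v"
    and xe: "\<And>v. x v = e v + M v"
  shows "x (x (x (L v))) - q_int q 3 *s x (x (L (x v))) + q_int q 3 *s x (L (x (x v))) - L (x (x (x v))) = 0"
  unfolding Z(3)
  apply (simp only: xe lin_simps[OF lin(1)] lin_simps[OF lin(2)] lin_simps[OF lin(3)] Me Le inverses Z
      scale_scale scale_right_distrib)
  apply (simp only: scale_left_distrib scale_one Z(1,2) scale_right_distrib scale_scale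
      distrib_right distrib_left mult_1_left mult_1_right)
  by (simp add: Z(2) inverses add_ac diff_diff_eq diff_diff_eq2 add_diff_eq diff_add_eq diff_eq_eq eq_diff_eq)

text \<open>The Serre expression is linear in its second argument: the part with \<open>f\<close>
  loses its \<open>M\<close> terms, and the part with \<open>L\<close>, the inverse of
  \<open>M\<close>, vanishes.\<close>

lemma serre_shift:
  fixes Z :: "int \<Rightarrow> 'k"
  assumes lin: "lin e" "lin f" "lin M" "lin L"
    and Z: "\<And>m n. Z m * Z n = Z (m + n)" "Z 0 = 1" "q_int q 3 = Z 1 + 1 + Z (- 1)"
    and Me: "\<And>v. M (e v) = Z 1 *s e (M v)" and Mf: "\<And>v. M (f v) = Z (- 1) *s f (M v)"
    and inverses: "\<And>v. M (L v) = v" "\<And>v. L (M v) = v"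
    and xe: "\<And>v. x v = e v + M v" and yf: "\<And>v. y v = f v + L v"
  shows "q_serre (*s) q x y \<longleftrightarrow> q_serre (*s) q e f"
proof -
  have "L (e v) = Z (- 1) *s e (L v)" for v
  proof -
    have "M (e (L v)) = Z 1 *s e v" by (simp add: Me inverses)
    then have "L (M (e (L v))) = Z 1 *s L (e v)" by (simp add: lin_scale[OF lin(4)])
    then have "Z (- 1) *s e (L v) = Z (- 1) *s Z 1 *s L (e v)" by (simp add: inverses)
    then show ?thesis by (simp add: Z)
  qed
  note inv = serre_shift_inverse[OF lin(1,3,4) Z Me this inverses xe]
  have lx: "lin x" using lin_plus[OF lin(1,3)] xe by (simp add: lin_iff)
  have "x (x (x (y v))) - q_int q 3 *s x (x (y (x v))) + q_int q 3 *s x (y (x (x v))) - y (x (x (x v)))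
     = (x (x (x (f v))) - q_int q 3 *s x (x (f (x v))) + q_int q 3 *s x (f (x (x v))) - f (x (x (x v))))
     + (x (x (x (L v))) - q_int q 3 *s x (x (L (x v))) + q_int q 3 *s x (L (x (x v))) - L (x (x (x v))))" for v
    by (simp add: yf lin_simps[OF lx] scale_right_distrib)
  then have *: "x (x (x (y v))) - q_int q 3 *s x (x (y (x v))) + q_int q 3 *s x (y (x (x v))) - y (x (x (x v)))
    = e (e (e (f v))) - q_int q 3 *s e (e (f (e v))) + q_int q 3 *s e (f (e (e v))) - f (e (e (e v)))" for v
    using serre_shift_left[OF lin(1,2,3) Z Me Mf xe, of v] inv[of v] by (metis add_0_right)
  show ?thesis unfolding q_serre_def * by (rule refl)
qed

text \<open>The diagonal part of \<open>A\<close> contributes \<open>p - inverse p\<close>, and the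
  off-diagonal part cancels by the ratio of \<open>c (i + k)\<close> to \<open>c i\<close>. In the
  applications \<open>p\<close> is \<open>q\<close> or \<open>inverse q\<close>, according to
  whether the shift divides or multiplies \<open>c\<close> by \<open>q^2\<close>.\<close>

lemma weyl_intro:
  assumes lin: "lin A" "lin C" and span: "span (\<Union>i. S i) = UNIV" and p: "p \<noteq> 0"
    and A: "\<And>i v. v \<in> S i \<Longrightarrow> A v - a i *s v \<in> S (i + k)"
    and C: "\<And>i v. v \<in> S i \<Longrightarrow> C v = c i *s v"
    and ac: "\<And>i. a i * c i = 1" and c: "\<And>i. p * c (i + k) = inverse p * c i"
  shows "p *s C (A v) - inverse p *s A (C v) = (p - inverse p) *s v"
proof (rule lin_eq_on_span[where G = "\<Union>i. S i" and A = "\<lambda>v. p *s C (A v) - inverse p *s A (C v)"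
      and C = "\<lambda>v. (p - inverse p) *s v"])
  show "lin (\<lambda>v. p *s C (A v) - inverse p *s A (C v))"
    by (intro lin_minus lin_scaled lin_comp[OF lin(1)] lin_comp[OF lin(2)] lin)
  show "lin (\<lambda>v. (p - inverse p) *s v)" by (intro lin_scaled lin_id)
  show "v \<in> span (\<Union>i. S i)" by (simp add: span)
  fix v assume "v \<in> (\<Union>i. S i)"
  then obtain i where i: "v \<in> S i" by auto
  define w where "w = A v - a i *s v"
  have w: "w \<in> S (i + k)" "A v = a i *s v + w" using A[OF i] by (simp_all add: w_def)
  have ac': "c i * a i = 1" using ac[of i] by (simp add: mult.commute)
  have "p *s C (A v) - inverse p *s A (C v)
    = (p * (a i * c i)) *s v + (p * c (i + k)) *s w - ((inverse p * (c i * a i)) *s v + (inverse p * c i) *s w)"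
    by (simp add: C[OF i] C[OF w(1)] w(2) lin_simps[OF lin(1)] lin_simps[OF lin(2)] scale_right_distrib
        mult.assoc)
  then show "p *s C (A v) - inverse p *s A (C v) = (p - inverse p) *s v"
    by (simp add: ac ac' c scale_left_diff_distrib)
qed

text \<open>The relation expresses \<open>A (C v)\<close> by \<open>C v\<close> and
  \<open>v\<close>; the multiple \<open>inverse t\<close> of \<open>v\<close> is what must be
  subtracted to leave an eigenvector. So a \<open>q\<close>-Weyl partner of \<open>A\<close> moves
  the eigenspaces of \<open>A\<close> one step.\<close>

lemma weyl_eigsp:
  assumes lin: "lin A" "lin C" and p: "p \<noteq> 0" "t \<noteq> 0" and v: "v \<in> eigsp A t"
    and weyl: "\<And>v. p *s C (A v) - inverse p *s A (C v) = (p - inverse p) *s v"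
  shows "C v - inverse t *s v \<in> eigsp A (p * p * t)"
proof (rule eigspI)
  have Av: "A v = t *s v" using v by (rule eigspD)
  have eq: "a - b = c \<Longrightarrow> b = a - c" for a b c :: 'v by (metis add_diff_cancel_left' add_diff_cancel_right' diff_add_cancel)
  have "inverse p *s A (C v) = p *s C (A v) - (p - inverse p) *s v"
    using weyl[of v] by (rule eq)
  then have "p *s (inverse p *s A (C v)) = p *s (p *s C (A v)) - p *s ((p - inverse p) *s v)"
    by (simp only: scale_right_diff_distrib)
  then have 1: "A (C v) = (p * p * t) *s C v - (p * (p - inverse p)) *s v"
    using p by (simp only: Av lin_scale[OF lin(2)] scale_scale right_inverse scale_one mult.assoc not_False_eq_True)
  have "inverse t * t = 1" "p * p * t * inverse t = 1 + p * (p - inverse p)"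
    using p by (simp_all add: right_diff_distrib)
  then show "A (C v - inverse t *s v) = (p * p * t) *s (C v - inverse t *s v)"
    unfolding lin_diff[OF lin(1)] lin_scale[OF lin(1)] 1 Av scale_right_diff_distrib scale_scale
    by (simp only: scale_left_distrib scale_one diff_diff_eq add.commute)
qed

end

section \<open>The pair \<open>x\<close>, \<open>y\<close> and its raising and lowering operators\<close>

text \<open>The assumptions are symmetric in \<open>x\<close> and \<open>y\<close>, and the set of
  exponents \<open>2 * i - d\<close> is symmetric under negation, so each eigenspace decomposition
  can be read in either direction.\<close>

locale td_pair = q_space scale q
  for scale :: "'k::field \<Rightarrow> 'v::ab_group_add \<Rightarrow> 'v" (infixr \<open>*s\<close> 75) and q :: 'k +
  fixes x y :: "'v \<Rightarrow> 'v" and d :: int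
  assumes d_nonneg: "0 \<le> d" and lin_x: "lin x" and lin_y: "lin y"
    and serre_xy: "q_serre (*s) q x y" and serre_yx: "q_serre (*s) q y x"
    and irred: "\<And>W. subspace W \<Longrightarrow> x ` W \<subseteq> W \<Longrightarrow> y ` W \<subseteq> W \<Longrightarrow> W = {0} \<or> W = UNIV"
    and eigsp_x: "\<And>c. eigsp x c \<noteq> {0} \<longleftrightarrow> (\<exists>i\<in>{0..d}. c = q powi (2 * i - d))"
    and eigsp_y: "\<And>c. eigsp y c \<noteq> {0} \<longleftrightarrow> (\<exists>i\<in>{0..d}. c = q powi (2 * i - d))"
begin

lemma swap: "td_pair (*s) q y x d"
  by (rule td_pair.intro[OF q_space_axioms], rule td_pair_axioms.intro)
    (fact d_nonneg lin_y lin_x serre_yx serre_xy eigsp_y eigsp_x | (rule irred; assumption))+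

lemma tri_x:
  assumes "v \<in> eigsp x (q powi j)"
  shows "y v \<in> span (eigsp x (q powi (j - 2)) \<union> eigsp x (q powi j) \<union> eigsp x (q powi (j + 2)))"
proof -
  have "j - 2 = - 2 + j" "j + 2 = 2 + j" by simp_all
  then show ?thesis
    using serre_tridiag[OF lin_x lin_y serre_xy assms qpow_nz] by (metis qpow_add)
qed

text \<open>The sum of these eigenspaces is stable under \<open>y\<close> by tridiagonality and is
  nonzero, so irreducibility makes \<open>x\<close> diagonalizable.\<close>

lemma span_x: "span (\<Union>j. eigsp x (q powi j)) = UNIV"
proof -
  let ?W = "span (\<Union>j. eigsp x (q powi j))"
  have sub: "eigsp x (q powi j) \<subseteq> ?W" for j by (auto intro: span_base)
  have "x v \<in> ?W" if "v \<in> ?W" for v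
  proof (rule lin_span_subset[OF lin_x that])
    fix v assume "v \<in> (\<Union>j. eigsp x (q powi j))"
    then obtain j where "v \<in> eigsp x (q powi j)" by auto
    then have "x v = q powi j *s v" "v \<in> ?W" using sub[of j] by (auto dest: eigspD)
    then show "x v \<in> ?W" by (auto intro: span_scale)
  qed simp
  then have "x ` ?W \<subseteq> ?W" by auto
  have "y v \<in> ?W" if "v \<in> ?W" for v
  proof (rule lin_span_subset[OF lin_y that])
    fix v assume "v \<in> (\<Union>j. eigsp x (q powi j))"
    then obtain j where j: "v \<in> eigsp x (q powi j)" by auto
    show "y v \<in> ?W"
      using tri_x[OF j] span_minimal[OF _ subspace_span, of "eigsp x (q powi (j - 2)) \<union> eigsp x (q powi j) \<union> eigsp x (q powi (j + 2))"] sub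
      by blast
  qed simp
  then have "y ` ?W \<subseteq> ?W" by auto
  then have "?W = {0} \<or> ?W = UNIV"
    using irred[OF subspace_span \<open>x ` ?W \<subseteq> ?W\<close>] by blast
  moreover have "eigsp x (q powi (2 * 0 - d)) \<noteq> {0}" using eigsp_x d_nonneg by force
  then obtain v where "v \<in> ?W" "v \<noteq> 0"
    using sub[of "2 * 0 - d"] subspace_0[OF subspace_eigsp[OF lin_x]] by blast
  ultimately show ?thesis by auto
qed

text \<open>The two standard orderings of the eigenvalues, given by exponents of \<open>q\<close>;
  reversal preserves tridiagonality.\<close>

definition dir :: "(int \<Rightarrow> int) \<Rightarrow> bool" where
  "dir a \<longleftrightarrow> a = (\<lambda>i. 2 * i - d) \<or> a = (\<lambda>i. d - 2 * i)"

lemma dir_cases: "dir (\<lambda>i. 2 * i - d)" "dir (\<lambda>i. d - 2 * i)"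
  by (simp_all add: dir_def)

lemma dir_inj: "dir a \<Longrightarrow> inj (\<lambda>i. q powi (a i))"
  by (auto simp: dir_def intro!: injI)

lemma dir_eigsp: "dir a \<Longrightarrow> eigsp x (q powi (a i)) \<noteq> {0} \<longleftrightarrow> i \<in> {0..d}"
  unfolding eigsp_x qpow_eq_iff dir_def
proof (elim disjE)
  assume "a = (\<lambda>i. 2 * i - d)"
  then show "(\<exists>k\<in>{0..d}. a i = 2 * k - d) \<longleftrightarrow> i \<in> {0..d}" by auto
next
  assume "a = (\<lambda>i. d - 2 * i)"
  then show "(\<exists>k\<in>{0..d}. a i = 2 * k - d) \<longleftrightarrow> i \<in> {0..d}" by (auto intro!: bexI[of _ "d - i"])
qed

lemma dir_span:
  assumes "dir a"
  shows "span (\<Union>i. eigsp x (q powi (a i))) = UNIV"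
proof -
  have "(\<Union>j. eigsp x (q powi j)) \<subseteq> span (\<Union>i. eigsp x (q powi (a i)))"
  proof
    fix v assume "v \<in> (\<Union>j. eigsp x (q powi j))"
    then obtain j where j: "v \<in> eigsp x (q powi j)" by auto
    show "v \<in> span (\<Union>i. eigsp x (q powi (a i)))"
    proof (cases "eigsp x (q powi j) = {0}")
      case True then show ?thesis using j by (simp add: span_zero)
    next
      case False
      then obtain i where "j = 2 * i - d" unfolding eigsp_x by auto
      then have "j = a i \<or> j = a (d - i)" using assms by (auto simp: dir_def)
      then show ?thesis using j by (auto intro: span_base)
    qed
  qed
  then show ?thesis using span_minimal[OF _ subspace_span] span_x by blast
qed

lemma dir_tri:
  assumes "dir a" "v \<in> eigsp x (q powi (a i))"
  shows "y v \<in> span (eigsp x (q powi (a (i - 1))) \<union> eigsp x (q powi (a i)) \<union> eigsp x (q powi (a (i + 1))))"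
proof -
  have "(a (i - 1) = a i - 2 \<and> a (i + 1) = a i + 2) \<or> (a (i - 1) = a i + 2 \<and> a (i + 1) = a i - 2)"
    using assms(1) by (auto simp: dir_def)
  then show ?thesis using tri_x[OF assms(2)] by (auto simp: Un_ac)
qed

end

lemma (in td_pair) split_dir:
  assumes "dir a" "dir b"
  shows "split_decomposition (*s) x y (\<lambda>i. q powi (a i)) (\<lambda>i. q powi (b i)) d"
proof -
  interpret sw: td_pair "(*s)" q y x d by (rule swap)
  have dirb: "sw.dir b" using assms(2) by (simp add: dir_def sw.dir_def)
  have out: "eigsp x (q powi (a i)) = {0}" "eigsp y (q powi (b i)) = {0}" if "i \<notin> {0..d}" for i
    using dir_eigsp[OF assms(1), of i] sw.dir_eigsp[of b i] dirb that by blast+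
  have ins: "eigsp x (q powi (a i)) \<noteq> {0}" if "i \<in> {0..d}" for i
    using dir_eigsp[OF assms(1)] that by blast
  show ?thesis
    by (rule split_decomposition.intro[OF lin_space_axioms], rule split_decomposition_axioms.intro)
      (fact lin_x lin_y d_nonneg dir_inj[OF assms(1)] sw.dir_inj[OF dirb] out ins
        sw.dir_span[OF dirb] dir_tri[OF assms(1)] sw.dir_tri[OF dirb] | erule out ins | (rule irred; assumption))+
qed

text \<open>\<open>U\<close> pairs ascending exponents of \<open>x\<close> with descending exponents
  of \<open>y\<close>; its spaces become the common eigenspaces of \<open>K_0\<close> and
  \<open>K_1\<close>.\<close>

sublocale td_pair \<subseteq> U: split_decomposition "(*s)" x y "\<lambda>i. q powi (2 * i - d)" "\<lambda>i. q powi (d - 2 * i)" d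
  using split_dir dir_cases by blast

text \<open>\<open>W\<close> uses descending exponents for both. It shares the flag of
  \<open>y\<close> with \<open>U\<close>, which links the two decompositions.\<close>

sublocale td_pair \<subseteq> W: split_decomposition "(*s)" x y "\<lambda>i. q powi (d - 2 * i)" "\<lambda>i. q powi (d - 2 * i)" d
  using split_dir dir_cases by blast

context td_pair begin

text \<open>
  \<open>Kop\<close>, \<open>eop\<close> and, below, \<open>gop\<close> are the actions of \<open>K\<^sub>0\<close>, \<open>e\<^sub>0\<^sup>+\<close> and \<open>e\<^sub>0\<^sup>-\<close>.  The situation is
  symmetric in \<open>x\<close> and \<open>y\<close>, and \<open>swap.Kop\<close>, \<open>swap.eop\<close>, \<open>swap.gop\<close> are the actions of \<open>K\<^sub>1\<close>, \<open>e\<^sub>1\<^sup>+\<close>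
  and \<open>e\<^sub>1\<^sup>-\<close>.  New definitions and facts are available with this prefix only once the context has been
  reopened.
\<close>

definition Kop :: "'v \<Rightarrow> 'v" where "Kop = U.diagop (\<lambda>i. q powi (2 * i - d))"

text \<open>The eigenvalues are inverse to the diagonal entries of both \<open>x\<close> and
  \<open>y\<close> on \<open>W.S i\<close>, as \<open>weyl_intro\<close> demands.\<close>

definition Bop :: "'v \<Rightarrow> 'v" where "Bop = W.diagop (\<lambda>i. q powi (2 * i - d))"

definition eop :: "'v \<Rightarrow> 'v" where "eop v = x v - Kop v"

lemma lin_Kop: "lin Kop" and lin_Bop: "lin Bop"
  by (simp_all only: Kop_def Bop_def U.lin_diagop W.lin_diagop)

lemma lin_eop: "lin eop"
  unfolding eop_def[abs_def] by (rule lin_minus[OF lin_x lin_Kop])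

lemma x_eq: "x v = eop v + Kop v"
  by (simp add: eop_def)

lemma Kop_S: "v \<in> U.S i \<Longrightarrow> Kop v = q powi (2 * i - d) *s v"
  unfolding Kop_def by (rule U.diagop_S)

lemma eop_S: "v \<in> U.S i \<Longrightarrow> eop v \<in> U.S (i + 1)"
  using U.A_S[of v i] by (simp add: eop_def Kop_S)

lemma Kop_eop: "Kop (eop v) = q powi 2 *s eop (Kop v)"
proof (rule U.eq_on_S[of "\<lambda>v. Kop (eop v)" "\<lambda>v. q powi 2 *s eop (Kop v)"])
  fix i v assume v: "v \<in> U.S i"
  have "2 * (i + 1) - d = 2 + (2 * i - d)" by simp
  then show "Kop (eop v) = q powi 2 *s eop (Kop v)"
    unfolding Kop_S[OF v] Kop_S[OF eop_S[OF v]] lin_scale[OF lin_eop] scale_scale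
    by (simp only: qpow_mult)
qed (intro lin_scaled lin_comp[OF lin_eop] lin_comp[OF lin_Kop] lin_eop lin_Kop)+

lemma Bop_x: "q *s x (Bop v) - inverse q *s Bop (x v) = (q - inverse q) *s v"
proof -
  \<comment> \<open>The parameter is \<open>inverse q\<close> here: \<open>x\<close> raises the
    index, which multiplies the eigenvalue of \<open>Bop\<close> by \<open>q^2\<close>.\<close>
  have "inverse q *s Bop (x v) - inverse (inverse q) *s x (Bop v) = (inverse q - inverse (inverse q)) *s v"
  proof (rule weyl_intro[OF lin_x lin_Bop W.span_S, where k = 1])
    show "Bop v = q powi (2 * i - d) *s v" if "v \<in> W.S i" for v i
      unfolding Bop_def using that by (rule W.diagop_S)
    show "inverse q * q powi (2 * (i + 1) - d) = inverse (inverse q) * q powi (2 * i - d)" for i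
      using q_nz by (simp add: power_int_add power_int_diff field_simps power2_eq_square)
    show "q powi (d - 2 * i) * q powi (2 * i - d) = 1" for i by (simp only: qpow_mult) simp
  qed (use q_nz W.A_S in auto)
  then show ?thesis by (simp add: scale_left_diff_distrib algebra_simps)
qed

lemma Bop_y: "q *s Bop (y v) - inverse q *s y (Bop v) = (q - inverse q) *s v"
proof (rule weyl_intro[OF lin_y lin_Bop W.span_S, where k = "-1"])
  show "Bop v = q powi (2 * i - d) *s v" if "v \<in> W.S i" for v i
    unfolding Bop_def using that by (rule W.diagop_S)
  show "q * q powi (2 * (i + - 1) - d) = inverse q * q powi (2 * i - d)" for i
    using q_nz by (simp add: power_int_add power_int_diff field_simps power2_eq_square)
  show "q powi (d - 2 * i) * q powi (2 * i - d) = 1" for i by (simp only: qpow_mult) simp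
qed (use q_nz W.B_S in auto)

end

sublocale td_pair \<subseteq> swap: td_pair "(*s)" q y x d
  by (rule swap)

context td_pair begin

lemma UN_reflect: "(\<Union>j\<in>{..d - i}. F (d - 2 * j)) = (\<Union>j\<in>{i..}. F (2 * j - d))"
  and UN_reflect': "(\<Union>j\<in>{d - i..}. F (2 * j - d)) = (\<Union>j\<in>{..i}. F (d - 2 * j))"
  for F :: "int \<Rightarrow> 'v set"
proof -
  have e: "2 * (d - j) - d = d - 2 * j" "d - 2 * (d - j) = 2 * j - d" for j by simp_all
  show "(\<Union>j\<in>{..d - i}. F (d - 2 * j)) = (\<Union>j\<in>{i..}. F (2 * j - d))"
    using UN_upper[of "d - _" "{i..}" "\<lambda>j. F (2 * j - d)"] UN_upper[of "d - _" "{..d - i}" "\<lambda>j. F (d - 2 * j)"]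
    unfolding e by (intro equalityI UN_least) auto
  show "(\<Union>j\<in>{d - i..}. F (2 * j - d)) = (\<Union>j\<in>{..i}. F (d - 2 * j))"
    using UN_upper[of "d - _" "{d - i..}" "\<lambda>j. F (2 * j - d)"] UN_upper[of "d - _" "{..i}" "\<lambda>j. F (d - 2 * j)"]
    unfolding e by (intro equalityI UN_least) auto
qed

text \<open>Reflecting \<open>i\<close> to \<open>d - i\<close> turns ascending exponents into
  descending ones. Hence exchanging \<open>x\<close> and \<open>y\<close> only reverses the spaces
  \<open>U.S i\<close>, and \<open>Kop\<close> and \<open>swap.Kop\<close> are diagonal on the same
  decomposition.\<close>

lemma swap_UE: "swap.U.UE i = U.LF (d - i)" and swap_LF: "swap.U.LF i = U.UE (d - i)"
  unfolding swap.U.UE_def U.LF_def swap.U.LF_def U.UE_def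
  using UN_reflect[where F = "\<lambda>k. eigsp y (q powi k)"] UN_reflect'[where F = "\<lambda>k. eigsp x (q powi k)"]
  by simp_all

lemma swap_S: "swap.U.S i = U.S (d - i)"
  by (auto simp: swap.U.S_def U.S_def swap_UE swap_LF)

lemma swap_Kop_S: "v \<in> U.S i \<Longrightarrow> swap.Kop v = q powi (d - 2 * i) *s v"
  using swap.Kop_S[of v "d - i"] unfolding swap_S by simp

lemma Kop_inverse: "Kop (swap.Kop v) = v"
proof (rule U.eq_on_S[of "\<lambda>v. Kop (swap.Kop v)" "\<lambda>v. v"])
  fix i v assume v: "v \<in> U.S i"
  show "Kop (swap.Kop v) = v"
    unfolding swap_Kop_S[OF v] lin_scale[OF lin_Kop] Kop_S[OF v] scale_scale
    by (simp only: qpow_mult) simp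
qed (intro lin_id lin_comp[OF lin_Kop] swap.lin_Kop)+

lemma swap_Kop_x: "q *s swap.Kop (x v) - inverse q *s x (swap.Kop v) = (q - inverse q) *s v"
proof (rule weyl_intro[OF lin_x swap.lin_Kop U.span_S, where k = 1])
  show "swap.Kop v = q powi (d - 2 * i) *s v" if "v \<in> U.S i" for v i
    using that by (rule swap_Kop_S)
  show "q * q powi (d - 2 * (i + 1)) = inverse q * q powi (d - 2 * i)" for i
    using q_nz by (simp add: power_int_add power_int_diff field_simps power2_eq_square)
  show "q powi (2 * i - d) * q powi (d - 2 * i) = 1" for i by (simp only: qpow_mult) simp
qed (use q_nz U.A_S in auto)

lemma swap_Kop_LF: 
  assumes "v \<in> U.LF i"
  shows "swap.Kop v - q powi (d - 2 * i) *s v \<in> U.LF (i - 1)"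
proof (rule lin_span_subset[OF lin_minus[OF swap.lin_Kop lin_scaled[OF lin_id]] assms[unfolded U.LF_eq_span] U.subspace_LF])
  fix v assume "v \<in> (\<Union>j\<in>{..i}. U.S j)"
  then obtain j where j: "j \<le> i" "v \<in> U.S j" by auto
  have *: "swap.Kop v - q powi (d - 2 * i) *s v = (q powi (d - 2 * j) - q powi (d - 2 * i)) *s v"
    by (simp only: swap_Kop_S[OF j(2)] scale_left_diff_distrib)
  show "swap.Kop v - q powi (d - 2 * i) *s v \<in> U.LF (i - 1)"
  proof (cases "j = i")
    case True then show ?thesis unfolding * by (simp add: subspace_0[OF U.subspace_LF])
  next
    case False
    then have "v \<in> U.LF (i - 1)" using j U.S_subset_LF[of j "i - 1"] by auto
    then show ?thesis unfolding * by (rule subspace_scale[OF U.subspace_LF])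
  qed
qed

text \<open>By \<open>weyl_eigsp\<close>, \<open>C\<close> raises the exponent of an
  \<open>x\<close>-eigenvector by \<open>2\<close>, up to a multiple of that vector; in the
  descending ordering this lowers the index by one.\<close>

lemma W_UE_shift:
  assumes "lin C" and weyl: "\<And>v. q *s C (x v) - inverse q *s x (C v) = (q - inverse q) *s v"
    and "v \<in> W.UE i"
  shows "C v \<in> W.UE (i - 1)"
proof (rule lin_span_subset[OF assms(1) assms(3)[unfolded W.UE_def] W.subspace_UE])
  fix v assume "v \<in> (\<Union>j\<in>{i..}. eigsp x (q powi (d - 2 * j)))"
  then obtain j where j: "i \<le> j" "v \<in> eigsp x (q powi (d - 2 * j))" by auto
  have "q * q * q powi (d - 2 * j) = q powi (d - 2 * (j - 1))"
    using q_nz by (simp add: power_int_diff power_int_add field_simps power2_eq_square)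
  then have "C v - inverse (q powi (d - 2 * j)) *s v \<in> eigsp x (q powi (d - 2 * (j - 1)))"
    using weyl_eigsp[OF lin_x assms(1) q_nz qpow_nz j(2) weyl] by simp
  then have 1: "C v - inverse (q powi (d - 2 * j)) *s v \<in> W.UE (i - 1)"
    using W.eigsp_UE[of "i - 1" "j - 1"] j(1) by auto
  have "v \<in> W.UE (i - 1)" using W.eigsp_UE[of "i - 1" j] j by auto
  then have "inverse (q powi (d - 2 * j)) *s v \<in> W.UE (i - 1)" by (rule subspace_scale[OF W.subspace_UE])
  from subspace_add[OF W.subspace_UE 1 this] show "C v \<in> W.UE (i - 1)" by simp
qed

text \<open>Here the relation has parameter \<open>inverse q\<close>, so exponents of
  \<open>y\<close> drop by \<open>2\<close> and the index rises by one.\<close>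

lemma W_LF_shift:
  assumes "lin C" and weyl: "\<And>v. q *s y (C v) - inverse q *s C (y v) = (q - inverse q) *s v"
    and "v \<in> W.LF i"
  shows "C v \<in> W.LF (i + 1)"
proof (rule lin_span_subset[OF assms(1) assms(3)[unfolded W.LF_def] W.subspace_LF])
  fix v assume "v \<in> (\<Union>j\<in>{..i}. eigsp y (q powi (d - 2 * j)))"
  then obtain j where j: "j \<le> i" "v \<in> eigsp y (q powi (d - 2 * j))" by auto
  have weyl': "inverse q *s C (y v) - inverse (inverse q) *s y (C v) = (inverse q - inverse (inverse q)) *s v" for v
  proof -
    have "inverse q *s C (y v) - q *s y (C v) = - (q *s y (C v) - inverse q *s C (y v))"
      by (rule minus_diff_eq[symmetric])
    also have "\<dots> = (inverse q - q) *s v"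
      unfolding weyl by (metis minus_diff_eq scale_minus_left)
    finally show ?thesis by (simp only: inverse_inverse_eq)
  qed
  have "inverse q * inverse q * q powi (d - 2 * j) = q powi (d - 2 * (j + 1))"
    using q_nz by (simp add: power_int_diff power_int_add field_simps power2_eq_square)
  then have "C v - inverse (q powi (d - 2 * j)) *s v \<in> eigsp y (q powi (d - 2 * (j + 1)))"
    using weyl_eigsp[OF lin_y assms(1) _ qpow_nz j(2) weyl'] q_nz by simp
  then have 1: "C v - inverse (q powi (d - 2 * j)) *s v \<in> W.LF (i + 1)"
    using W.eigsp_LF[of "j + 1" "i + 1"] j(1) by auto
  have "v \<in> W.LF (i + 1)" using W.eigsp_LF[of j "i + 1"] j by auto
  then have "inverse (q powi (d - 2 * j)) *s v \<in> W.LF (i + 1)" by (rule subspace_scale[OF W.subspace_LF])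
  from subspace_add[OF W.subspace_LF 1 this] show "C v \<in> W.LF (i + 1)" by simp
qed

lemma swap_Kop_W:
  assumes "v \<in> W.S i"
  shows "swap.Kop v - q powi (d - 2 * i) *s v \<in> W.S (i - 1)"
proof -
  \<comment> \<open>\<open>U.LF\<close> and \<open>W.LF\<close> are the same flag of
    \<open>y\<close>.\<close>
  have "swap.Kop v - q powi (d - 2 * i) *s v \<in> W.LF (i - 1)"
    using swap_Kop_LF assms by (simp add: W.S_def)
  moreover have "v \<in> W.UE i" using assms by (simp add: W.S_def)
  then have "v \<in> W.UE (i - 1)" "swap.Kop v \<in> W.UE (i - 1)"
    using W.UE_mono[of "i - 1" i] W_UE_shift[OF swap.lin_Kop swap_Kop_x] by auto
  then have "swap.Kop v - q powi (d - 2 * i) *s v \<in> W.UE (i - 1)"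
    by (intro subspace_diff subspace_scale W.subspace_UE)
  ultimately show ?thesis by (simp add: W.S_def)
qed

text \<open>On the spaces \<open>W.S i\<close> the operator \<open>swap.Kop\<close> has the same
  diagonal entries and the same shift as \<open>y\<close>, so the argument of \<open>Bop_y\<close>
  repeats.\<close>

lemma swap_Kop_Bop: "q *s Bop (swap.Kop v) - inverse q *s swap.Kop (Bop v) = (q - inverse q) *s v"
proof (rule weyl_intro[OF swap.lin_Kop lin_Bop W.span_S, where k = "-1"])
  show "Bop v = q powi (2 * i - d) *s v" if "v \<in> W.S i" for v i
    unfolding Bop_def using that by (rule W.diagop_S)
  show "q * q powi (2 * (i + - 1) - d) = inverse q * q powi (2 * i - d)" for i
    using q_nz by (simp add: power_int_add power_int_diff field_simps power2_eq_square)
  show "q powi (d - 2 * i) * q powi (2 * i - d) = 1" for i by (simp only: qpow_mult) simp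
qed (use q_nz swap_Kop_W in auto)

text \<open>\<open>swap.Bop\<close> forms \<open>q\<close>-Weyl pairs with \<open>y\<close> and
  \<open>x\<close> and therefore moves each of the two flags of \<open>W\<close> by at most one
  step.\<close>

lemma swap_Bop_tri:
  assumes "v \<in> W.S i"
  shows "swap.Bop v \<in> span (W.S (i - 1) \<union> W.S i \<union> W.S (i + 1))"
proof -
  have "swap.Bop v \<in> W.LF (i + 1)" "swap.Bop v \<in> W.UE (i - 1)"
    using W_LF_shift[OF swap.lin_Bop swap.Bop_x] W_UE_shift[OF swap.lin_Bop swap.Bop_y] assms
    by (auto simp: W.S_def)
  then have "swap.Bop v \<in> span (\<Union>j\<in>{i - 1..i + 1}. W.S j)" by (rule W.UE_LF_span)
  moreover have "{i - 1..i + 1} = {i - 1, i, i + 1}" by auto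
  ultimately show ?thesis by (simp add: Un_ac)
qed

lemma serre_Bop: "q_serre (*s) q Bop swap.Bop"
proof (rule tridiag_serre[OF lin_Bop swap.lin_Bop W.span_S _ swap_Bop_tri])
  show "Bop v = q powi (2 * i + - d) *s v" if "v \<in> W.S i" for i v
    unfolding Bop_def using W.diagop_S[OF that, of "\<lambda>i. q powi (2 * i - d)"] by simp
qed

end

section \<open>Commutation and Serre relations of the lowering operators\<close>

context q_space begin

lemma weyl_solve:
  assumes "q *s u - inverse q *s w = (q - inverse q) *s v"
  shows "u = q powi (- 2) *s w + (1 - q powi (- 2)) *s v"
proof -
  have eq: "a - b = c \<Longrightarrow> a = b + c" for a b c :: 'v by (metis diff_add_cancel add.commute)
  have "inverse q *s (q *s u) = inverse q *s (inverse q *s w + (q - inverse q) *s v)"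
    by (simp only: eq[OF assms])
  moreover have "inverse q * q = 1" "inverse q * inverse q = q powi (- 2)"
    "inverse q * (q - inverse q) = 1 - q powi (- 2)"
    using q_nz by (simp_all add: power_int_minus power2_eq_square field_simps)
  ultimately show ?thesis by (simp only: scale_right_distrib scale_scale scale_one)
qed

text \<open>Every word in the Serre relation contains \<open>N\<close> three times and its inverse
  \<open>M\<close> once. Moving them to the right leaves \<open>N (N v)\<close>, the commutation
  factors cancel, and all words carry the common scalar \<open>k^4\<close>.\<close>

lemma serre_twist:
  assumes PR: "P * R = 1" and lin: "lin a" "lin b" "lin M" "lin N"
    and Na: "\<And>v. N (a v) = P *s a (N v)" and Nb: "\<And>v. N (b v) = R *s b (N v)"
    and Ma: "\<And>v. M (a v) = R *s a (M v)"
    and NM: "\<And>v. N (M v) = v" "\<And>v. M (N v) = v"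
    and g: "\<And>v. g v = k *s a (N v)" and h: "\<And>v. h v = k *s b (M v)"
    and serre: "q_serre (*s) q a b"
  shows "q_serre (*s) q g h"
  unfolding q_serre_def
proof
  fix v
  let ?w = "N (N v)"
  have cancel: "P * (R * c) = c" for c using PR by (simp add: mult.assoc[symmetric])
  note simps = g h lin_scale[OF lin(1)] lin_scale[OF lin(2)] lin_scale[OF lin(3)] lin_scale[OF lin(4)]
    Na Nb Ma NM scale_scale
  have 1: "g (g (g (h v))) = (k * (k * (k * k))) *s a (a (a (b ?w)))"
    "g (g (h (g v))) = (k * (k * (k * k))) *s a (a (b (a ?w)))"
    "g (h (g (g v))) = (k * (k * (k * k))) *s a (b (a (a ?w)))"
    "h (g (g (g v))) = (k * (k * (k * k))) *s b (a (a (a ?w)))"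
    by (simp_all only: simps) (simp_all add: mult_ac cancel PR)
  have "g (g (g (h v))) - q_int q 3 *s g (g (h (g v))) + q_int q 3 *s g (h (g (g v))) - h (g (g (g v)))
    = (k * (k * (k * k))) *s (a (a (a (b ?w))) - q_int q 3 *s a (a (b (a ?w)))
      + q_int q 3 *s a (b (a (a ?w))) - b (a (a (a ?w))))"
    unfolding 1 by (simp only: scale_right_distrib scale_right_diff_distrib scale_scale mult.commute)
  then show "g (g (g (h v))) - q_int q 3 *s g (g (h (g v))) + q_int q 3 *s g (h (g (g v))) - h (g (g (g v))) = 0"
    using serre by (simp add: q_serre_def)
qed

end

context td_pair begin

lemma swap_Kop_inverse: "swap.Kop (Kop v) = v"
  by (rule swap.Kop_inverse)

lemma swap_Kop_swap_eop: "swap.Kop (swap.eop v) = q powi 2 *s swap.eop (swap.Kop v)"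
  by (rule swap.Kop_eop)

lemma Kop_swap_eop: "Kop (swap.eop v) = q powi (- 2) *s swap.eop (Kop v)"
proof -
  have "swap.Kop (swap.eop (Kop v)) = q powi 2 *s swap.eop v"
    by (simp only: swap_Kop_swap_eop swap_Kop_inverse)
  then have "Kop (swap.Kop (swap.eop (Kop v))) = Kop (q powi 2 *s swap.eop v)" by (simp only:)
  then have "swap.eop (Kop v) = q powi 2 *s Kop (swap.eop v)"
    by (simp only: Kop_inverse lin_scale[OF lin_Kop])
  then have "q powi (- 2) *s swap.eop (Kop v) = (q powi (- 2) * q powi 2) *s Kop (swap.eop v)"
    by (simp only: scale_scale)
  then show ?thesis by (simp only: qpow_mult) simp
qed

definition gop :: "'v \<Rightarrow> 'v" where
  "gop v = (- q * inverse ((q - inverse q)\<^sup>2)) *s (Bop (swap.Kop v) - v)"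

lemma lin_gop: "lin gop"
  unfolding gop_def[abs_def]
  by (intro lin_scaled lin_minus lin_comp[OF lin_Bop] swap.lin_Kop lin_id)

lemmas Kop_lin = lin_simps[OF lin_Kop] lin_simps[OF swap.lin_Kop] lin_simps[OF lin_Bop]
  lin_simps[OF lin_eop] lin_simps[OF swap.lin_eop] lin_simps[OF lin_gop] lin_simps[OF lin_x] lin_simps[OF lin_y]

lemma Kop_Bop: "Kop (Bop v) = q powi (- 2) *s Bop (Kop v) + (1 - q powi (- 2)) *s Kop (Kop v)"
proof -
  have "Bop (swap.Kop (Kop v)) = q powi (- 2) *s swap.Kop (Bop (Kop v)) + (1 - q powi (- 2)) *s Kop v"
    by (rule weyl_solve[OF swap_Kop_Bop])
  then have "Kop (Bop v) = Kop (q powi (- 2) *s swap.Kop (Bop (Kop v)) + (1 - q powi (- 2)) *s Kop v)"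
    by (simp only: swap_Kop_inverse)
  then show ?thesis by (simp only: Kop_lin Kop_inverse)
qed

lemma Kop_gop: "Kop (gop v) = q powi (- 2) *s gop (Kop v)"
proof -
  have "Kop (Bop (swap.Kop v)) - Kop v = q powi (- 2) *s (Bop v - Kop v)"
    unfolding Kop_Bop[of "swap.Kop v"] Kop_inverse
    by (simp only: scale_left_diff_distrib scale_right_diff_distrib scale_one) simp
  then show ?thesis unfolding gop_def Kop_lin swap_Kop_inverse
    by (simp only: scale_left_commute)
qed

text \<open>Three \<open>q\<close>-Weyl relations reduce both products to the same quadratic term,
  which cancels. The scalar in \<open>gop\<close> is chosen so that its product with
  \<open>1 - q powi (- 2)\<close> is \<open>- inverse (q - inverse q)\<close>.\<close>

lemma eop_gop: "eop (gop v) - gop (eop v) = inverse (q - inverse q) *s (Kop v - swap.Kop v)"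
proof -
  let ?r = "q powi (- 2)" and ?k = "- q * inverse ((q - inverse q)\<^sup>2)"
  have 1: "x (Bop (swap.Kop v)) = ?r *s Bop (x (swap.Kop v)) + (1 - ?r) *s swap.Kop v"
    by (rule weyl_solve[OF Bop_x])
  have 2: "Bop (swap.Kop (x v)) = ?r *s Bop (x (swap.Kop v)) + (1 - ?r) *s Bop v"
    unfolding weyl_solve[OF swap_Kop_x] Kop_lin ..
  have 3: "Kop (Bop (swap.Kop v)) = ?r *s Bop v + (1 - ?r) *s Kop v"
    unfolding Kop_Bop Kop_inverse ..
  have "eop (Bop (swap.Kop v) - v) - (Bop (swap.Kop (eop v)) - eop v)
    = x (Bop (swap.Kop v)) - Kop (Bop (swap.Kop v)) - Bop (swap.Kop (x v)) + Bop v"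
    unfolding eop_def Kop_lin swap_Kop_inverse by simp
  also have "\<dots> = (1 - ?r) *s (swap.Kop v - Kop v)"
    unfolding 1 2 3 by (simp only: scale_left_diff_distrib scale_right_diff_distrib scale_one) simp
  finally have *: "eop (Bop (swap.Kop v) - v) - (Bop (swap.Kop (eop v)) - eop v)
    = (1 - ?r) *s (swap.Kop v - Kop v)" .
  have "eop (gop v) - gop (eop v) = (?k * (1 - ?r)) *s (swap.Kop v - Kop v)"
    unfolding gop_def lin_scale[OF lin_eop] scale_right_diff_distrib[symmetric] *
    by (simp only: scale_scale)
  also have "?k * (1 - ?r) = - inverse (q - inverse q)"
  proof -
    have "q * (1 - ?r) = q - inverse q" using q_nz by (simp add: power_int_minus field_simps power2_eq_square)
    moreover have "?k * (1 - ?r) = - (q * (1 - ?r) * inverse ((q - inverse q)\<^sup>2))"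
      by (simp only: mult_minus_left mult_minus_right mult.assoc mult.left_commute mult.commute)
    moreover have "c * inverse (c\<^sup>2) = inverse c" for c :: 'k
      by (cases "c = 0") (simp_all add: power2_eq_square)
    ultimately show ?thesis by metis
  qed
  finally show ?thesis by (metis minus_diff_eq scale_minus_left scale_minus_right)
qed

text \<open>\<open>y\<close> and \<open>swap.Kop\<close> satisfy the same \<open>q\<close>-Weyl
  relation with \<open>Bop\<close>, so the constant terms cancel in their difference
  \<open>swap.eop\<close>.\<close>

lemma Bop_swap_eop: "Bop (swap.eop v) = q powi (- 2) *s swap.eop (Bop v)"
  unfolding swap.eop_def lin_diff[OF lin_Bop] weyl_solve[OF Bop_y] weyl_solve[OF swap_Kop_Bop]
  by (simp only: scale_right_diff_distrib) simp

lemma gop_swap_eop: "gop (swap.eop v) = swap.eop (gop v)"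
proof -
  have "q powi 2 * q powi (- 2) = 1" by (simp only: qpow_mult) simp
  then show ?thesis
    unfolding gop_def swap_Kop_swap_eop Kop_lin Bop_swap_eop scale_scale by simp
qed

lemma swap_Kop_gop: "swap.Kop (gop v) = q powi 2 *s gop (swap.Kop v)"
proof -
  have "Kop (gop (swap.Kop v)) = q powi (- 2) *s gop v"
    by (simp only: Kop_gop Kop_inverse)
  then have "q powi 2 *s swap.Kop (Kop (gop (swap.Kop v))) = q powi 2 *s swap.Kop (q powi (- 2) *s gop v)" by (simp only:)
  then have "q powi 2 *s gop (swap.Kop v) = (q powi 2 * q powi (- 2)) *s swap.Kop (gop v)"
    by (simp only: swap_Kop_inverse lin_scale[OF swap.lin_Kop] scale_scale)
  then show ?thesis by (simp only: qpow_mult) simp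
qed

end

context td_pair begin

text \<open>\<open>gop\<close> is a multiple of \<open>b\<close> after \<open>swap.Kop\<close>,
  where \<open>b = Bop - Kop\<close>. The relation passes from \<open>Bop\<close>,
  \<open>swap.Bop\<close> to \<open>b\<close>, \<open>b'\<close> by \<open>serre_shift\<close>, and
  from there to \<open>gop\<close>, \<open>swap.gop\<close> by \<open>serre_twist\<close>.\<close>

lemma serre_gop: "q_serre (*s) q gop swap.gop"
proof -
  define b b' where "b v = Bop v - Kop v" and "b' v = swap.Bop v - swap.Kop v" for v
  have lin_b: "lin b" "lin b'"
    using lin_minus[OF lin_Bop lin_Kop] lin_minus[OF swap.lin_Bop swap.lin_Kop]
    by (simp_all add: b_def[abs_def] b'_def[abs_def])
  have Kb: "Kop (b v) = q powi (- 2) *s b (Kop v)" for v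
    unfolding b_def lin_diff[OF lin_Kop] Kop_Bop
    by (simp only: scale_left_diff_distrib scale_right_diff_distrib scale_one) simp
  have "q powi (- 2) *s (Kop (b' v)) = b' (Kop v)" for v
    unfolding b'_def lin_diff[OF lin_Kop] Kop_inverse swap_Kop_inverse weyl_solve[OF swap.swap_Kop_Bop]
    by (simp only: scale_left_diff_distrib scale_right_diff_distrib scale_one) simp
  then have "q powi 2 *s (q powi (- 2) *s (Kop (b' v))) = q powi 2 *s b' (Kop v)" for v by (simp only:)
  moreover have inv: "q powi 2 * q powi (- 2) = 1" by (simp only: qpow_mult) simp
  ultimately have Kb': "Kop (b' v) = q powi 2 *s b' (Kop v)" for v
    by (simp only: scale_scale scale_one)
  have N: "swap.Kop (f v) = q powi (- k) *s f (swap.Kop v)" if "\<And>v. Kop (f v) = q powi k *s f (Kop v)" for f k v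
  proof -
    have "Kop (f (swap.Kop v)) = q powi k *s f v" using that[of "swap.Kop v"] by (simp only: Kop_inverse)
    then have "swap.Kop (Kop (f (swap.Kop v))) = q powi k *s swap.Kop (f v)"
      by (simp only: lin_scale[OF swap.lin_Kop])
    then have "q powi (- k) *s f (swap.Kop v) = q powi (- k) *s (q powi k *s swap.Kop (f v))"
      by (simp only: swap_Kop_inverse)
    then show ?thesis unfolding scale_scale qpow_mult by simp
  qed
  have serre_b: "q_serre (*s) q b b'"
  proof (rule serre_shift[where Z = "\<lambda>n. q powi (- 2 * n)", THEN iffD1, OF lin_b lin_Kop swap.lin_Kop])
    show "q_serre (*s) q Bop swap.Bop" by (rule serre_Bop)
    show "q powi (- 2 * m) * q powi (- 2 * n) = q powi (- 2 * (m + n))" for m n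
      by (simp only: qpow_mult distrib_left)
    show "q_int q 3 = q powi (- 2 * 1) + 1 + q powi (- 2 * - 1)" by (simp add: q_int_3_eq)
    show "Kop (b v) = q powi (- 2 * 1) *s b (Kop v)" for v using Kb by simp
    show "Kop (b' v) = q powi (- 2 * - 1) *s b' (Kop v)" for v using Kb' by simp
  qed (simp_all add: Kop_inverse swap_Kop_inverse b_def b'_def)
  show ?thesis
  proof (rule serre_twist[OF inv lin_b lin_Kop swap.lin_Kop])
    show "swap.Kop (b v) = q powi 2 *s b (swap.Kop v)" for v using N[of b "- 2", OF Kb] by simp
    show "swap.Kop (b' v) = q powi - 2 *s b' (swap.Kop v)" for v using N[of b' 2, OF Kb'] by simp
    show "gop v = (- q * inverse ((q - inverse q)\<^sup>2)) *s b (swap.Kop v)" for v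
      by (simp only: gop_def b_def Kop_inverse)
    show "swap.gop v = (- q * inverse ((q - inverse q)\<^sup>2)) *s b' (Kop v)" for v
      by (simp only: swap.gop_def b'_def swap_Kop_inverse)
  qed (rule Kb Kop_inverse swap_Kop_inverse serre_b)+
qed

lemma serre_eop: "q_serre (*s) q eop swap.eop"
proof (rule serre_shift[where Z = "\<lambda>n. q powi (2 * n)", THEN iffD1, OF lin_eop swap.lin_eop lin_Kop swap.lin_Kop])
  show "q_serre (*s) q x y" by (rule serre_xy)
  show "q powi (2 * m) * q powi (2 * n) = q powi (2 * (m + n))" for m n
    by (simp only: qpow_mult distrib_left)
  show "q_int q 3 = q powi (2 * 1) + 1 + q powi (2 * - 1)" by (simp add: q_int_3_eq)
  show "Kop (eop v) = q powi (2 * 1) *s eop (Kop v)" for v using Kop_eop by simp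
  show "Kop (swap.eop v) = q powi (2 * - 1) *s swap.eop (Kop v)" for v using Kop_swap_eop by simp
qed (simp_all add: Kop_inverse swap_Kop_inverse x_eq swap.x_eq)

end

context td_pair begin

section \<open>The module structure\<close>

primrec Uq_act :: "Uq_gen \<Rightarrow> 'v \<Rightarrow> 'v" where
  "Uq_act (E_plus i) = (case i of N0 \<Rightarrow> eop | N1 \<Rightarrow> swap.eop)"
| "Uq_act (E_minus i) = (case i of N0 \<Rightarrow> gop | N1 \<Rightarrow> swap.gop)"
| "Uq_act (K i) = (case i of N0 \<Rightarrow> Kop | N1 \<Rightarrow> swap.Kop)"
| "Uq_act (K_inv i) = (case i of N0 \<Rightarrow> swap.Kop | N1 \<Rightarrow> Kop)"

lemma Uq_module_act: "Uq_module (*s) q Uq_act"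
proof -
  have all_node: "(\<forall>i. P i) \<longleftrightarrow> P N0 \<and> P N1" for P by (metis node.exhaust)
  have lin_act: "lin (Uq_act g)" for g
    by (cases g; rename_tac i; case_tac i)
      (simp_all add: lin_eop swap.lin_eop lin_Kop swap.lin_Kop lin_gop swap.lin_gop)
  show ?thesis
    unfolding Uq_module_def
    apply (intro conjI)
    subgoal using lin_act by blast
    by (simp_all only: all_node Uq_act.simps node.case Kop_inverse swap_Kop_inverse Kop_eop Kop_swap_eop
      Kop_gop swap.Kop_gop swap_Kop_gop swap.swap_Kop_gop swap.Kop_eop swap.Kop_swap_eop
      eop_gop swap.eop_gop gop_swap_eop swap.gop_swap_eop serre_eop swap.serre_eop serre_gop swap.serre_gop
      node.distinct simp_thms diff_self)
qed

lemma Aq_acts_via_act: "Aq_acts_via x y Uq_act"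
  by (simp add: Aq_acts_via_def x_eq swap.x_eq)

end

section \<open>Uniqueness of the module structure\<close>

context td_pair begin

text \<open>A \<open>q\<close>-Weyl partner of \<open>x\<close> acts on the quotient of
  \<open>U.UE i\<close> by \<open>U.UE (i + 1)\<close> as the inverse of the eigenvalue of
  \<open>x\<close>.\<close>

lemma U_UE_shift:
  assumes "lin C" and weyl: "\<And>v. q *s C (x v) - inverse q *s x (C v) = (q - inverse q) *s v"
    and "v \<in> U.UE i"
  shows "C v - q powi (d - 2 * i) *s v \<in> U.UE (i + 1)"
proof (rule lin_span_subset[OF lin_minus[OF assms(1) lin_scaled[OF lin_id]] assms(3)[unfolded U.UE_def] U.subspace_UE])
  fix v assume "v \<in> (\<Union>j\<in>{i..}. eigsp x (q powi (2 * j - d)))"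
  then obtain j where j: "i \<le> j" "v \<in> eigsp x (q powi (2 * j - d))" by auto
  have "q * q * q powi (2 * j - d) = q powi (2 * (j + 1) - d)"
    using q_nz by (simp add: power_int_diff power_int_add field_simps power2_eq_square)
  moreover have "inverse (q powi (2 * j - d)) = q powi (d - 2 * j)"
    by (simp add: power_int_minus[symmetric])
  ultimately have "C v - q powi (d - 2 * j) *s v \<in> eigsp x (q powi (2 * (j + 1) - d))"
    using weyl_eigsp[OF lin_x assms(1) q_nz qpow_nz j(2) weyl] by simp
  then have 1: "C v - q powi (d - 2 * j) *s v \<in> U.UE (i + 1)"
    using U.eigsp_UE[of "i + 1" "j + 1"] j(1) by auto
  show "C v - q powi (d - 2 * i) *s v \<in> U.UE (i + 1)"
  proof (cases "j = i")
    case True then show ?thesis using 1 by simp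
  next
    case False
    then have "v \<in> U.UE (i + 1)" using U.eigsp_UE[of "i + 1" j] j by auto
    then have "(q powi (d - 2 * j) - q powi (d - 2 * i)) *s v \<in> U.UE (i + 1)"
      by (rule subspace_scale[OF U.subspace_UE])
    from subspace_add[OF U.subspace_UE 1 this] show ?thesis
      by (simp add: scale_left_diff_distrib)
  qed
qed

text \<open>By its \<open>q\<close>-Weyl relation with \<open>x\<close>, \<open>k0'\<close> acts on
  the graded pieces of \<open>U.UE\<close> by known scalars. It also preserves \<open>U.LF\<close>,
  being \<open>k1\<close> after \<open>c\<close>, where \<open>c\<close> commutes with
  \<open>y\<close>. Hence \<open>k0'\<close> minus the expected scalar maps \<open>U.S i\<close>
  into \<open>U.LF i\<close> and \<open>U.UE (i + 1)\<close>, that is, to zero.\<close>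

lemma Kop_unique:
  assumes lin: "lin k0" "lin k0'" "lin k1" "lin k1'" "lin e0" "lin e1"
    and inv0: "\<And>v. k0 (k0' v) = v" "\<And>v. k0' (k0 v) = v"
    and inv1: "\<And>v. k1 (k1' v) = v" "\<And>v. k1' (k1 v) = v"
    and comm: "\<And>v. k0 (k1 v) = k1 (k0 v)"
    and x: "\<And>v. x v = e0 v + k0 v" and y: "\<And>v. y v = e1 v + k1 v"
    and e0: "\<And>v. k0 (e0 (k0' v)) = q powi 2 *s e0 v"
    and e1: "\<And>v. k1 (e1 (k1' v)) = q powi 2 *s e1 v"
    and k0e1: "\<And>v. k0 (e1 (k0' v)) = q powi (- 2) *s e1 v"
  shows "k0' v = swap.Kop v"
proof -
  have e0': "e0 (k0' v) = q powi 2 *s k0' (e0 v)" for v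
    using arg_cong[OF e0[of v], of k0'] by (simp only: inv0 lin_scale[OF lin(2)])
  have e1': "e1 (k1' v) = q powi 2 *s k1' (e1 v)" for v
    using arg_cong[OF e1[of v], of k1'] by (simp only: inv1 lin_scale[OF lin(4)])
  have k0e1': "e1 (k0' v) = q powi (- 2) *s k0' (e1 v)" for v
    using arg_cong[OF k0e1[of v], of k0'] by (simp only: inv0 lin_scale[OF lin(2)])
  have q2: "inverse q * q powi 2 = q" using q_nz by (simp add: power2_eq_square)
  have cancel: "(a + b) - (a + c) = b - c" for a b c :: 'v by simp
  have weyl0: "q *s k0' (x v) - inverse q *s x (k0' v) = (q - inverse q) *s v" for v
    by (simp only: x lin_add[OF lin(2)] inv0 e0' scale_right_distrib scale_scale q2 cancel scale_left_diff_distrib)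
  have weyl1: "q *s k1' (y v) - inverse q *s y (k1' v) = (q - inverse q) *s v" for v
    by (simp only: y lin_add[OF lin(4)] inv1 e1' scale_right_distrib scale_scale q2 cancel scale_left_diff_distrib)
  \<comment> \<open>Induction along the flag: \<open>k1'\<close> sends \<open>v\<close> to a nonzero
    multiple of itself plus an eigenvector \<open>w\<close> of the previous index, and applying
    \<open>k1\<close> expresses \<open>k1 v\<close> by \<open>v\<close> and \<open>k1 w\<close>. The
    start is \<open>j < 0\<close>, where the eigenspace is zero.\<close>
  have k1_eig: "k1 v \<in> U.LF j" if "v \<in> eigsp y (q powi (d - 2 * j))" for j v
    using that
  proof (induction "nat (j + 1)" arbitrary: j v)
    case 0
    then have "j \<notin> {0..d}" by auto
    then have "v = 0" using 0 U.eig_B_out[of j] by blast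
    then show ?case using lin_zero[OF lin(3)] subspace_0[OF U.subspace_LF] by simp
  next
    case (Suc n)
    define w where "w = k1' v - inverse (q powi (d - 2 * j)) *s v"
    have "q * q * q powi (d - 2 * j) = q powi (d - 2 * (j - 1))"
      using q_nz by (simp add: power_int_diff power_int_add field_simps power2_eq_square)
    then have "w \<in> eigsp y (q powi (d - 2 * (j - 1)))"
      unfolding w_def using weyl_eigsp[OF lin_y lin(4) q_nz qpow_nz Suc.prems weyl1] by simp
    moreover have "n = nat (j - 1 + 1)" using Suc.hyps(2) by simp
    ultimately have "k1 w \<in> U.LF (j - 1)" using Suc.hyps(1) by blast
    then have "k1 w \<in> U.LF j" using U.LF_mono[of "j - 1" j] by auto
    moreover have "v \<in> U.LF j" using U.eigsp_LF[of j j] Suc.prems by auto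
    ultimately have "q powi (d - 2 * j) *s (v - k1 w) \<in> U.LF j"
      by (intro subspace_scale subspace_diff U.subspace_LF)
    moreover have "k1 w = v - inverse (q powi (d - 2 * j)) *s k1 v"
      unfolding w_def lin_diff[OF lin(3)] inv1 lin_scale[OF lin(3)] ..
    then have "v - k1 w = inverse (q powi (d - 2 * j)) *s k1 v" by simp
    ultimately show ?case using q_nz by simp
  qed
  have k1_LF: "k1 v \<in> U.LF i" if "v \<in> U.LF i" for i v
    by (rule lin_span_subset[OF lin(3) that[unfolded U.LF_def] U.subspace_LF])
      (use k1_eig U.LF_mono in blast)
  have comm': "k0' (k1 v) = k1 (k0' v)" for v
    using arg_cong[OF comm[of "k0' v"], of k0'] by (simp only: inv0)
  \<comment> \<open>\<open>c\<close> is the inverse of \<open>k0\<close> after \<open>k1\<close>,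
    not yet known to be the identity. Its commutation factors with \<open>e1\<close> are
    \<open>q^2\<close> and \<open>q^-2\<close> and cancel.\<close>
  define c where "c v = k1' (k0' v)" for v
  have lin_c: "lin c" unfolding c_def[abs_def] by (rule lin_comp[OF lin(4,2)])
  have "q powi 2 * q powi (- 2) = 1" by (simp only: qpow_mult) simp
  then have ce1: "c (e1 v) = e1 (c v)" for v
    unfolding c_def e1' k0e1' lin_scale[OF lin(4)] scale_scale by simp
  have "c (k1 v) = k1 (c v)" for v unfolding c_def comm' inv1 ..
  then have cy: "c (y v) = y (c v)" for v unfolding y lin_add[OF lin_c] ce1 by simp
  have c_LF: "c v \<in> U.LF i" if "v \<in> U.LF i" for i v
  proof (rule lin_span_subset[OF lin_c that[unfolded U.LF_def] U.subspace_LF])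
    fix v assume "v \<in> (\<Union>j\<in>{..i}. eigsp y (q powi (d - 2 * j)))"
    then obtain j where j: "j \<le> i" "v \<in> eigsp y (q powi (d - 2 * j))" by auto
    have "c v \<in> eigsp y (q powi (d - 2 * j))"
      using j(2) by (simp add: eigsp_def cy[symmetric] lin_scale[OF lin_c])
    then show "c v \<in> U.LF i" using U.eigsp_LF[OF j(1)] by blast
  qed
  show ?thesis
  proof (rule U.eq_on_S[OF lin(2) swap.lin_Kop])
    fix i v assume v: "v \<in> U.S i"
    then have vs: "v \<in> U.LF i" "v \<in> U.UE i" by (auto simp: U.S_def)
    have "k0' v \<in> U.LF i" using k1_LF[OF c_LF[OF vs(1)]] by (simp add: c_def inv1)
    then have "k0' v - q powi (d - 2 * i) *s v \<in> U.LF i"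
      using vs(1) by (intro subspace_diff subspace_scale U.subspace_LF)
    moreover have "k0' v - q powi (d - 2 * i) *s v \<in> U.UE (i + 1)"
      by (rule U_UE_shift[OF lin(2) weyl0 vs(2)])
    ultimately have "k0' v - q powi (d - 2 * i) *s v \<in> U.LF i \<inter> U.UE (i + 1)" by (rule IntI)
    then show "k0' v = swap.Kop v" unfolding U.LF_UE_zero[OF less_add_one] by (simp add: swap_Kop_S[OF v])
  qed
qed

lemma S_eigsp: "U.S i = eigsp Kop (q powi (2 * i - d))"
  unfolding Kop_def by (rule U.eigsp_diagop[symmetric]) (auto intro!: injI)

lemma UNIV_nontrivial: "\<exists>v\<in>U.S 0. v \<noteq> 0"
  using U.S_nonzero[of 0] d_nonneg subspace_0[OF U.subspace_S, of 0] by auto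

lemma gop_unique:
  assumes lin: "lin g"
    and eg: "\<And>v. eop (g v) - g (eop v) = inverse (q - inverse q) *s (Kop v - swap.Kop v)"
    and fg: "\<And>v. swap.eop (g v) - g (swap.eop v) = 0"
    and Kg: "\<And>v. Kop (g (swap.Kop v)) = q powi (- 2) *s g v"
  shows "g v = gop v"
proof -
  define D where "D v = g v - gop v" for v
  have lin_D: "lin D" unfolding D_def[abs_def] by (rule lin_minus[OF lin lin_gop])
  have "eop (D v) - D (eop v) = (eop (g v) - g (eop v)) - (eop (gop v) - gop (eop v))" for v
    unfolding D_def lin_diff[OF lin_eop] by simp
  then have eD: "D (eop v) = eop (D v)" for v unfolding eg eop_gop by simp
  have fD: "D (swap.eop v) = swap.eop (D v)" for v
    unfolding D_def lin_diff[OF swap.lin_eop] gop_swap_eop using fg[of v] by simp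
  have Kg': "Kop (g v) = q powi (- 2) *s g (Kop v)" for v
    using Kg[of "Kop v"] by (simp only: swap_Kop_inverse)
  have KD: "Kop (D v) = q powi (- 2) *s D (Kop v)" for v
    unfolding D_def lin_diff[OF lin_Kop] Kg' Kop_gop scale_right_diff_distrib ..
  \<comment> \<open>\<open>D\<close> sends \<open>U.S 0\<close> to the eigenvalue
    \<open>q powi (- 2 - d)\<close> of \<open>Kop\<close>, which does not occur. This makes the
    invariant kernel of \<open>D\<close> nonzero.\<close>
  have D0: "D v = 0" if "v \<in> U.S 0" for v
  proof -
    have "Kop (D v) = (q powi (- 2) * q powi (2 * 0 - d)) *s D v"
      unfolding KD Kop_S[OF that] lin_scale[OF lin_D] scale_scale ..
    then have "D v \<in> U.S (- 1)" unfolding S_eigsp qpow_mult by (intro eigspI) simp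
    then show ?thesis using U.S_out[of "- 1"] by simp
  qed
  let ?W = "{v. D v = 0}"
  have W: "subspace ?W" using lin_subspace_vimage[OF lin_D subspace_single_0] by simp
  have DK: "D (Kop v) = 0" if "D v = 0" for v
    using KD[of v] that q_nz by (simp add: lin_zero[OF lin_Kop])
  have DK': "D (swap.Kop v) = 0" if "D v = 0" for v
  proof -
    have "Kop (D (swap.Kop v)) = 0" using KD[of "swap.Kop v"] that by (simp add: Kop_inverse)
    then show ?thesis using swap_Kop_inverse[of "D (swap.Kop v)"] by (simp add: lin_zero[OF swap.lin_Kop])
  qed
  have "x ` ?W \<subseteq> ?W"
    by (auto simp: x_eq lin_add[OF lin_D] eD DK lin_zero[OF lin_eop])
  moreover have "y ` ?W \<subseteq> ?W"
    by (auto simp: swap.x_eq lin_add[OF lin_D] fD DK' lin_zero[OF swap.lin_eop])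
  ultimately have "?W = {0} \<or> ?W = UNIV" by (rule irred[OF W])
  moreover have "?W \<noteq> {0}" using UNIV_nontrivial D0 by auto
  ultimately have "D v = 0" by auto
  then show ?thesis by (simp add: D_def)
qed

end

context td_pair begin

text \<open>\<open>Kop_unique\<close> and its mirror image identify the inverses of
  \<open>K_0\<close> and \<open>K_1\<close>. The raising operators are then read off from
  \<open>x\<close> and \<open>y\<close>, and \<open>gop_unique\<close> fixes the lowering
  operators.\<close>

lemma Uq_act_unique:
  assumes "Uq_module (*s) q \<rho>" "Aq_acts_via x y \<rho>"
  shows "\<rho> = Uq_act"
proof -
  note M = assms(1)[unfolded Uq_module_def]
  have lin: "lin (\<rho> g)" for g using M by blast
  have inv: "\<rho> (K i) (\<rho> (K_inv i) v) = v" "\<rho> (K_inv i) (\<rho> (K i) v) = v" for i v using M by blast+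
  have comm: "\<rho> (K N0) (\<rho> (K N1) v) = \<rho> (K N1) (\<rho> (K N0) v)" for v using M by blast
  have KE: "\<rho> (K i) (\<rho> (E_plus i) (\<rho> (K_inv i) v)) = q powi 2 *s \<rho> (E_plus i) v"
    "\<rho> (K i) (\<rho> (E_minus i) (\<rho> (K_inv i) v)) = q powi (- 2) *s \<rho> (E_minus i) v" for i v
    using M by blast+
  have KE': "i \<noteq> j \<Longrightarrow> \<rho> (K i) (\<rho> (E_plus j) (\<rho> (K_inv i) v)) = q powi (- 2) *s \<rho> (E_plus j) v" for i j v
    using M by blast
  have EE: "\<rho> (E_plus i) (\<rho> (E_minus i) v) - \<rho> (E_minus i) (\<rho> (E_plus i) v)
    = inverse (q - inverse q) *s (\<rho> (K i) v - \<rho> (K_inv i) v)" for i v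
    using M by blast
  have EE': "i \<noteq> j \<Longrightarrow> \<rho> (E_plus i) (\<rho> (E_minus j) v) - \<rho> (E_minus j) (\<rho> (E_plus i) v) = 0" for i j v
    using M by blast
  have x: "x v = \<rho> (E_plus N0) v + \<rho> (K N0) v" and y: "y v = \<rho> (E_plus N1) v + \<rho> (K N1) v" for v
    using assms(2) by (simp_all add: Aq_acts_via_def)
  have 0: "\<rho> (K_inv N0) = swap.Kop"
    by (rule ext, rule Kop_unique[OF lin lin lin lin lin lin inv inv comm x y KE(1) KE(1) KE'[of N0 N1]]) simp
  have 1: "\<rho> (K_inv N1) = Kop"
    by (rule ext, rule swap.Kop_unique[OF lin lin lin lin lin lin inv inv comm[symmetric] y x KE(1) KE(1) KE'[of N1 N0]]) simp
  have 2: "\<rho> (K N0) = Kop"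
    using inv(1)[of N0 "Kop _"] unfolding 0 swap_Kop_inverse by auto
  have 3: "\<rho> (K N1) = swap.Kop"
    using inv(1)[of N1 "swap.Kop _"] unfolding 1 Kop_inverse by auto
  have 4: "\<rho> (E_plus N0) = eop" using x by (auto simp: eop_def 2)
  have 5: "\<rho> (E_plus N1) = swap.eop" using y by (auto simp: swap.eop_def 3)
  have 6: "\<rho> (E_minus N0) = gop"
    by (rule ext, rule gop_unique[OF lin EE[of N0, unfolded 0 2 4]
      EE'[OF node.distinct(2), unfolded 5] KE(2)[of N0, unfolded 0 2]])
  have 7: "\<rho> (E_minus N1) = swap.gop"
    by (rule ext, rule swap.gop_unique[OF lin EE[of N1, unfolded 1 3 5]
      EE'[OF node.distinct(1), unfolded 4] KE(2)[of N1, unfolded 1 3]])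
  show ?thesis
  proof
    fix g show "\<rho> g = Uq_act g"
    proof (cases g)
      case (E_plus i) then show ?thesis by (cases i) (simp_all add: 4 5)
    next
      case (E_minus i) then show ?thesis by (cases i) (simp_all add: 6 7)
    next
      case (K i) then show ?thesis by (cases i) (simp_all add: 2 3)
    next
      case (K_inv i) then show ?thesis by (cases i) (simp_all add: 0 1)
    qed
  qed
qed

section \<open>Irreducibility, type and the space \<open>U_0\<close>\<close>

lemma Uq_irreducible_act: "Uq_irreducible (*s) Uq_act"
  unfolding Uq_irreducible_def irreducible_under_def
proof (intro conjI allI impI)
  show "(UNIV :: 'v set) \<noteq> {0}" using UNIV_nontrivial by auto
  fix W assume "subspace W \<and> (\<forall>f\<in>range Uq_act. f ` W \<subseteq> W)"
  then have W: "subspace W" and g: "\<And>g v. v \<in> W \<Longrightarrow> Uq_act g v \<in> W" by auto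
  have "x v \<in> W" "y v \<in> W" if "v \<in> W" for v
    using subspace_add[OF W g[OF that, of "E_plus N0"] g[OF that, of "K N0"]]
      subspace_add[OF W g[OF that, of "E_plus N1"] g[OF that, of "K N1"]]
    by (simp_all add: x_eq swap.x_eq)
  then show "W = {0} \<or> W = UNIV" by (intro irred W) auto
qed

lemma Uq_decomposition_act: "Uq_decomposition (*s) q Uq_act (1, 1) (nat d) (\<lambda>i. U.S (int i))"
proof -
  have sum: "(\<Sum>i\<le>nat d. f (int i)) = (\<Sum>i\<in>{0..d}. f i)" for f :: "int \<Rightarrow> 'v"
  proof -
    have "{0..d} = int ` {..nat d}"
      using d_nonneg by (auto simp: image_iff le_nat_iff intro!: bexI[of _ "nat _"])
    then show ?thesis by (simp add: sum.reindex)
  qed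
  have "\<exists>!u. (\<forall>i\<le>nat d. u i \<in> U.S (int i)) \<and> (\<forall>i>nat d. u i = 0) \<and> v = (\<Sum>i\<le>nat d. u i)" for v
  proof (rule ex1I[of _ "\<lambda>i. if i \<le> nat d then U.pr (int i) v else 0"])
    show "(\<forall>i\<le>nat d. (if i \<le> nat d then U.pr (int i) v else 0) \<in> U.S (int i)) \<and>
      (\<forall>i>nat d. (if i \<le> nat d then U.pr (int i) v else 0) = 0) \<and>
      v = (\<Sum>i\<le>nat d. if i \<le> nat d then U.pr (int i) v else 0)"
      using sum[of "\<lambda>i. U.pr i v"] by (simp add: U.pr_mem U.sum_pr)
    fix u assume u: "(\<forall>i\<le>nat d. u i \<in> U.S (int i)) \<and> (\<forall>i>nat d. u i = 0) \<and> v = (\<Sum>i\<le>nat d. u i)"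
    have "U.pr j v = (if j \<in> {0..d} then u (nat j) else 0)" for j
    proof (rule U.pr_unique)
      show "(if i \<in> {0..d} then u (nat i) else 0) \<in> U.S i" for i
      proof (cases "i \<in> {0..d}")
        case True
        then have "nat i \<le> nat d" by (simp add: nat_mono)
        then have "u (nat i) \<in> U.S (int (nat i))" using u by blast
        then show ?thesis using True by simp
      next
        case False
        then show ?thesis using subspace_0[OF U.subspace_S, of i] by (simp only: if_False)
      qed
      have "(\<Sum>i\<in>{0..d}. if i \<in> {0..d} then u (nat i) else 0) = (\<Sum>i\<in>{0..d}. u (nat i))"
        by (rule sum.cong) auto
      also have "\<dots> = v" using u sum[of "\<lambda>i. u (nat i)"] by simp
      finally show "v = (\<Sum>i\<in>{0..d}. if i \<in> {0..d} then u (nat i) else 0)" ..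
    qed
    note pr = this
    show "u = (\<lambda>i. if i \<le> nat d then U.pr (int i) v else 0)"
    proof
      fix i show "u i = (if i \<le> nat d then U.pr (int i) v else 0)"
        using u pr[of "int i"] d_nonneg by auto
    qed
  qed
  then show ?thesis
    unfolding Uq_decomposition_def is_direct_sum_def
    using U.subspace_S U.S_nonzero d_nonneg by (auto simp: Kop_S swap_Kop_S le_nat_iff)
qed

text \<open>This makes the definite description in \<open>Uq_U0\<close> meaningful: any sign and any
  length are allowed for the competing decomposition, but its eigenvalues of \<open>Kop\<close>
  increase in steps of \<open>q^2\<close> and must include the lowest one,
  \<open>q powi (- d)\<close>.\<close>

lemma Uq_decomposition_U0:
  assumes "Uq_decomposition (*s) q Uq_act \<epsilon> d' U'"
  shows "U' 0 = U.S 0"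
proof -
  obtain a b where \<epsilon>: "\<epsilon> = (a, b)" by force
  note dec = assms[unfolded \<epsilon> Uq_decomposition_def is_direct_sum_def prod.case]
  let ?c = "\<lambda>i. a * q powi (2 * int i - int d')"
  have a: "a \<noteq> 0" using dec by auto
  have K: "Kop u = ?c i *s u" if "i \<le> d'" "u \<in> U' i" for i u
    using dec that by auto
  have U': "\<exists>u. u \<in> U' i \<and> u \<noteq> 0" if "i \<le> d'" for i
  proof -
    have "subspace (U' i)" "U' i \<noteq> {0}" using dec that by auto
    then show ?thesis using subspace_0 by blast
  qed
  have eig: "\<exists>i\<in>{0..d}. ?c j = q powi (2 * i - d)" if j: "j \<le> d'" for j
  proof -
    obtain u where u: "u \<in> U' j" "u \<noteq> 0" using U'[OF j] by blast
    then have "Kop u = ?c j *s u" using K j by blast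
    then have "(\<Sum>i\<in>{0..d}. q powi (2 * i - d) *s U.pr i u) = (\<Sum>i\<in>{0..d}. ?c j *s U.pr i u)"
      by (simp add: Kop_def U.diagop_def scale_sum_right[symmetric] U.sum_pr)
    then have z: "(q powi (2 * i - d) - ?c j) *s U.pr i u = 0" for i
      by (intro U.S_sum_unique[of "\<lambda>i. (q powi (2 * i - d) - ?c j) *s U.pr i u"])
        (simp_all add: subspace_scale U.subspace_S U.pr_mem subspace_diff scale_left_diff_distrib sum_subtractf)
    obtain i where "i \<in> {0..d}" "U.pr i u \<noteq> 0"
      using u(2) U.sum_pr[of u] by (metis sum.neutral)
    then show ?thesis using z[of i] by (intro bexI[of _ i]) auto
  qed
  have comp: "\<exists>u. (\<forall>i\<le>d'. u i \<in> U' i) \<and> v = (\<Sum>i\<le>d'. u i)" for v using dec by blast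
  have unique: "u = w" if "\<forall>i\<le>d'. u i \<in> U' i" "\<forall>i>d'. u i = 0" "\<forall>i\<le>d'. w i \<in> U' i" "\<forall>i>d'. w i = 0"
     "(\<Sum>i\<le>d'. u i) = (\<Sum>i\<le>d'. w i)" for u w :: "nat \<Rightarrow> 'v"
    using dec that by metis
  have sub: "subspace (U' i)" if "i \<le> d'" for i using dec that by auto
  \<comment> \<open>An eigenvector can have components only at indices carrying its eigenvalue; if
    at most \<open>i\<close> qualifies, it lies in \<open>U' i\<close>.\<close>
  have eigen: "v \<in> U' i \<and> i \<le> d'" if iv: "Kop v = c *s v" "v \<noteq> 0" "\<And>j. j \<le> d' \<Longrightarrow> ?c j = c \<Longrightarrow> j = i" for v i c
  proof -
    obtain u where u: "\<forall>i\<le>d'. u i \<in> U' i" "v = (\<Sum>i\<le>d'. u i)" using comp by blast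
    have "(\<Sum>j\<le>d'. ?c j *s u j) = (\<Sum>j\<le>d'. c *s u j)"
      using iv(1) u K by (simp add: lin_sum[OF lin_Kop] scale_sum_right)
    then have "(\<lambda>j. if j \<le> d' then (?c j - c) *s u j else 0) = (\<lambda>j. 0)"
      by (intro unique) (use u sub in \<open>auto intro: subspace_scale subspace_diff subspace_0 simp: scale_left_diff_distrib sum_subtractf\<close>)
    then have z: "(?c j - c) *s u j = 0" if "j \<le> d'" for j using that by (metis (no_types, lifting))
    have u0: "u j = 0" if "j \<le> d'" "j \<noteq> i" for j using z[OF that(1)] iv(3)[OF that(1)] that(2) by auto
    have "i \<le> d'"
    proof (rule ccontr)
      assume "\<not> i \<le> d'"
      then have "v = 0" unfolding u(2) using u0 by (intro sum.neutral) auto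
      then show False using iv(2) by simp
    qed
    moreover have "v = u i" unfolding u(2) using u0 \<open>i \<le> d'\<close> by (subst sum.remove[of _ i]) auto
    ultimately show ?thesis using u(1) by auto
  qed
  obtain i0 where i0: "i0 \<in> {0..d}" "?c 0 = q powi (2 * i0 - d)" using eig[of 0] by auto
  have cj: "?c j = q powi (2 * (i0 + int j) - d)" for j
  proof -
    have "?c j = ?c 0 * q powi (2 * int j)" by (simp add: qpow_mult mult.assoc algebra_simps)
    also have "\<dots> = q powi (2 * i0 - d + 2 * int j)" unfolding i0(2) by (rule qpow_mult)
    finally show ?thesis by (simp add: algebra_simps)
  qed
  have "i0 = 0"
  proof (rule ccontr)
    assume "i0 \<noteq> 0"
    then have "0 \<in> {0..d}" using i0 by auto
    then obtain v where v: "v \<in> U.S 0" "v \<noteq> 0"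
      using UNIV_nontrivial by auto
    \<comment> \<open>For \<open>i0 > 0\<close> no index carries the eigenvalue of \<open>v\<close>,
      so the last premise of \<open>eigen\<close> is vacuous and any index could be named;
      \<open>0\<close> leads to the contradiction.\<close>
    have "v \<in> U' 0 \<and> 0 \<le> d'"
      by (rule eigen[OF Kop_S[OF v(1)] v(2)]) (use i0 \<open>i0 \<noteq> 0\<close> in \<open>simp add: cj\<close>)
    then have "Kop v = ?c 0 *s v" using K by blast
    then have "?c 0 = q powi (2 * 0 - d)" using Kop_S[OF v(1)] v(2) by simp
    then show False using i0 \<open>i0 \<noteq> 0\<close> by simp
  qed
  show ?thesis
  proof (intro equalityI subsetI)
    fix v assume "v \<in> U' 0"
    then have "Kop v = ?c 0 *s v" using K by blast
    then show "v \<in> U.S 0" unfolding S_eigsp i0(2) \<open>i0 = 0\<close> by (rule eigspI)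
  next
    fix v assume v: "v \<in> U.S 0"
    show "v \<in> U' 0"
    proof (cases "v = 0")
      case True then show ?thesis using sub[of 0] subspace_0 by auto
    next
      case False
      have "v \<in> U' 0 \<and> 0 \<le> d'"
        by (rule eigen[OF Kop_S[OF v] False]) (simp add: cj \<open>i0 = 0\<close>)
      then show ?thesis by simp
    qed
  qed
qed

lemma Uq_U0_act: "Uq_U0 (*s) q Uq_act = U.S 0"
  unfolding Uq_U0_def
proof (rule the_equality)
  show "\<exists>\<epsilon> d' U'. Uq_decomposition (*s) q Uq_act \<epsilon> d' U' \<and> U.S 0 = U' 0"
    by (rule exI[of _ "(1, 1)"], rule exI[of _ "nat d"], rule exI[of _ "\<lambda>i. U.S (int i)"])
      (simp add: Uq_decomposition_act)
qed (auto dest: Uq_decomposition_U0)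

end

section \<open>Exponential sums in powers of \<open>x\<close>\<close>

context lin_space begin

text \<open>Division by \<open>z - z0\<close> for polynomials with vector coefficients.\<close>

lemma vector_poly_split:
  "\<exists>C'. \<forall>z. (\<Sum>k\<le>Suc D. z ^ k *s C k) = (\<Sum>k\<le>Suc D. z0 ^ k *s C k) + (z - z0) *s (\<Sum>k\<le>D. z ^ k *s C' k)"
proof (induction D arbitrary: C)
  case 0
  show ?case
    by (rule exI[of _ "\<lambda>_. C 1"]) (simp add: scale_left_diff_distrib)
next
  case (Suc D)
  obtain C' where C': "\<And>z. (\<Sum>k\<le>Suc D. z ^ k *s C (Suc k))
    = (\<Sum>k\<le>Suc D. z0 ^ k *s C (Suc k)) + (z - z0) *s (\<Sum>k\<le>D. z ^ k *s C' k)"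
    using Suc[of "\<lambda>k. C (Suc k)"] by blast
  define S0 where "S0 = (\<Sum>k\<le>Suc D. z0 ^ k *s C (Suc k))"
  define C'' where "C'' k = (case k of 0 \<Rightarrow> S0 | Suc j \<Rightarrow> C' j)" for k
  have shift: "(\<Sum>k\<le>Suc n. z ^ k *s G k) = G 0 + z *s (\<Sum>k\<le>n. z ^ k *s G (Suc k))" for n z and G :: "nat \<Rightarrow> 'b"
    by (simp add: sum.atMost_Suc_shift scale_sum_right del: sum.atMost_Suc)
  have "(\<Sum>k\<le>Suc (Suc D). z ^ k *s C k) = (\<Sum>k\<le>Suc (Suc D). z0 ^ k *s C k) + (z - z0) *s (\<Sum>k\<le>Suc D. z ^ k *s C'' k)" for z
  proof -
    define T where "T = (\<Sum>k\<le>D. z ^ k *s C' k)"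
    have "(\<Sum>k\<le>Suc D. z ^ k *s C'' k) = S0 + z *s T"
      unfolding shift C''_def T_def by simp
    moreover have "(\<Sum>k\<le>Suc (Suc D). z ^ k *s C k) = C 0 + z *s (S0 + (z - z0) *s T)"
      unfolding shift[where n = "Suc D"] C'[of z] S0_def T_def ..
    moreover have "(\<Sum>k\<le>Suc (Suc D). z0 ^ k *s C k) = C 0 + z0 *s S0"
      unfolding shift[where n = "Suc D"] S0_def ..
    moreover have "z *s S0 = z0 *s S0 + (z - z0) *s S0"
      by (simp add: scale_left_diff_distrib)
    ultimately show ?thesis
      by (simp only: scale_right_distrib scale_scale mult.commute add.assoc)
  qed
  then show ?case by blast
qed

text \<open>Dividing by \<open>z - z0\<close> for one node \<open>z0\<close> lowers the degree, and
  the quotient has values in \<open>Z\<close> at the remaining nodes.\<close>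

lemma interpolation:
  assumes "subspace Z" "finite X" "D < card X"
    and "\<And>z. z \<in> X \<Longrightarrow> (\<Sum>k\<le>D. z ^ k *s C k) \<in> Z"
  shows "(\<Sum>k\<le>D. w ^ k *s C k) \<in> Z"
  using assms(2-4)
proof (induction D arbitrary: C X)
  case 0
  then obtain z where "z \<in> X" by (metis card.empty ex_in_conv less_irrefl)
  then show ?case using 0(3) by simp
next
  case (Suc D)
  then obtain z0 where z0: "z0 \<in> X" by (metis card.empty ex_in_conv not_less_zero)
  let ?P = "\<lambda>z. \<Sum>k\<le>Suc D. z ^ k *s C k"
  obtain C' where C': "\<And>z. ?P z = ?P z0 + (z - z0) *s (\<Sum>k\<le>D. z ^ k *s C' k)"
    using vector_poly_split[where C = C and D = D and ?z0.0 = z0] by blast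
  have "(\<Sum>k\<le>D. z ^ k *s C' k) \<in> Z" if "z \<in> X - {z0}" for z
  proof -
    have "?P z - ?P z0 \<in> Z" using Suc.prems(3) that z0 by (intro subspace_diff assms(1)) auto
    then have "inverse (z - z0) *s (?P z - ?P z0) \<in> Z" by (rule subspace_scale[OF assms(1)])
    moreover have "?P z - ?P z0 = (z - z0) *s (\<Sum>k\<le>D. z ^ k *s C' k)" unfolding C'[of z] by simp
    ultimately show ?thesis using that by simp
  qed
  then have "(\<Sum>k\<le>D. w ^ k *s C' k) \<in> Z"
    using Suc.prems z0 by (intro Suc.IH[of "X - {z0}"]) auto
  then show ?case unfolding C'[of w]
    using Suc.prems(3)[OF z0] by (intro subspace_add subspace_scale assms(1)) auto
qed

end

context q_space begin

text \<open>Only arguments up to \<open>N\<close> count, because the functions of interest contain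
  the truncated exponent \<open>N - a\<close>.\<close>

definition exp_sum :: "nat \<Rightarrow> nat \<Rightarrow> (nat \<Rightarrow> 'v) \<Rightarrow> bool" where
  "exp_sum m N F \<longleftrightarrow> (\<exists>C. \<forall>a\<le>N. F a = (\<Sum>k\<in>{- int m..int m}. q powi (2 * k * int a) *s C k))"

lemma exp_sum_add:
  assumes "exp_sum m N F" "exp_sum m N G"
  shows "exp_sum m N (\<lambda>a. F a + G a)"
proof -
  obtain C C' where "\<forall>a\<le>N. F a = (\<Sum>k\<in>{- int m..int m}. q powi (2 * k * int a) *s C k)"
    "\<forall>a\<le>N. G a = (\<Sum>k\<in>{- int m..int m}. q powi (2 * k * int a) *s C' k)"
    using assms unfolding exp_sum_def by blast
  then show ?thesis unfolding exp_sum_def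
    by (intro exI[of _ "\<lambda>k. C k + C' k"]) (simp add: scale_right_distrib sum.distrib)
qed

lemma exp_sum_linear:
  assumes "exp_sum m N F" "lin L"
  shows "exp_sum m N (\<lambda>a. L (F a))"
proof -
  obtain C where "\<forall>a\<le>N. F a = (\<Sum>k\<in>{- int m..int m}. q powi (2 * k * int a) *s C k)"
    using assms unfolding exp_sum_def by blast
  then show ?thesis unfolding exp_sum_def
    by (intro exI[of _ "\<lambda>k. L (C k)"]) (simp add: lin_sum[OF assms(2)] lin_scale[OF assms(2)])
qed

lemma exp_sum_diff:
  assumes "exp_sum m N F" "exp_sum m N G"
  shows "exp_sum m N (\<lambda>a. F a - G a)"
  using exp_sum_add[OF assms(1) exp_sum_linear[OF assms(2), of "\<lambda>v. - v"]]
  by (simp add: lin_iff)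

lemma exp_sum_rev:
  assumes "exp_sum m N F"
  shows "exp_sum m N (\<lambda>a. F (N - a))"
proof -
  obtain C where C: "\<forall>a\<le>N. F a = (\<Sum>k\<in>{- int m..int m}. q powi (2 * k * int a) *s C k)"
    using assms unfolding exp_sum_def by blast
  have "F (N - a) = (\<Sum>k\<in>{- int m..int m}. q powi (2 * k * int a) *s (q powi (- 2 * k * int N) *s C (- k)))" if "a \<le> N" for a
  proof -
    have e: "2 * k * int a + - 2 * k * int N = 2 * (- k) * int (N - a)" for k
      using that by (simp add: of_nat_diff algebra_simps)
    have "F (N - a) = (\<Sum>k\<in>{- int m..int m}. q powi (2 * k * int (N - a)) *s C k)" using C by simp
    also have "\<dots> = (\<Sum>k\<in>{- int m..int m}. q powi (2 * (- k) * int (N - a)) *s C (- k))"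
      by (rule sum.reindex_bij_witness[of _ uminus uminus]) auto
    finally show ?thesis by (simp only: scale_scale qpow_mult e)
  qed
  note * = this
  show ?thesis unfolding exp_sum_def
  proof (rule exI[of _ "\<lambda>k. q powi (- 2 * k * int N) *s C (- k)"], intro allI impI)
    fix a assume "a \<le> N"
    then show "F (N - a) = (\<Sum>k\<in>{- int m..int m}. q powi (2 * k * int a) *s (q powi (- 2 * k * int N) *s C (- k)))"
      by (rule *)
  qed
qed

lemma qpow_pow: "(q powi n) ^ l = q powi (n * int l)"
  by (simp add: power_int_mult)

text \<open>Multiplication by \<open>q powi (2 * m * a)\<close> gives a polynomial of degree
  \<open>2 * m\<close> in \<open>q powi (2 * a)\<close>, and different \<open>a\<close> give
  different nodes.\<close>

lemma exp_sum_interpolation: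
  assumes "exp_sum m N F" "subspace Z" "A \<subseteq> {..N}" "2 * m < card A" "\<And>a. a \<in> A \<Longrightarrow> F a \<in> Z" "b \<le> N"
  shows "F b \<in> Z"
proof -
  obtain C where C: "\<And>a. a \<le> N \<Longrightarrow> F a = (\<Sum>k\<in>{- int m..int m}. q powi (2 * k * int a) *s C k)"
    using assms unfolding exp_sum_def by blast
  define C' where "C' l = C (int l - int m)" for l
  have P: "q powi (2 * int m * int a) *s F a = (\<Sum>l\<le>2 * m. (q powi (2 * int a)) ^ l *s C' l)" if "a \<le> N" for a
  proof -
    have "q powi (2 * int m * int a) *s F a
      = (\<Sum>k\<in>{- int m..int m}. q powi (2 * (k + int m) * int a) *s C k)"
      unfolding C[OF that] scale_sum_right scale_scale qpow_mult by (simp add: algebra_simps)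
    also have "\<dots> = (\<Sum>l\<le>2 * m. q powi (2 * int l * int a) *s C' l)"
      by (rule sum.reindex_bij_witness[of _ "\<lambda>l. int l - int m" "\<lambda>k. nat (k + int m)"]) (auto simp: C'_def)
    also have "\<dots> = (\<Sum>l\<le>2 * m. (q powi (2 * int a)) ^ l *s C' l)"
    proof (rule sum.cong[OF refl])
      fix l
      have "2 * int l * int a = 2 * int a * int l" by simp
      then show "q powi (2 * int l * int a) *s C' l = (q powi (2 * int a)) ^ l *s C' l"
        by (simp only: qpow_pow)
    qed
    finally show ?thesis .
  qed
  have inj: "inj_on (\<lambda>a. q powi (2 * int a)) A" by (auto intro!: inj_onI)
  have "(\<Sum>l\<le>2 * m. (q powi (2 * int b)) ^ l *s C' l) \<in> Z"
  proof (rule interpolation[OF assms(2)])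
    show "finite ((\<lambda>a. q powi (2 * int a)) ` A)" using assms(3) finite_subset by blast
    show "2 * m < card ((\<lambda>a. q powi (2 * int a)) ` A)" using assms(4) card_image[OF inj] by simp
    fix z assume "z \<in> (\<lambda>a. q powi (2 * int a)) ` A"
    then obtain a where a: "a \<in> A" "z = q powi (2 * int a)" by blast
    then have "a \<le> N" using assms(3) by auto
    show "(\<Sum>l\<le>2 * m. z ^ l *s C' l) \<in> Z"
      unfolding a(2) P[OF \<open>a \<le> N\<close>, symmetric] using assms(5)[OF a(1)] by (rule subspace_scale[OF assms(2)])
  qed
  then have "q powi (2 * int m * int b) *s F b \<in> Z" unfolding P[OF assms(6)] .
  from subspace_scale[OF assms(2) this, of "q powi (- (2 * int m * int b))"]
  show ?thesis unfolding scale_scale qpow_mult by simp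
qed

lemma eigsp_funpow: "lin A \<Longrightarrow> v \<in> eigsp A (q powi j) \<Longrightarrow> (A ^^ n) v = q powi (j * int n) *s v"
proof (induction n)
  case (Suc n)
  have "q powi (j * int n) * q powi j = q powi (j * int (Suc n))"
    unfolding qpow_mult by (simp add: algebra_simps)
  then show ?case using Suc eigspD[OF Suc.prems(2)] by (simp add: lin_scale)
qed simp

text \<open>For \<open>v\<close> with eigenvalue \<open>q^j\<close>, the component of
  \<open>X v\<close> with eigenvalue \<open>q^(j + 2k)\<close> acquires the factor
  \<open>q^(j (N - a) + (j + 2k) a)\<close>, which is \<open>q^(2ka)\<close> times a
  constant.\<close>

lemma exp_sum_eigsp:
  assumes linA: "lin A" and linX: "lin X" and span: "span (\<Union>j. eigsp A (q powi j)) = UNIV"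
    and X: "\<And>j v. v \<in> eigsp A (q powi j) \<Longrightarrow> X v \<in> span (\<Union>k\<in>{- int m..int m}. eigsp A (q powi (j + 2 * k)))"
  shows "exp_sum m N (\<lambda>a. (A ^^ a) (X ((A ^^ (N - a)) v)))"
proof -
  have lin_pow: "lin (A ^^ n)" for n by (rule lin_funpow[OF linA])
  have zero: "exp_sum m N (\<lambda>a. 0)" unfolding exp_sum_def by (rule exI[of _ "\<lambda>_. 0"]) simp
  have scaled: "exp_sum m N (\<lambda>a. c *s F a)" if "exp_sum m N F" for c F
    by (rule exp_sum_linear[OF that lin_scaled[OF lin_id]])
  have inner: "exp_sum m N (\<lambda>a. (A ^^ a) (q powi (j * int (N - a)) *s w))"
    if "w \<in> span (\<Union>k\<in>{- int m..int m}. eigsp A (q powi (j + 2 * k)))" for w j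
    using that
  proof (induction w rule: span_induct)
    case base
    show ?case
    proof (rule subspaceI, goal_cases)
      case 1 show ?case by (simp add: lin_zero[OF lin_pow] zero)
    next
      case (2 u w)
      then show ?case using exp_sum_add by (simp add: lin_add[OF lin_pow] scale_right_distrib)
    next
      case (3 c w)
      then show ?case using scaled[of "\<lambda>a. (A ^^ a) (q powi (j * int (N - a)) *s w)" c]
        by (simp add: lin_scale[OF lin_pow] mult.commute)
    qed
  next
    case (step w)
    then obtain k where k: "k \<in> {- int m..int m}" "w \<in> eigsp A (q powi (j + 2 * k))" by auto
    have "(A ^^ a) (q powi (j * int (N - a)) *s w)
      = (\<Sum>l\<in>{- int m..int m}. q powi (2 * l * int a) *s (if l = k then q powi (j * int N) *s w else 0))" if "a \<le> N" for a
    proof -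
      have e: "j * int (N - a) + (j + 2 * k) * int a = 2 * k * int a + j * int N"
        using that by (simp add: of_nat_diff algebra_simps)
      have "(\<Sum>l\<in>{- int m..int m}. q powi (2 * l * int a) *s (if l = k then q powi (j * int N) *s w else 0))
        = (\<Sum>l\<in>{- int m..int m}. if l = k then q powi (2 * k * int a) *s q powi (j * int N) *s w else 0)"
        by (rule sum.cong) auto
      also have "\<dots> = q powi (2 * k * int a) *s q powi (j * int N) *s w" using k(1) by simp
      finally show ?thesis
        unfolding lin_scale[OF lin_pow] eigsp_funpow[OF linA k(2)] scale_scale qpow_mult e by simp
    qed
    note * = this
    show ?case unfolding exp_sum_def
      by (rule exI[of _ "\<lambda>l. if l = k then q powi (j * int N) *s w else 0"], intro allI impI, erule *)
  qed
  have "v \<in> span (\<Union>j. eigsp A (q powi j))" by (simp add: span)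
  then show ?thesis
  proof (induction v rule: span_induct)
    case base
    show ?case
      by (rule subspaceI)
        (simp_all add: lin_simps[OF lin_pow] lin_simps[OF linX] zero exp_sum_add scaled)
  next
    case (step v)
    then obtain j where j: "v \<in> eigsp A (q powi j)" by auto
    show ?case using inner[OF X[OF j]]
      by (simp only: eigsp_funpow[OF linA j] lin_scale[OF linX])
  qed
qed

end

section \<open>Passing from powers of \<open>x\<close> to powers of the raising operator\<close>

context td_pair begin

lemma swap_eop_S: "v \<in> U.S i \<Longrightarrow> swap.eop v \<in> U.S (i - 1)"
  using swap.eop_S[of v "d - i"] unfolding swap_S by (simp add: algebra_simps)

lemma eop_pow_S: "v \<in> U.S i \<Longrightarrow> (eop ^^ n) v \<in> U.S (i + int n)"
proof (induction n)
  case (Suc n)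
  then show ?case using eop_S[of "(eop ^^ n) v" "i + int n"] by (simp add: add.assoc add.commute[of 1])
qed simp

lemma swap_eop_pow_S: "v \<in> U.S i \<Longrightarrow> (swap.eop ^^ n) v \<in> U.S (i - int n)"
proof (induction n)
  case (Suc n)
  then show ?case using swap_eop_S[of "(swap.eop ^^ n) v" "i - int n"] by (simp add: diff_diff_eq add.commute)
qed simp

text \<open>\<open>swap.eop\<close> is \<open>y - swap.Kop\<close>; the first term is tridiagonal on
  the eigenspaces of \<open>x\<close>, and the second is bidiagonal by its \<open>q\<close>-Weyl
  relation.\<close>

lemma swap_eop_tri:
  assumes "v \<in> eigsp x (q powi j)"
  shows "swap.eop v \<in> span (\<Union>k\<in>{- 1..1}. eigsp x (q powi (j + 2 * k)))"
proof -
  let ?T = "span (\<Union>k\<in>{- 1..1}. eigsp x (q powi (j + 2 * k)))"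
  have sub: "eigsp x (q powi (j + 2 * k)) \<subseteq> ?T" if "k \<in> {- 1..1}" for k
    using that by (intro subsetI span_base UN_I)
  have s: "eigsp x (q powi (j - 2)) \<subseteq> ?T" "eigsp x (q powi j) \<subseteq> ?T" "eigsp x (q powi (j + 2)) \<subseteq> ?T"
    using sub[of "- 1"] sub[of 0] sub[of 1] by simp_all
  then have y: "y v \<in> ?T" using tri_x[OF assms] span_minimal[OF _ subspace_span] by (meson Un_least subsetD)
  have "q * q * q powi j = q powi (j + 2)"
    using q_nz by (simp add: power_int_add power2_eq_square)
  then have "swap.Kop v - inverse (q powi j) *s v \<in> eigsp x (q powi (j + 2))"
    using weyl_eigsp[OF lin_x swap.lin_Kop q_nz qpow_nz assms swap_Kop_x] by simp
  then have 1: "swap.Kop v - inverse (q powi j) *s v \<in> ?T" using s by blast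
  have "inverse (q powi j) *s v \<in> ?T" using s assms by (intro span_scale) blast
  from span_add[OF 1 this] have "swap.Kop v \<in> ?T" by simp
  with y show ?thesis unfolding swap.eop_def by (rule span_diff)
qed

lemma swap_eop_pow_tri:
  assumes "v \<in> eigsp x (q powi j)"
  shows "(swap.eop ^^ m) v \<in> span (\<Union>k\<in>{- int m..int m}. eigsp x (q powi (j + 2 * k)))"
proof (induction m)
  case 0 then show ?case using assms by (auto intro: span_base)
next
  case (Suc m)
  let ?T = "span (\<Union>k\<in>{- int (Suc m)..int (Suc m)}. eigsp x (q powi (j + 2 * k)))"
  have "swap.eop ((swap.eop ^^ m) v) \<in> ?T"
  proof (rule lin_span_subset[OF swap.lin_eop Suc])
    fix w assume "w \<in> (\<Union>k\<in>{- int m..int m}. eigsp x (q powi (j + 2 * k)))"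
    then obtain k where k: "k \<in> {- int m..int m}" "w \<in> eigsp x (q powi (j + 2 * k))" by auto
    have "(\<Union>l\<in>{- 1..1}. eigsp x (q powi (j + 2 * k + 2 * l))) \<subseteq> ?T"
    proof (rule UN_least)
      fix l :: int assume "l \<in> {- 1..1}"
      then have "k + l \<in> {- int (Suc m)..int (Suc m)}" using k(1) by auto
      moreover have "j + 2 * k + 2 * l = j + 2 * (k + l)" by simp
      ultimately show "eigsp x (q powi (j + 2 * k + 2 * l)) \<subseteq> ?T"
        using span_superset by (metis (no_types, lifting) UN_upper order_trans)
    qed
    then show "swap.eop w \<in> ?T" using swap_eop_tri[OF k(2)] span_minimal[OF _ subspace_span] by blast
  qed simp
  then show ?case by simp
qed

text \<open>\<open>v\<close> is the component of highest degree of \<open>u\<close>.\<close>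

definition top_term :: "int \<Rightarrow> 'v \<Rightarrow> 'v \<Rightarrow> bool" where
  "top_term i u v \<longleftrightarrow> v \<in> U.S i \<and> u - v \<in> U.LF (i - 1)"

lemma top_term_x: assumes "top_term i u v" shows "top_term (i + 1) (x u) (eop v)"
proof -
  have "x u - eop v = x (u - v) + Kop v" by (simp add: x_eq[of v] lin_diff[OF lin_x])
  moreover have "x (u - v) \<in> U.LF i" using U.A_LF[of "u - v" "i - 1"] assms by (simp add: top_term_def)
  moreover have "Kop v \<in> U.LF i"
    using assms U.S_subset_LF[of i i] by (auto simp: top_term_def Kop_S intro!: subspace_scale[OF U.subspace_LF])
  ultimately show ?thesis
    using assms eop_S by (simp add: top_term_def subspace_add U.subspace_LF)
qed

lemma top_term_swap_eop: assumes "top_term i u v" shows "top_term (i - 1) (swap.eop u) (swap.eop v)"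
proof -
  have "swap.eop (u - v) \<in> U.LF (i - 1 - 1)"
  proof (rule lin_span_subset[OF swap.lin_eop _ U.subspace_LF])
    show "u - v \<in> span (\<Union>j\<in>{..i - 1}. U.S j)" using assms by (simp add: top_term_def U.LF_eq_span)
    fix w assume "w \<in> (\<Union>j\<in>{..i - 1}. U.S j)"
    then obtain j where "j \<le> i - 1" "w \<in> U.S j" by auto
    then show "swap.eop w \<in> U.LF (i - 1 - 1)"
      using swap_eop_S[of w j] U.S_subset_LF[of "j - 1" "i - 1 - 1"] by auto
  qed
  then show ?thesis using assms swap_eop_S by (simp add: top_term_def lin_diff[OF swap.lin_eop])
qed

lemma top_term_pow:
  "top_term i u v \<Longrightarrow> top_term (i + int n) ((x ^^ n) u) ((eop ^^ n) v)"
  "top_term i u v \<Longrightarrow> top_term (i - int n) ((swap.eop ^^ n) u) ((swap.eop ^^ n) v)"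
proof (induction n)
  case (Suc n)
  {
    case 1
    then show ?case using top_term_x[OF Suc(1)] by (simp add: add.assoc add.commute[of 1])
  next
    case 2
    then show ?case using top_term_swap_eop[OF Suc(2)] by (simp add: diff_diff_eq add.commute)
  }
qed simp_all

lemma top_term_pr: assumes "top_term i u v" shows "v = U.pr i u"
proof -
  have "U.pr i (u - v) \<in> {0}"
  proof (rule lin_span_subset[OF U.lin_pr _ subspace_single_0])
    show "u - v \<in> span (\<Union>j\<in>{..i - 1}. U.S j)" using assms by (simp add: top_term_def U.LF_eq_span)
    fix w assume "w \<in> (\<Union>j\<in>{..i - 1}. U.S j)"
    then obtain j where "j \<le> i - 1" "w \<in> U.S j" by auto
    then show "U.pr i w \<in> {0}" using U.pr_S[of w j i] by simp
  qed
  then show ?thesis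
    using assms U.pr_S[of v i i] by (simp add: top_term_def lin_diff[OF U.lin_pr])
qed

text \<open>\<open>eop\<close> is not diagonalizable in general, but it is the part of highest
  degree of \<open>x\<close>. The claim holds for the diagonalizable \<open>x\<close>, and
  projecting to the top degree replaces \<open>x\<close> by \<open>eop\<close>.\<close>

lemma exp_sum_eop:
  assumes "v \<in> U.S j"
  shows "exp_sum m N (\<lambda>a. (eop ^^ a) ((swap.eop ^^ m) ((eop ^^ (N - a)) v)))"
proof -
  have t0: "top_term j v v" using assms by (simp add: top_term_def subspace_0 U.subspace_LF)
  have "(eop ^^ a) ((swap.eop ^^ m) ((eop ^^ (N - a)) v))
    = U.pr (j + int N - int m) ((x ^^ a) ((swap.eop ^^ m) ((x ^^ (N - a)) v)))" if "a \<le> N" for a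
  proof -
    have "j + int (N - a) - int m + int a = j + int N - int m" using that by simp
    then show ?thesis
      using top_term_pr[OF top_term_pow(1)[OF top_term_pow(2)[OF top_term_pow(1)[OF t0, of "N - a"], of m], of a]]
      by (simp only:)
  qed
  moreover have "exp_sum m N (\<lambda>a. U.pr (j + int N - int m) ((x ^^ a) ((swap.eop ^^ m) ((x ^^ (N - a)) v))))"
    by (rule exp_sum_linear[OF exp_sum_eigsp[OF lin_x lin_funpow[OF swap.lin_eop] span_x swap_eop_pow_tri] U.lin_pr])
  ultimately show ?thesis unfolding exp_sum_def by simp
qed

end

section \<open>The operators \<open>\<sigma>\<^sub>n\<close> are scalar on \<open>U\<^sub>0\<close>\<close>

context td_pair begin

lemma exp_sum_swap_eop:
  assumes "v \<in> U.S j"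
  shows "exp_sum m N (\<lambda>a. (swap.eop ^^ a) ((eop ^^ m) ((swap.eop ^^ (N - a)) v)))"
  using swap.exp_sum_eop[of v "d - j" m N] assms by (simp add: swap_S)

definition sig :: "nat \<Rightarrow> 'v \<Rightarrow> 'v" where
  "sig n v = (swap.eop ^^ n) ((eop ^^ n) v)"

lemma lin_sig: "lin (sig n)"
  unfolding sig_def[abs_def] by (rule lin_comp[OF lin_funpow[OF swap.lin_eop] lin_funpow[OF lin_eop]])

lemma sig_S: "v \<in> U.S i \<Longrightarrow> sig n v \<in> U.S i"
  unfolding sig_def using swap_eop_pow_S[OF eop_pow_S, of v i n n] by simp

lemma S_neg: "v \<in> U.S i \<Longrightarrow> i < 0 \<Longrightarrow> v = 0"
  using U.S_out[of i] by auto

text \<open>For \<open>n = b + c\<close> this is \<open>sig b (sig c u)\<close>, so symmetry in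
  \<open>b\<close> and \<open>c\<close> gives commutativity of the \<open>sig\<close> operators on
  \<open>U.S 0\<close>.\<close>

definition zigzag :: "nat \<Rightarrow> 'v \<Rightarrow> nat \<Rightarrow> nat \<Rightarrow> 'v" where
  "zigzag n u b c = (swap.eop ^^ (n - c)) ((eop ^^ b) ((swap.eop ^^ c) ((eop ^^ (n - b)) u)))"

text \<open>The two inner powers already lead to the negative degree
  \<open>n - b - c\<close>.\<close>

lemma zigzag_zero:
  assumes "u \<in> U.S 0" "b \<le> n" "n < b + c"
  shows "zigzag n u b c = 0"
proof -
  have "(swap.eop ^^ c) ((eop ^^ (n - b)) u) \<in> U.S (0 + int (n - b) - int c)"
    by (intro swap_eop_pow_S eop_pow_S assms)
  then have "(swap.eop ^^ c) ((eop ^^ (n - b)) u) = 0" by (rule S_neg) (use assms in simp)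
  then show ?thesis
    by (simp add: zigzag_def lin_zero[OF lin_funpow[OF lin_eop]] lin_zero[OF lin_funpow[OF swap.lin_eop]])
qed

text \<open>
  Both sides are exponential sums of length \<open>2m+1\<close>; they agree for \<open>c < m\<close> by induction, for
  \<open>c = m\<close> trivially, and for \<open>c > n - m\<close> because both vanish.
\<close>

lemma zigzag_symmetric:
  assumes u: "u \<in> U.S 0"
  shows "2 * m \<le> n \<Longrightarrow> c \<le> n \<Longrightarrow> zigzag n u m c = zigzag n u c m"
proof (induction m arbitrary: c rule: less_induct)
  case (less m)
  have 1: "exp_sum m n (zigzag n u m)"
  proof -
    have "(eop ^^ (n - m)) u \<in> U.S (0 + int (n - m))" by (rule eop_pow_S[OF u])
    from exp_sum_rev[OF exp_sum_swap_eop[OF this, of m n]]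
    show ?thesis unfolding exp_sum_def zigzag_def by simp
  qed
  have 2: "exp_sum m n (\<lambda>b. zigzag n u b m)"
    unfolding zigzag_def
    by (rule exp_sum_linear[OF exp_sum_eop[OF u] lin_funpow[OF swap.lin_eop]])
  have "zigzag n u m c - zigzag n u c m \<in> {0}"
  proof (rule exp_sum_interpolation[OF exp_sum_diff[OF 1 2] subspace_single_0])
    let ?A = "{..m} \<union> {n - m + 1..n}"
    show "?A \<subseteq> {..n}" using less.prems by auto
    have "card ?A = card {..m} + card {n - m + 1..n}"
      using less.prems by (intro card_Un_disjoint) auto
    then show "2 * m < card ?A" using less.prems by simp
    fix a assume "a \<in> ?A"
    then consider "a < m" | "a = m" | "n < m + a" "a \<le> n" using less.prems by force
    then show "zigzag n u m a - zigzag n u a m \<in> {0}"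
    proof cases
      case 1 then show ?thesis using less.IH[of a m] less.prems by simp
    next
      case 2 then show ?thesis by simp
    next
      case 3 then show ?thesis using zigzag_zero[OF u, of m n a] zigzag_zero[OF u, of a n m] less.prems by simp
    qed
  qed (rule less.prems)
  then show ?case by simp
qed

lemma sig_commute:
  assumes "u \<in> U.S 0"
  shows "sig i (sig j u) = sig j (sig i u)"
proof -
  have *: "sig i (sig j u) = sig j (sig i u)" if "i \<le> j" for i j
    using zigzag_symmetric[OF assms, of i "i + j" j] that
    by (simp add: zigzag_def sig_def)
  show ?thesis using *[of i j] *[of j i] by (cases "i \<le> j") auto
qed

text \<open>The exponents of a word are listed in the order of application, that is, from right to left.\<close>

fun word :: "bool \<Rightarrow> nat list \<Rightarrow> 'v \<Rightarrow> 'v" where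
  "word b [] v = v"
| "word b (n # ns) v = word (\<not> b) ns (((if b then eop else swap.eop) ^^ n) v)"

lemma word_append: "word b (as @ bs) v = word (b = even (length as)) bs (word b as v)"
  by (induction as arbitrary: b v) auto

lemma lin_word: "lin (word b ns)"
proof (induction ns arbitrary: b)
  case Nil then show ?case by (simp add: lin_iff)
next
  case (Cons n ns)
  have "lin ((if b then eop else swap.eop) ^^ n)" by (rule lin_funpow) (simp add: lin_eop swap.lin_eop)
  from lin_comp[OF Cons this] show ?case by simp
qed

lemma word_S: "v \<in> U.S i \<Longrightarrow> \<exists>k. word b ns v \<in> U.S k"
proof (induction ns arbitrary: b v i)
  case (Cons n ns)
  have "\<exists>k. ((if b then eop else swap.eop) ^^ n) v \<in> U.S k"
    using eop_pow_S[OF Cons.prems, of n] swap_eop_pow_S[OF Cons.prems, of n] by (cases b) auto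
  then show ?case using Cons.IH by auto
qed auto

lemma pr_eop_swap_eop:
  assumes "b > a" "w \<in> U.S k"
  shows "U.pr 0 ((swap.eop ^^ a) ((eop ^^ b) w)) = 0"
proof (cases "k < 0")
  case True
  then show ?thesis using S_neg[OF assms(2)]
    by (simp add: lin_zero[OF lin_funpow[OF lin_eop]] lin_zero[OF lin_funpow[OF swap.lin_eop]] lin_zero[OF U.lin_pr])
next
  case False
  have "(swap.eop ^^ a) ((eop ^^ b) w) \<in> U.S (k + int b - int a)"
    by (intro swap_eop_pow_S eop_pow_S assms)
  then show ?thesis using U.pr_S[of _ "k + int b - int a" 0] False assms(1) by auto
qed

lemma pr_sig: "w \<in> U.S k \<Longrightarrow> U.pr 0 (sig n w) = sig n (U.pr 0 w)"
  using U.pr_S[of w k 0] U.pr_S[OF sig_S[of w k n], of 0] lin_zero[OF lin_sig] by simp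

text \<open>
  An interior exponent \<open>m\<close> allows to interpolate over the distribution of the two exponents next to it.  This reduces
  to words with a smaller exponent, and to words where \<open>m\<close> occurs further to the left; once \<open>m\<close> is the
  last or the first exponent, either some \<open>\<sigma>\<^sub>n\<close> splits off or the word acts as zero.
\<close>

lemma pr_word_mem:
  assumes Z: "subspace Z" "Z \<subseteq> U.S 0" and sig: "\<And>n z. z \<in> Z \<Longrightarrow> sig n z \<in> Z"
    and "even (length ns)" "z \<in> Z"
  shows "U.pr 0 (word True ns z) \<in> Z"
  using assms(4,5)
proof (induction "length ns" arbitrary: ns z rule: less_induct)
  case (less ns0)
  let ?L = "length ns0"
  have shorter: "U.pr 0 (word True ns z) \<in> Z" if "length ns < ?L" "even (length ns)" "z \<in> Z" for ns z
    using less.hyps that by blast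
  \<comment> \<open>Two further inductions for a fixed length: on the exponent \<open>m\<close> at
    position \<open>i\<close>, and then on the distance of \<open>i\<close> from the end of the
    list, where the leftmost letter of the word stands.\<close>
  have all: "U.pr 0 (word True ns z) \<in> Z" if "length ns = ?L" "i < ?L" "ns ! i = m" "z \<in> Z" for ns i m z
    using that
  proof (induction m arbitrary: ns i z rule: less_induct)
    case (less m)
    note IHm = less.IH
    show ?case using less.prems
    proof (induction "?L - i" arbitrary: ns i z rule: less_induct)
      case (less i ns)
      note IHi = less.hyps and prems = less.prems
      have zS: "z \<in> U.S 0" using prems(4) Z by auto
      have evenL: "even ?L" by fact
      consider "i = 0" | "i = ?L - 1" "i \<noteq> 0" | "0 < i" "i + 1 < ?L" using prems(2) by linarith
      then show ?case
      proof cases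
        case 1
        obtain b ns' where ns: "ns = m # b # ns'"
          using prems(1-3) evenL 1 by (cases ns; cases "tl ns") auto
        have w: "word True ns z = word True ns' ((swap.eop ^^ b) ((eop ^^ m) z))"
          unfolding ns by simp
        consider "b < m" | "b = m" | "b > m" by linarith
        then show ?thesis
        proof cases
          assume "b < m"
          then show ?thesis using IHm[of b ns 1] prems ns by simp
        next
          assume "b = m"
          then have "word True ns z = word True ns' (sig m z)" unfolding w sig_def by simp
          moreover have "length ns' < ?L" "even (length ns')"
            using prems(1) evenL ns by (simp, metis even_Suc length_Cons)
          ultimately show ?thesis using shorter[of ns' "sig m z"] sig prems(4) by simp
        next
          assume "b > m"
          have "(swap.eop ^^ b) ((eop ^^ m) z) \<in> U.S (0 + int m - int b)"
            by (intro swap_eop_pow_S eop_pow_S zS)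
          then have "(swap.eop ^^ b) ((eop ^^ m) z) = 0" by (rule S_neg) (use \<open>b > m\<close> in simp)
          then show ?thesis unfolding w
            by (simp add: lin_zero[OF lin_word] lin_zero[OF U.lin_pr] subspace_0 Z)
        qed
      next
        case 2
        have "ns \<noteq> []" using 2 prems by auto
        then obtain ns1 where ns1: "ns = ns1 @ [m]"
          using 2 prems(1,3) by (metis append_butlast_last_id last_conv_nth)
        then have "ns1 \<noteq> []" using 2 prems(1) by auto
        then obtain ns' b where "ns1 = ns' @ [b]" by (metis append_butlast_last_id)
        then have ns: "ns = ns' @ [b, m]" using ns1 by simp
        have "?L = length ns' + 2" using ns prems(1) by simp
        then have ev: "even (length ns')" "length ns' < ?L" using evenL by auto
        define w where "w = word True ns' z"
        have w: "word True ns z = (swap.eop ^^ m) ((eop ^^ b) w)"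
          unfolding ns word_append w_def using ev by simp
        obtain k where k: "w \<in> U.S k" using word_S[OF zS] w_def by auto
        consider "b < m" | "b = m" | "b > m" by linarith
        then show ?thesis
        proof cases
          assume "b < m"
          then show ?thesis using IHm[of b ns "length ns'"] prems ns by simp
        next
          assume "b = m"
          then have "word True ns z = sig m w" unfolding w sig_def by simp
          then show ?thesis using pr_sig[OF k] shorter[OF ev(2,1) prems(4)] sig by (simp add: w_def)
        next
          assume "b > m"
          then show ?thesis unfolding w using pr_eop_swap_eop[OF _ k] by (simp add: subspace_0 Z)
        qed
      next
        case 3
        define as b a bs where "as = take (i - 1) ns" and "b = ns ! (i - 1)" and "a = ns ! (i + 1)"
          and "bs = drop (i + 2) ns"
        have ns: "ns = as @ [b, m, a] @ bs"
        proof -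
          have "ns = take (i - 1) ns @ ns ! (i - 1) # drop i ns"
            using id_take_nth_drop[of "i - 1" ns] 3 prems by simp
          also have "drop i ns = m # a # bs"
            using Cons_nth_drop_Suc[of i ns] Cons_nth_drop_Suc[of "Suc i" ns] 3 prems
            by (simp add: a_def bs_def)
          finally show ?thesis by (simp add: as_def b_def)
        qed
        have len: "length as = i - 1" using 3 prems by (simp add: as_def)
        define N where "N = a + b"
        define v where "v = word True as z"
        obtain j where j: "v \<in> U.S j" using word_S[OF zS] v_def by auto
        \<comment> \<open>\<open>F\<close> redistributes the total \<open>N\<close> of the
          neighbours of \<open>m\<close>; the given word is \<open>F a\<close>.\<close>
        define F where "F a' = U.pr 0 (word True (as @ [N - a', m, a'] @ bs) z)" for a'
        have F: "exp_sum m N F"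
        proof (cases "even (length as)")
          case True
          have "F = (\<lambda>a'. U.pr 0 (word False bs ((eop ^^ a') ((swap.eop ^^ m) ((eop ^^ (N - a')) v)))))"
            unfolding F_def word_append v_def using True by simp
          then show ?thesis
            using exp_sum_linear[OF exp_sum_eop[OF j] lin_comp[OF U.lin_pr[of 0] lin_word[of False bs]]] by simp
        next
          case False
          have "F = (\<lambda>a'. U.pr 0 (word True bs ((swap.eop ^^ a') ((eop ^^ m) ((swap.eop ^^ (N - a')) v)))))"
            unfolding F_def word_append v_def using False by simp
          then show ?thesis
            using exp_sum_linear[OF exp_sum_swap_eop[OF j] lin_comp[OF U.lin_pr[of 0] lin_word[of True bs]]] by simp
        qed
        consider "a < m" | "b < m" | "m \<le> a" "m \<le> b" by linarith
        then show ?thesis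
        proof cases
          assume "a < m" then show ?thesis using IHm[of a ns "i + 1"] prems 3 by (simp add: a_def)
        next
          assume "b < m" then show ?thesis using IHm[of b ns "i - 1"] prems 3 by (simp add: b_def)
        next
          assume ab: "m \<le> a" "m \<le> b"
          \<comment> \<open>These are \<open>2 * m + 1\<close> nodes. At each of them a neighbour of
            \<open>m\<close> becomes smaller than \<open>m\<close>, or \<open>a' = m\<close>, in
            which case \<open>m\<close> also occurs one position later.\<close>
          let ?A = "{..m} \<union> {N - m + 1..N}"
          have "F a \<in> Z"
          proof (rule exp_sum_interpolation[OF F Z(1)])
            show "?A \<subseteq> {..N}" using ab by (auto simp: N_def)
            have "card ?A = card {..m} + card {N - m + 1..N}"
              using ab by (intro card_Un_disjoint) (auto simp: N_def)
            then show "2 * m < card ?A" using ab by (simp add: N_def)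
            show "a \<le> N" by (simp add: N_def)
            fix a' assume a': "a' \<in> ?A"
            let ?ns = "as @ [N - a', m, a'] @ bs"
            have l: "length ?ns = ?L" using ns prems(1) by simp
            have n1: "?ns ! (i - 1) = N - a'" using len by (metis append_Cons nth_append_length)
            have "i + 1 = length as + 2" using len 3 by simp
            then have n2: "?ns ! (i + 1) = a'" by (simp add: nth_append)
            have "a' \<le> m \<or> N - a' < m" using a' ab by (auto simp: N_def)
            then consider "a' < m" | "a' = m" | "N - a' < m" by linarith
            then have "U.pr 0 (word True ?ns z) \<in> Z"
            proof cases
              assume "a' < m" then show ?thesis using IHm[OF _ l _ n2 prems(4)] 3 by simp
            next
              assume "a' = m"
              then show ?thesis using IHi[of "i + 1" ?ns z, OF _ l] n2 prems(4) 3 by simp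
            next
              assume "N - a' < m" then show ?thesis using IHm[OF _ l _ n1 prems(4)] 3 by simp
            qed
            then show "F a' \<in> Z" by (simp add: F_def)
          qed
          moreover have "N - a = b" by (simp add: N_def)
          ultimately show ?thesis using ns by (simp add: F_def)
        qed
      qed
    qed
  qed
  show ?case
  proof (cases "ns0 = []")
    case True
    then show ?thesis using U.pr_S[of z 0 0] less.prems Z by auto
  next
    case False
    then show ?thesis using all[of ns0 0] less.prems by simp
  qed
qed

text \<open>The words applied to \<open>Z\<close> span a subspace invariant under \<open>x\<close>
  and \<open>y\<close>, hence everything, while \<open>pr_word_mem\<close> shows that its projection
  to \<open>U.S 0\<close> stays in \<open>Z\<close>.\<close>

lemma sig_invariant_trivial:
  assumes Z: "subspace Z" "Z \<subseteq> U.S 0" and sig: "\<And>n z. z \<in> Z \<Longrightarrow> sig n z \<in> Z"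
    and "Z \<noteq> {0}"
  shows "Z = U.S 0"
proof -
  define G where "G = {word True ns z | ns z. even (length ns) \<and> z \<in> Z}"
  have G: "eop g \<in> G" "swap.eop g \<in> G" "Kop g \<in> span G" "swap.Kop g \<in> span G" if g: "g \<in> G" for g
  proof -
    obtain ns z where ns: "g = word True ns z" "even (length ns)" "z \<in> Z" using g by (auto simp: G_def)
    \<comment> \<open>The zero exponents keep the length of the list even.\<close>
    have "eop g = word True (ns @ [1, 0]) z" "swap.eop g = word True (ns @ [0, 1]) z"
      using ns by (simp_all add: word_append)
    moreover have "word True ns' z \<in> G" if "even (length ns')" for ns'
      unfolding G_def using that ns(3) by blast
    ultimately show "eop g \<in> G" "swap.eop g \<in> G" using ns(2) by simp_all
    obtain k where "g \<in> U.S k" using word_S[of z 0 True ns] ns Z by auto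
    then show "Kop g \<in> span G" "swap.Kop g \<in> span G"
      using g by (simp_all add: Kop_S swap_Kop_S span_base span_scale)
  qed
  have "x g \<in> span G" "y g \<in> span G" if "g \<in> G" for g
    using G[OF that] by (simp_all add: x_eq swap.x_eq span_add span_base)
  then have "x ` span G \<subseteq> span G" "y ` span G \<subseteq> span G"
    using lin_span_subset[OF lin_x] lin_span_subset[OF lin_y] by (metis image_subsetI subspace_span)+
  then have "span G = {0} \<or> span G = UNIV" by (rule irred[OF subspace_span])
  moreover have "Z \<subseteq> span G"
  proof
    fix z assume "z \<in> Z"
    then have "word True [] z \<in> G"
      unfolding G_def mem_Collect_eq by (intro exI[of _ "[]"] exI[of _ z]) simp
    then show "z \<in> span G" by (simp add: span_base)
  qed
  ultimately have span: "span G = UNIV"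
    using assms(4) subspace_0[OF Z(1)] by auto
  have "u \<in> Z" if "u \<in> U.S 0" for u
  proof -
    have "U.pr 0 u \<in> Z"
      by (rule lin_span_subset[OF U.lin_pr _ Z(1), of u G])
        (use span pr_word_mem[OF Z sig] in \<open>auto simp: G_def\<close>)
    then show ?thesis using U.pr_S[OF that, of 0] by simp
  qed
  then show ?thesis using Z(2) by blast
qed

text \<open>An eigenspace of \<open>sig i\<close> in \<open>U.S 0\<close> is stable under all
  \<open>sig n\<close> by commutativity, so it is all of \<open>U.S 0\<close> once it is
  nonzero.\<close>

lemma sig_scalar:
  assumes "u \<in> U.S 0" "u \<noteq> 0" "sig i u = c *s u" "v \<in> U.S 0"
  shows "sig i v = c *s v"
proof -
  let ?Z = "{v \<in> U.S 0. sig i v = c *s v}"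
  have "?Z = U.S 0 \<inter> eigsp (sig i) c" by (auto simp: eigsp_def)
  then have sub: "subspace ?Z" by (simp add: subspace_inter U.subspace_S subspace_eigsp lin_sig)
  have "?Z = U.S 0"
  proof (rule sig_invariant_trivial[OF sub])
    show "sig n z \<in> ?Z" if "z \<in> ?Z" for n z
      using that sig_S[of z 0 n] sig_commute[of z i n] by (simp add: lin_scale[OF lin_sig])
    show "?Z \<noteq> {0}" using assms(1-3) by auto
  qed auto
  then show ?thesis using assms(4) by auto
qed

end

text \<open>Take \<open>p\<close> of least degree with \<open>p(f) v = 0\<close> and split off a
  linear factor: the quotient applied to \<open>v\<close> is nonzero and is an eigenvector. It stays
  in \<open>S\<close>, being a combination of iterates of \<open>v\<close>.\<close>

lemma exists_eigenvector:
  fixes s :: "'k::alg_closed_field \<Rightarrow> 'v::ab_group_add \<Rightarrow> 'v"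
  assumes "finite_dimensional_vector_space s B" and lin: "Vector_Spaces.linear s s f"
    and S: "module.subspace s S" "\<And>w. w \<in> S \<Longrightarrow> f w \<in> S" and v: "v \<in> S" "v \<noteq> 0"
  shows "\<exists>c w. w \<in> S \<and> w \<noteq> 0 \<and> f w = s c w"
proof -
  interpret fd: finite_dimensional_vector_space s B by fact
  interpret lin_space s ..
  define g where "g k = (f ^^ k) v" for k
  have gS: "g k \<in> S" for k unfolding g_def using v(1) S(2) by (rule funpow_mem)
  define pe where "pe p = (\<Sum>k\<le>degree p. s (coeff p k) (g k))" for p
  have pe: "pe p = (\<Sum>k\<le>N. s (coeff p k) (g k))" if "degree p \<le> N" for p N
    unfolding pe_def by (rule sum.mono_neutral_left) (use that in \<open>auto simp: coeff_eq_0\<close>)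
  \<comment> \<open>Either the first \<open>dimension + 1\<close> iterates are distinct, hence
    dependent as a set, or two of them coincide.\<close>
  have "\<exists>a n. (\<exists>k\<le>n. a k \<noteq> 0) \<and> (\<Sum>k\<le>n. s (a k) (g k)) = 0"
  proof (cases "inj_on g {..fd.dimension}")
    case True
    let ?T = "g ` {..fd.dimension}"
    have "card ?T > fd.dim ?T"
      using card_image[OF True] fd.dim_subset_UNIV[of ?T] by simp
    then have "fd.dependent ?T" by (rule fd.dependent_biggerset_general)
    then obtain u where u: "\<exists>t\<in>?T. u t \<noteq> 0" "(\<Sum>t\<in>?T. s (u t) t) = 0"
      using fd.dependent_finite[of ?T] by auto
    have "(\<Sum>k\<le>fd.dimension. s (u (g k)) (g k)) = 0"
      using u(2) by (simp add: sum.reindex[OF True])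
    then show ?thesis using u(1) by (intro exI[of _ "\<lambda>k. u (g k)"] exI[of _ fd.dimension]) auto
  next
    case False
    then obtain i j where ij: "i < j" "g i = g j" by (metis inj_onI linorder_neqE_nat)
    have "(\<Sum>k\<le>j. s (if k = i then 1 else if k = j then - 1 else 0) (g k))
      = (\<Sum>k\<in>{i, j}. s (if k = i then 1 else if k = j then - 1 else 0) (g k))"
      using ij(1) by (intro sum.mono_neutral_right) auto
    then have "(\<Sum>k\<le>j. s (if k = i then 1 else if k = j then - 1 else 0) (g k)) = 0"
      using ij by simp
    then show ?thesis
      using ij(1) by (intro exI[of _ "\<lambda>k. if k = i then 1 else if k = j then - 1 else 0"] exI[of _ j]) auto
  qed
  then obtain a n where a: "\<exists>k\<le>n. a k \<noteq> 0" "(\<Sum>k\<le>n. s (a k) (g k)) = 0" by blast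
  define p0 where "p0 = (\<Sum>k\<le>n. monom (a k) k)"
  have c0: "coeff p0 k = (if k \<le> n then a k else 0)" for k
    by (simp add: p0_def coeff_sum if_distrib cong: if_cong)
  have "degree p0 \<le> n" by (rule degree_le) (simp add: c0)
  then have "pe p0 = 0" using a(2) by (simp add: pe c0)
  moreover have "p0 \<noteq> 0" using a(1) c0 by (metis coeff_0)
  ultimately have "\<exists>p. p \<noteq> 0 \<and> pe p = 0" by blast
  then obtain p where p: "p \<noteq> 0" "pe p = 0" and min: "\<And>r. r \<noteq> 0 \<Longrightarrow> pe r = 0 \<Longrightarrow> degree p \<le> degree r"
    using ex_has_least_nat[of "\<lambda>p. p \<noteq> 0 \<and> pe p = 0" _ degree] by blast
  have "degree p > 0"
  proof (rule ccontr)
    assume "\<not> degree p > 0"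
    then have "s (coeff p 0) v = 0" using p(2) by (simp add: pe_def g_def)
    then show False using v(2) p(1) \<open>\<not> degree p > 0\<close> leading_coeff_0_iff[of p] by simp
  qed
  then obtain z where "poly p z = 0" using alg_closed_imp_poly_has_root by blast
  then obtain r where r: "p = [:- z, 1:] * r" by (metis dvdE poly_eq_0_iff_dvd)
  have "r \<noteq> 0" using p(1) r by auto
  then have deg: "degree p = Suc (degree r)" unfolding r by (subst degree_mult_eq) auto
  have "pe r \<noteq> 0" using min[OF \<open>r \<noteq> 0\<close>] deg by auto
  have "f (pe r) = s z (pe r)"
  proof -
    have "pe p = (\<Sum>k\<le>Suc (degree r). s (coeff p k) (g k))" by (rule pe) (simp add: deg)
    also have "\<dots> = (\<Sum>k\<le>Suc (degree r). s (coeff (pCons 0 r) k) (g k)) - (\<Sum>k\<le>Suc (degree r). s (z * coeff r k) (g k))"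
      unfolding r by (simp only: sum_subtractf[symmetric] fd.scale_left_diff_distrib[symmetric])
        (intro sum.cong refl, simp add: coeff_pCons fd.scale_left_diff_distrib split: nat.split)
    also have "(\<Sum>k\<le>Suc (degree r). s (coeff (pCons 0 r) k) (g k)) = f (pe r)"
      by (simp add: sum.atMost_Suc_shift pe_def lin_sum[OF lin] lin_scale[OF lin] g_def del: sum.atMost_Suc)
    also have "(\<Sum>k\<le>Suc (degree r). s (z * coeff r k) (g k)) = s z (pe r)"
      by (subst pe[of r "Suc (degree r)"]) (simp_all only: fd.scale_sum_right fd.scale_scale le_SucI order_refl)
    finally show ?thesis using p(2) by simp
  qed
  moreover have "pe r \<in> S" unfolding pe_def by (intro fd.subspace_sum fd.subspace_scale S(1) gS)
  ultimately show ?thesis using \<open>pe r \<noteq> 0\<close> by blast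
qed

section \<open>The Drinfel'd polynomial\<close>

context td_pair begin

text \<open>A third choice of orderings, with the roles of \<open>x\<close> and \<open>y\<close>
  exchanged, makes these two spaces the opposite flag members \<open>LF 0\<close> and
  \<open>UE 1\<close>.\<close>

lemma eigsp_x_y_zero:
  assumes "v \<in> eigsp x (q powi (- d))" "v \<in> span (\<Union>j\<in>{1..}. eigsp y (q powi (d - 2 * j)))"
  shows "v = 0"
proof -
  have "split_decomposition (*s) y x (\<lambda>i. q powi (d - 2 * i)) (\<lambda>i. q powi (2 * i - d)) d"
    by (rule swap.split_dir[OF swap.dir_cases(2) swap.dir_cases(1)])
  then interpret V: split_decomposition "(*s)" y x "\<lambda>i. q powi (d - 2 * i)" "\<lambda>i. q powi (2 * i - d)" d .
  have "v \<in> V.LF 0" using V.eigsp_LF[of 0 0] assms(1) by auto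
  moreover have "v \<in> V.UE 1" using assms(2) by (simp add: V.UE_def)
  ultimately show ?thesis using V.LF_UE_zero[of 0 1] by auto
qed

text \<open>Modulo the sum of the \<open>y\<close>-eigenspaces other than the one for
  \<open>q powi d\<close>, \<open>y\<close> acts as \<open>q powi d\<close>. Hence
  \<open>swap.eop = y - swap.Kop\<close> acts on vectors of degree \<open>j\<close> as the scalar
  \<open>q powi d - q powi (d - 2 * j)\<close>; the product collects the steps from \<open>k\<close>
  down to \<open>1\<close>.\<close>

lemma swap_eop_pow_mod:
  assumes "w \<in> U.S (int k)"
  shows "w - inverse (\<Prod>j\<in>{1..k}. q powi d - q powi (d - 2 * int j)) *s (swap.eop ^^ k) w
    \<in> span (\<Union>j\<in>{1..}. eigsp y (q powi (d - 2 * j)))"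
  using assms
proof (induction k arbitrary: w)
  case 0 then show ?case by (simp add: span_zero)
next
  case (Suc k)
  let ?R = "span (\<Union>j\<in>{1..}. eigsp y (q powi (d - 2 * j)))"
  let ?c = "\<Prod>j\<in>{1..k}. q powi d - q powi (d - 2 * int j)"
  let ?t = "q powi d - q powi (d - 2 * int (Suc k))"
  have "\<not> q powi d = q powi (d - 2 * int (Suc k))" by simp
  then have t: "?t \<noteq> 0" by (simp only: right_minus_eq simp_thms)
  have "(\<Union>j. eigsp y (q powi (d - 2 * j))) \<subseteq> eigsp y (q powi d) \<union> ?R"
  proof
    fix v assume "v \<in> (\<Union>j. eigsp y (q powi (d - 2 * j)))"
    then obtain j where j: "v \<in> eigsp y (q powi (d - 2 * j))" by auto
    consider "j < 0" | "j = 0" | "j \<ge> 1" by linarith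
    then show "v \<in> eigsp y (q powi d) \<union> ?R"
    proof cases
      case 1 then have "v = 0" using j U.eig_B_out[of j] by auto
      then show ?thesis by (simp add: span_zero)
    next
      case 2 then show ?thesis using j by simp
    next
      case 3 then show ?thesis using j by (auto intro: span_base)
    qed
  qed
  then have "span (eigsp y (q powi d) \<union> ?R) = UNIV"
    using U.span_B span_mono by (metis top.extremum_uniqueI)
  then obtain w0 w1 where w: "w = w0 + w1" "w0 \<in> eigsp y (q powi d)" "w1 \<in> ?R"
    using span_Un[of "eigsp y (q powi d)" ?R] subspace_eigsp[OF lin_y]
    by (smt (verit, best) UNIV_I mem_Collect_eq span_eq_iff span_span)
  have yR: "y v \<in> ?R" if "v \<in> ?R" for v
  proof (rule lin_span_subset[OF lin_y that])
    fix v assume "v \<in> (\<Union>j\<in>{1..}. eigsp y (q powi (d - 2 * j)))"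
    then obtain j where j: "j \<ge> 1" "v \<in> eigsp y (q powi (d - 2 * j))" by auto
    then have "v \<in> ?R" by (auto intro: span_base)
    then show "y v \<in> ?R" unfolding eigspD[OF j(2)] by (rule span_scale)
  qed simp
  define r where "r = y w1 - q powi (d - 2 * int (Suc k)) *s w1"
  have r: "r \<in> ?R" unfolding r_def using yR[OF w(3)] w(3) by (intro span_diff span_scale)
  have "swap.eop w = y w - q powi (d - 2 * int (Suc k)) *s w"
    unfolding swap.eop_def by (simp only: swap_Kop_S[OF Suc.prems])
  also have "\<dots> = ?t *s w0 + r"
    unfolding w(1) lin_add[OF lin_y] eigspD[OF w(2)] r_def scale_right_distrib scale_left_diff_distrib
    by simp
  finally have fw: "swap.eop w = ?t *s w0 + r" .
  have "swap.eop w \<in> U.S (int k)" using swap_eop_S[OF Suc.prems] by simp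
  from Suc.IH[OF this] have "swap.eop w - inverse ?c *s (swap.eop ^^ Suc k) w \<in> ?R"
    by (simp add: funpow_swap1)
  from span_diff[OF this r] have "?t *s w0 - inverse ?c *s (swap.eop ^^ Suc k) w \<in> ?R"
    unfolding fw by (simp add: algebra_simps)
  from span_scale[OF this, of "inverse ?t"]
  have "w0 - (inverse ?t * inverse ?c) *s (swap.eop ^^ Suc k) w \<in> ?R"
    using t by (simp only: scale_right_diff_distrib scale_scale left_inverse scale_one not_False_eq_True)
  from span_add[OF this w(3)] have "w - (inverse ?t * inverse ?c) *s (swap.eop ^^ Suc k) w \<in> ?R"
    unfolding w(1) by (simp add: algebra_simps)
  moreover have "inverse ?t * inverse ?c = inverse (\<Prod>j\<in>{1..Suc k}. q powi d - q powi (d - 2 * int j))"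
    by (simp add: mult.commute)
  ultimately show ?case by (simp only:)
qed

lemma eop_pow_zero:
  assumes "u \<in> U.S 0" "nat d < k"
  shows "(eop ^^ k) u = 0"
  using eop_pow_S[OF assms(1), of k] U.S_out[of "int k"] assms(2) by auto

text \<open>Comparing components in \<open>x v = q powi (- d) *s v\<close> gives a two-term
  recursion whose solution with \<open>t 0 = 1\<close> is the given product. The component of degree
  \<open>0\<close> is \<open>u\<close>, so \<open>v\<close> is nonzero.\<close>

lemma x_eigenvector:
  assumes u: "u \<in> U.S 0" "u \<noteq> 0"
  defines "t \<equiv> \<lambda>k. inverse (\<Prod>j\<in>{1..k}. (1 - q powi (2 * int j)) * q powi (- d))"
  defines "v \<equiv> \<Sum>k\<le>nat d. t k *s (eop ^^ k) u"
  shows "v \<in> eigsp x (q powi (- d))" "v \<noteq> 0"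
proof -
  have ne: "1 - q powi (2 * int (Suc k)) \<noteq> 0" for k
    using qpow_eq_1_iff[of "2 * int (Suc k)"] by (simp del: of_nat_Suc) 
  have t: "t (Suc k) * q powi (2 * int (Suc k) - d) + t k = q powi (- d) * t (Suc k)" for k
  proof -
    have 1: "t k = t (Suc k) * ((1 - q powi (2 * int (Suc k))) * q powi (- d))"
    proof -
      have "t (Suc k) = t k * inverse ((1 - q powi (2 * int (Suc k))) * q powi (- d))"
        unfolding t_def by (simp add: prod.nat_ivl_Suc' mult.commute)
      then show ?thesis using ne[of k] by (simp only: mult.assoc left_inverse mult_eq_0_iff qpow_nz simp_thms mult_1_right)
    qed
    have 2: "q powi (2 * int (Suc k) - d) = q powi (2 * int (Suc k)) * q powi (- d)"
      unfolding qpow_mult by simp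
    show ?thesis unfolding 2 by (subst 1) algebra
  qed
  let ?w = "\<lambda>k. (eop ^^ k) u"
  have xw: "x (?w k) = ?w (Suc k) + q powi (2 * int k - d) *s ?w k" for k
    using eop_pow_S[OF u(1), of k] by (simp add: x_eq Kop_S)
  have "x v = (\<Sum>k\<le>nat d. t k *s ?w (Suc k)) + (\<Sum>k\<le>nat d. (t k * q powi (2 * int k - d)) *s ?w k)"
    unfolding v_def lin_sum[OF lin_x] lin_scale[OF lin_x] xw scale_right_distrib scale_scale sum.distrib ..
  also have "(\<Sum>k\<le>nat d. t k *s ?w (Suc k)) = (\<Sum>k<nat d. t k *s ?w (Suc k))"
    using eop_pow_zero[OF u(1), of "Suc (nat d)"] by (simp add: lessThan_Suc_atMost[symmetric] del: funpow.simps)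
  also have "(\<Sum>k\<le>nat d. (t k * q powi (2 * int k - d)) *s ?w k)
    = t 0 *s (q powi (- d) *s ?w 0) + (\<Sum>k<nat d. (t (Suc k) * q powi (2 * int (Suc k) - d)) *s ?w (Suc k))"
    by (simp add: lessThan_Suc_atMost[symmetric] sum.lessThan_Suc_shift del: sum.lessThan_Suc funpow.simps of_nat_Suc)
  also have "(\<Sum>k<nat d. t k *s ?w (Suc k)) + (t 0 *s (q powi (- d) *s ?w 0)
     + (\<Sum>k<nat d. (t (Suc k) * q powi (2 * int (Suc k) - d)) *s ?w (Suc k)))
    = q powi (- d) *s (t 0 *s ?w 0) + (\<Sum>k<nat d. q powi (- d) *s (t (Suc k) *s ?w (Suc k)))"
  proof -
    have "t k *s ?w (Suc k) + (t (Suc k) * q powi (2 * int (Suc k) - d)) *s ?w (Suc k)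
      = q powi (- d) *s (t (Suc k) *s ?w (Suc k))" for k
      unfolding scale_scale t[symmetric] by (simp only: scale_left_distrib add.commute)
    then have *: "(\<Sum>k<nat d. t k *s ?w (Suc k)) + (\<Sum>k<nat d. (t (Suc k) * q powi (2 * int (Suc k) - d)) *s ?w (Suc k))
      = (\<Sum>k<nat d. q powi (- d) *s (t (Suc k) *s ?w (Suc k)))"
      by (simp only: sum.distrib[symmetric])
    have "a + (c + b) = c + e" if "a + b = e" for a b c e :: 'v
      using that by (simp add: add.left_commute)
    from this[OF *] show ?thesis unfolding scale_left_commute[of "t 0"] .
  qed
  also have "\<dots> = q powi (- d) *s v"
    unfolding v_def scale_sum_right[symmetric] scale_right_distrib[symmetric]
    by (simp add: lessThan_Suc_atMost[symmetric] sum.lessThan_Suc_shift del: sum.lessThan_Suc funpow.simps)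
  finally show "v \<in> eigsp x (q powi (- d))" by (rule eigspI)
  have "U.pr 0 v = (\<Sum>k\<le>nat d. if k = 0 then u else 0)"
    unfolding v_def lin_sum[OF U.lin_pr] lin_scale[OF U.lin_pr]
  proof (rule sum.cong[OF refl])
    fix k
    show "t k *s U.pr 0 (?w k) = (if k = 0 then u else 0)"
      using U.pr_S[OF eop_pow_S[OF u(1), of k], of 0] by (simp add: t_def)
  qed
  then show "v \<noteq> 0" using u(2) by (auto simp: lin_zero[OF U.lin_pr])
qed

text \<open>Lift \<open>u\<close> to the \<open>x\<close>-eigenvector \<open>v\<close> of
  \<open>x_eigenvector\<close> and reduce it modulo the lower \<open>y\<close>-eigenspaces by
  \<open>swap_eop_pow_mod\<close>. The result is \<open>u\<close> times this sum; if the sum were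
  zero, \<open>v\<close> would contradict \<open>eigsp_x_y_zero\<close>.\<close>

lemma sigma_sum_nonzero:
  assumes "\<And>k v. v \<in> U.S 0 \<Longrightarrow> sig k v = \<sigma> k *s v"
  shows "(\<Sum>k\<le>nat d. \<sigma> k * inverse (\<Prod>j\<in>{1..k}. (1 - q powi (2 * int j)) * (1 - q powi (- 2 * int j)))) \<noteq> 0"
proof
  let ?R = "span (\<Union>j\<in>{1..}. eigsp y (q powi (d - 2 * j)))"
  let ?t = "\<lambda>k. inverse (\<Prod>j\<in>{1..k}. (1 - q powi (2 * int j)) * q powi (- d))"
  let ?c = "\<lambda>k. inverse (\<Prod>j\<in>{1..k}. q powi d - q powi (d - 2 * int j))"
  let ?p = "\<lambda>k. inverse (\<Prod>j\<in>{1..k}. (1 - q powi (2 * int j)) * (1 - q powi (- 2 * int j)))"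
  assume sum0: "(\<Sum>k\<le>nat d. \<sigma> k * ?p k) = 0"
  obtain u where u: "u \<in> U.S 0" "u \<noteq> 0" using UNIV_nontrivial by blast
  define v where "v = (\<Sum>k\<le>nat d. ?t k *s (eop ^^ k) u)"
  have tc: "?t k * ?c k = ?p k" for k
    unfolding inverse_mult_distrib[symmetric] prod.distrib[symmetric]
  proof (intro arg_cong[of _ _ inverse] prod.cong refl)
    fix j
    have "q powi (- d) * q powi d = 1" "q powi (- d) * q powi (d - 2 * int j) = q powi (- 2 * int j)"
      unfolding qpow_mult by simp_all
    then show "(1 - q powi (2 * int j)) * q powi (- d) * (q powi d - q powi (d - 2 * int j))
      = (1 - q powi (2 * int j)) * (1 - q powi (- 2 * int j))" by algebra
  qed
  have "v - (\<Sum>k\<le>nat d. (\<sigma> k * ?p k) *s u) \<in> ?R"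
    unfolding v_def sum_subtractf[symmetric]
  proof (rule span_sum)
    fix k
    have "(eop ^^ k) u - ?c k *s (swap.eop ^^ k) ((eop ^^ k) u) \<in> ?R"
      by (rule swap_eop_pow_mod) (use eop_pow_S[OF u(1), of k] in simp)
    then have "?t k *s ((eop ^^ k) u - ?c k *s (swap.eop ^^ k) ((eop ^^ k) u)) \<in> ?R"
      by (rule span_scale)
    moreover have "(swap.eop ^^ k) ((eop ^^ k) u) = \<sigma> k *s u"
      using assms[OF u(1), of k] by (simp only: sig_def)
    moreover have "?t k *s (?c k *s (\<sigma> k *s u)) = (\<sigma> k * ?p k) *s u"
      unfolding scale_scale tc[symmetric] by (simp only: mult_ac)
    ultimately show "?t k *s (eop ^^ k) u - (\<sigma> k * ?p k) *s u \<in> ?R"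
      by (simp only: scale_right_diff_distrib)
  qed
  then have "v \<in> ?R" unfolding scale_sum_left[symmetric] sum0 by simp
  then show False using eigsp_x_y_zero[of v] x_eigenvector[OF u] unfolding v_def by blast
qed

text \<open>At this point the value of the polynomial is the sum in
  \<open>sigma_sum_nonzero\<close>, because
  \<open>(1 - q^(2j)) (1 - q^(-2j)) = - (q^j - q^(-j))^2\<close> turns the product over
  \<open>j\<close> into a squared \<open>q\<close>-factorial.\<close>

lemma poly_drinfeld_act:
  assumes scalar: "\<And>k v. v \<in> U.S 0 \<Longrightarrow> sig k v = \<sigma> k *s v"
  shows "poly (drinfeld_poly (*s) q Uq_act) (inverse q * inverse ((q - inverse q)\<^sup>2)) \<noteq> 0"
proof -
  let ?z = "inverse q * inverse ((q - inverse q)\<^sup>2)"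
  let ?p = "\<lambda>k. inverse (\<Prod>j\<in>{1..k}. (1 - q powi (2 * int j)) * (1 - q powi (- 2 * int j)))"
  obtain u where u: "u \<in> U.S 0" "u \<noteq> 0" using UNIV_nontrivial by blast
  have sigma: "Uq_sigma (*s) q Uq_act k = \<sigma> k" for k
    unfolding Uq_sigma_def Uq_U0_act
  proof (rule the_equality)
    show "\<forall>v\<in>U.S 0. (Uq_act (E_plus N1) ^^ k) ((Uq_act (E_plus N0) ^^ k) v) = \<sigma> k *s v"
      using scalar by (simp add: sig_def)
    fix c assume "\<forall>v\<in>U.S 0. (Uq_act (E_plus N1) ^^ k) ((Uq_act (E_plus N0) ^^ k) v) = c *s v"
    then have "sig k u = c *s u" using u(1) by (simp add: sig_def)
    then show "c = \<sigma> k" using scalar[OF u(1), of k] u(2) by simp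
  qed
  have zero: "\<sigma> k = 0" if "nat d < k" for k
    using scalar[OF u(1), of k] eop_pow_zero[OF u(1) that] u(2)
    by (simp add: sig_def lin_zero[OF lin_funpow[OF swap.lin_eop]])
  have coeff: "(- 1) ^ k * \<sigma> k * q ^ k / (q_fact q k)\<^sup>2 * ?z ^ k = \<sigma> k * ?p k" for k
  proof -
    have j: "(1 - q powi (2 * int j)) * (1 - q powi (- 2 * int j))
      = - ((q - inverse q)\<^sup>2 * (q_int q j)\<^sup>2)" for j
    proof -
      have "(q - inverse q)\<^sup>2 * (q_int q j)\<^sup>2 = (q ^ j - inverse q ^ j)\<^sup>2"
        using q_diff_nz by (simp add: q_int_def power_mult_distrib[symmetric])
      moreover have "q powi (2 * int j) = (q ^ j)\<^sup>2" "q powi (- 2 * int j) = (inverse q ^ j)\<^sup>2"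
        by (simp_all add: power_int_mult power_int_minus power_mult[symmetric] power_inverse mult.commute)
      moreover have "q ^ j * inverse q ^ j = 1" using q_nz by (simp add: power_mult_distrib[symmetric])
      moreover have "(1 - a\<^sup>2) * (1 - b\<^sup>2) = - ((a - b)\<^sup>2)" if "a * b = 1" for a b :: 'k
        using that by algebra
      ultimately show ?thesis by simp
    qed
    have "(\<Prod>j\<in>{1..k}. (1 - q powi (2 * int j)) * (1 - q powi (- 2 * int j)))
      = (- 1) ^ k * (((q - inverse q)\<^sup>2) ^ k * (q_fact q k)\<^sup>2)"
    proof (induction k)
      case (Suc k)
      have "(\<Prod>j\<in>{1..Suc k}. F j) = F (Suc k) * (\<Prod>j\<in>{1..k}. F j)" for F :: "nat \<Rightarrow> 'k"
        by (simp add: prod.nat_ivl_Suc')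
      note * = this
      show ?case using Suc unfolding * j q_fact_def by (simp add: power_mult_distrib mult_ac)
    qed (simp add: q_fact_def)
    moreover have "inverse ((- 1 :: 'k) ^ k) = (- 1) ^ k"
      by (metis power_inverse inverse_minus_eq inverse_1)
    ultimately have "?p k = (- 1) ^ k * (inverse ((q - inverse q)\<^sup>2) ^ k * inverse ((q_fact q k)\<^sup>2))"
      by (simp add: inverse_mult_distrib power_inverse)
    moreover have "q ^ k * inverse q ^ k = 1" using q_nz by (simp add: power_mult_distrib[symmetric])
    moreover have "e * e = 1 \<Longrightarrow> a * b = 1 \<Longrightarrow> e * c * a * f * (b * g) = c * (e * (g * f))" for a b c e f g :: 'k
      by algebra
    ultimately show ?thesis
      unfolding power_mult_distrib divide_inverse by simp
  qed
  have "poly (drinfeld_poly (*s) q Uq_act) ?z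
    = (\<Sum>k | \<sigma> k \<noteq> 0. (- 1) ^ k * \<sigma> k * q ^ k / (q_fact q k)\<^sup>2 * ?z ^ k)"
    by (simp only: drinfeld_poly_def sigma poly_sum poly_monom)
  also have "\<dots> = (\<Sum>k | \<sigma> k \<noteq> 0. \<sigma> k * ?p k)"
    by (simp only: coeff)
  also have "\<dots> = (\<Sum>k\<le>nat d. \<sigma> k * ?p k)"
    by (rule sum.mono_neutral_left) (use zero in \<open>auto simp: not_less[symmetric]\<close>)
  finally show ?thesis using sigma_sum_nonzero[OF scalar] by simp
qed

end

section \<open>Existence, uniqueness, irreducibility, type and the Drinfel'd value combined\<close>

theorem theorem1p6:
  fixes q :: "'k::{alg_closed_field, field_char_0}"
    and s :: "'k \<Rightarrow> 'v::ab_group_add \<Rightarrow> 'v"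
    and B :: "'v set"
    and x y :: "'v \<Rightarrow> 'v"
  assumes "q \<noteq> 0" and "\<not> root_of_unity q"
    and "finite_dimensional_vector_space s B"
    and "Aq_module s q x y"
    and "Aq_irreducible s x y"
    and "NonNil x y"
    and "Aq_has_type s q x y (1, 1)"
  shows "(\<exists>!\<rho>. Uq_module s q \<rho> \<and> Aq_acts_via x y \<rho>) \<and>
         (\<forall>\<rho>. Uq_module s q \<rho> \<and> Aq_acts_via x y \<rho> \<longrightarrow>
            Uq_irreducible s \<rho> \<and>
            Uq_has_type s q \<rho> (1, 1) \<and>
            poly (drinfeld_poly s q \<rho>) (inverse q * inverse ((q - inverse q)\<^sup>2)) \<noteq> 0)"
proof -
  interpret fd: finite_dimensional_vector_space s B by fact
  interpret qs: q_space s q by unfold_locales (use assms in auto)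
  obtain d :: nat where
    ex: "eigenvalues s x = {1 * q powi (int d - 2 * int i) | i. i \<le> d}" and
    ey: "eigenvalues s y = {1 * q powi (int d - 2 * int i) | i. i \<le> d}"
    using assms(7) by (auto simp: Aq_has_type_def)
  have eig: "qs.eigsp f c \<noteq> {0} \<longleftrightarrow> (\<exists>i\<in>{0..int d}. c = q powi (2 * i - int d))"
    if f: "qs.lin f" "eigenvalues s f = {1 * q powi (int d - 2 * int i) | i. i \<le> d}" for f c
  proof -
    have "qs.eigsp f c \<noteq> {0} \<longleftrightarrow> c \<in> eigenvalues s f"
      using qs.lin_zero[OF f(1)] by (auto simp: eigenvalues_def qs.eigsp_def)
    also have "\<dots> \<longleftrightarrow> (\<exists>i\<in>{0..int d}. c = q powi (2 * i - int d))"
      unfolding f(2)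
    proof safe
      fix i assume "i \<le> d"
      then show "\<exists>j\<in>{0..int d}. 1 * q powi (int d - 2 * int i) = q powi (2 * j - int d)"
        by (intro bexI[of _ "int d - int i"]) auto
    next
      fix j assume "j \<in> {0..int d}"
      then show "\<exists>i. q powi (2 * j - int d) = 1 * q powi (int d - 2 * int i) \<and> i \<le> d"
        by (intro exI[of _ "nat (int d - j)"]) auto
    qed
    finally show ?thesis .
  qed
  have lin: "qs.lin x" "qs.lin y" and serre: "q_serre s q x y" "q_serre s q y x"
    using assms(4) by (auto simp: Aq_module_def)
  interpret td_pair s q x y "int d"
  proof (rule td_pair.intro[OF qs.q_space_axioms], rule td_pair_axioms.intro)
    show "W = {0} \<or> W = UNIV" if "fd.subspace W" "x ` W \<subseteq> W" "y ` W \<subseteq> W" for W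
      using assms(5) that by (auto simp: Aq_irreducible_def irreducible_under_def)
  qed (use lin serre eig[OF lin(1) ex] eig[OF lin(2) ey] in \<open>auto\<close>)
  \<comment> \<open>One eigenvector of \<open>sig k\<close> in \<open>U.S 0\<close> exists because
    the field is algebraically closed; \<open>sig_scalar\<close> then makes \<open>sig k\<close>
    scalar on the whole space.\<close>
  have "\<exists>c. \<forall>v\<in>U.S 0. sig k v = s c v" for k
  proof -
    obtain u where u: "u \<in> U.S 0" "u \<noteq> 0" using UNIV_nontrivial by blast
    then obtain c w where "w \<in> U.S 0" "w \<noteq> 0" "sig k w = s c w"
      using exists_eigenvector[OF assms(3) lin_sig U.subspace_S sig_S u] by blast
    then show ?thesis using sig_scalar by blast
  qed
  then obtain \<sigma> where \<sigma>: "\<And>k v. v \<in> U.S 0 \<Longrightarrow> sig k v = s (\<sigma> k) v" by metis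
  have "Uq_has_type s q Uq_act (1, 1)"
    using Uq_decomposition_act unfolding Uq_has_type_def by blast
  then show ?thesis
    using Uq_module_act Aq_acts_via_act Uq_act_unique Uq_irreducible_act poly_drinfeld_act[OF \<sigma>] by blast
qed

end
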